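(* There exists an efficient (polynomial-time) reduction that maps a $3$-CNF formula $\phi$ (a $\mathsf{3SAT}$ instance) with $N$ variables and $M$ clauses to an input $(\Pi, t, u, H(u,t))$ of the problem $\mathsf{BAY}$ in the binary action model such that: (i) the directed graph $G$ of $\Pi$ has $O(N+M)$ agents and edges, the time is $t=2$, and the agent $u$ does not receive a private signal; (ii) all probabilities of private signals are efficiently computable real numbers satisfying $\exp(-O(N)) \le p_{\theta_0}(v) \le 1-\exp(-O(N))$ for all agents $v \in V$ and $\theta_0 \in \{\mathsf{T},\mathsf{F}\}$; (iii) if $\phi$ is satisfiable, then the posterior satisfies $\mu(u,2) = 1-\exp(-\Theta(N))$; (iv) if $\phi$ is not satisfiable, then $\mu(u,2) = \exp(-\Theta(N))$.
   Context: Binary action model: A Bayesian network $\Pi$ consists of a directed graph $G=(V,E)$ (vertices are agents) together with a signal structure. A hidden state of the world $\theta \in \{\mathsf{T},\mathsf{F}\}$ has uniform prior. At time $0$ each agent $v$ receives a private signal $S(v)\in\{0,1\}$; the signals are independent across agents conditioned on $\theta$, with signal probabilities $p_{\theta_0}(v) = \Pr[S(v)=1 \mid \theta=\theta_0]$, where $p_{\mathsf{T}}(v) > p_{\mathsf{F}}(v)$ for informative signals; an agent "does not receive a private signal" means its signal is non-informative ($p_{\mathsf{T}}(v)=p_{\mathsf{F}}(v)$). If $(v,w)\in E$, agent $v$ observes agent $w$; $\mathcal{N}(v)$ denotes the out-neighbors of $v$. At each time $t=0,1,2,\dots$, each agent $v$ has belief $\mu(v,t) = \Pr[\theta=\mathsf{T}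 \mid S(v), H(v,t)]$, where $H(v,t) = \{A(w,t') : t'<t, w \in \mathcal{N}(v)\}$ is its observation history, and simultaneously broadcasts the action $A(v,t)\in\{\mathsf{T},\mathsf{F}\}$, with $A(v,t)=\mathsf{T}$ iff $\mu(v,t)>1/2$ (ties broken deterministically, say toward $\mathsf{F}$). All agents are rational and the model, the network and rationality are common knowledge. $\mathsf{BAY}(\Pi,t,u,S(u),H(u,t)) := A(u,t)$ is the problem of computing the action of agent $u$ at time $t$ from the network, $u$'s private signal and its observation history (when $u$ has no private signal, the input is $(\Pi,t,u,H(u,t))$); $\mathsf{BAYAB}$ denotes the corresponding problem of computing the belief $\mu(u,t)$. *)

theory Defs
  imports Complex_Main
begin

text \<open>Tape symbols are natural numbers below tm_syms; 0 is the blank, 1 encodes the bit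
  False and 2 encodes the bit True.  State 0 is the start state and state 1 the halting state.
  Moves: -1 (left), 0 (stay), 1 (right).\<close>

record tm =
  tm_states :: nat
  tm_syms :: nat
  tm_delta :: "nat \<Rightarrow> nat \<Rightarrow> nat \<times> nat \<times> int"

definition tm_wf :: "tm \<Rightarrow> bool" where
  "tm_wf M \<longleftrightarrow> 2 \<le> tm_states M \<and> 3 \<le> tm_syms M \<and>
     (\<forall>q < tm_states M. \<forall>a < tm_syms M.
        (case tm_delta M q a of (q', b, d) \<Rightarrow>
           q' < tm_states M \<and> b < tm_syms M \<and> d \<in> {-1, 0, 1}))"

text \<open>Configuration: (state, tape left of the head in reverse order, tape from the head on).\<close>
type_synonym tm_config = "nat \<times> nat list \<times> nat list"

definition tm_step :: "tm \<Rightarrow> tm_config \<Rightarrow> tm_config" where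
  "tm_step M c = (case c of (q, l, r) \<Rightarrow>
     (if q = 1 then (q, l, r) else
      (let a = (case r of [] \<Rightarrow> 0 | x # _ \<Rightarrow> x) in
       (case tm_delta M q a of (q', b, d) \<Rightarrow>
         (if d = -1 then (case l of [] \<Rightarrow> (q', [], 0 # b # drop 1 r)
                                   | x # l' \<Rightarrow> (q', l', x # b # drop 1 r))
          else if d = 1 then (q', b # l, drop 1 r)
          else (q', l, b # drop 1 r))))))"

definition tm_init :: "bool list \<Rightarrow> tm_config" where
  "tm_init x = (0, [], map (\<lambda>b. if b then 2 else 1) x)"

definition tm_output :: "tm_config \<Rightarrow> bool list" where
  "tm_output c = (case c of (q, l, r) \<Rightarrow>
     map (\<lambda>s. s = 2) (takeWhile (\<lambda>s. s = 1 \<or> s = 2) r))"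

definition tm_computes_in :: "tm \<Rightarrow> bool list \<Rightarrow> bool list \<Rightarrow> nat \<Rightarrow> bool" where
  "tm_computes_in M x y T \<longleftrightarrow>
     (\<exists>n \<le> T. fst ((tm_step M ^^ n) (tm_init x)) = 1 \<and> tm_output ((tm_step M ^^ n) (tm_init x)) = y)"

definition poly_time_on :: "('a \<Rightarrow> bool) \<Rightarrow> ('a \<Rightarrow> bool list) \<Rightarrow> ('a \<Rightarrow> bool list) \<Rightarrow> bool" where
  "poly_time_on P enc f \<longleftrightarrow>
     (\<exists>M c k. tm_wf M \<and> (\<forall>x. P x \<longrightarrow> tm_computes_in M (enc x) (f x) (c * (length (enc x) + 1) ^ k)))"

fun bits :: "nat \<Rightarrow> bool list" where
  "bits n = (if n = 0 then [] else odd n # bits (n div 2))"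

text \<open>Self-delimiting binary encoding of natural numbers and integers.\<close>
definition enc_nat :: "nat \<Rightarrow> bool list" where
  "enc_nat n = concat (map (\<lambda>b. [True, b]) (bits n)) @ [False, False]"

definition enc_unary :: "nat \<Rightarrow> bool list" where
  "enc_unary n = replicate n True @ [False]"

definition enc_int :: "int \<Rightarrow> bool list" where
  "enc_int z = (0 \<le> z) # enc_nat (nat \<bar>z\<bar>)"

definition enc_list :: "('a \<Rightarrow> bool list) \<Rightarrow> 'a list \<Rightarrow> bool list" where
  "enc_list enc xs = concat (map (\<lambda>x. True # enc x) xs) @ [False]"

text \<open>A CNF formula is (N, clauses): N is the number of variables x_0, ..., x_(N-1); a literal
  (v, True) is x_v and (v, False) is the negation of x_v.\<close>
type_synonym cnf = "nat \<times> (nat \<times> bool) list list"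

definition num_vars :: "cnf \<Rightarrow> nat" where "num_vars \<phi> = fst \<phi>"
definition num_clauses :: "cnf \<Rightarrow> nat" where "num_clauses \<phi> = length (snd \<phi>)"

definition is_3cnf :: "cnf \<Rightarrow> bool" where
  "is_3cnf \<phi> \<longleftrightarrow> (\<forall>c \<in> set (snd \<phi>). length c \<le> 3 \<and> (\<forall>(v, s) \<in> set c. v < fst \<phi>))"

definition satisfiable :: "cnf \<Rightarrow> bool" where
  "satisfiable \<phi> \<longleftrightarrow> (\<exists>\<alpha> :: nat \<Rightarrow> bool. \<forall>c \<in> set (snd \<phi>). \<exists>(v, s) \<in> set c. \<alpha> v = s)"

text \<open>N is written in unary (so the input length is at least N + M); variable indices in binary.\<close>
definition enc_cnf :: "cnf \<Rightarrow> bool list" where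
  "enc_cnf \<phi> = enc_unary (fst \<phi>) @
     enc_list (enc_list (\<lambda>(v, s). enc_nat v @ [s])) (snd \<phi>)"

text \<open>Agents are 0, ..., n_agents-1; (v, w) in edges means v observes w.  The state
  theta is a bool (True = T, False = F); p_T(v) = pT v, p_F(v) = pF v.\<close>
record bnet =
  n_agents :: nat
  edges :: "(nat \<times> nat) list"
  pT :: "nat \<Rightarrow> real"
  pF :: "nat \<Rightarrow> real"

definition sig_prob :: "bnet \<Rightarrow> bool \<Rightarrow> nat \<Rightarrow> real" where
  "sig_prob \<Pi> \<theta> v = (if \<theta> then pT \<Pi> v else pF \<Pi> v)"

definition bnet_wf :: "bnet \<Rightarrow> bool" where
  "bnet_wf \<Pi> \<longleftrightarrow> (\<forall>(v, w) \<in> set (edges \<Pi>). v < n_agents \<Pi> \<and> w < n_agents \<Pi>) \<and>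
     (\<forall>v < n_agents \<Pi>. 0 \<le> pF \<Pi> v \<and> pF \<Pi> v \<le> pT \<Pi> v \<and> pT \<Pi> v \<le> 1)"

definition no_signal :: "bnet \<Rightarrow> nat \<Rightarrow> bool" where
  "no_signal \<Pi> v \<longleftrightarrow> pT \<Pi> v = pF \<Pi> v"

definition observes :: "bnet \<Rightarrow> nat \<Rightarrow> nat \<Rightarrow> bool" where
  "observes \<Pi> v w \<longleftrightarrow> (v, w) \<in> set (edges \<Pi>)"

text \<open>Signal profiles: S(v) = True means S(v) = 1.\<close>
definition profiles :: "bnet \<Rightarrow> (nat \<Rightarrow> bool) set" where
  "profiles \<Pi> = {s. \<forall>v. n_agents \<Pi> \<le> v \<longrightarrow> \<not> s v}"

text \<open>Pr[theta, S = s] (uniform prior, signals independent given theta).\<close>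
definition weight :: "bnet \<Rightarrow> bool \<Rightarrow> (nat \<Rightarrow> bool) \<Rightarrow> real" where
  "weight \<Pi> \<theta> s = (1/2) * (\<Prod>v < n_agents \<Pi>. if s v then sig_prob \<Pi> \<theta> v else 1 - sig_prob \<Pi> \<theta> v)"

definition prob :: "bnet \<Rightarrow> (bool \<Rightarrow> (nat \<Rightarrow> bool) \<Rightarrow> bool) \<Rightarrow> real" where
  "prob \<Pi> E = (\<Sum>\<theta> \<in> UNIV. \<Sum>s \<in> profiles \<Pi>. if E \<theta> s then weight \<Pi> \<theta> s else 0)"

text \<open>An action profile over time: a list whose t-th entry maps (agent, signal profile)
  to the action A(agent, t) (True = T).  The event that agent v's observation history
  (actions of its out-neighbours at times before length prev) equals h, where h w t' is the
  observed action A(w, t').\<close>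
definition hist_consistent ::
  "bnet \<Rightarrow> (nat \<Rightarrow> (nat \<Rightarrow> bool) \<Rightarrow> bool) list \<Rightarrow> nat \<Rightarrow> (nat \<Rightarrow> nat \<Rightarrow> bool) \<Rightarrow> (nat \<Rightarrow> bool) \<Rightarrow> bool" where
  "hist_consistent \<Pi> prev v h s \<longleftrightarrow>
     (\<forall>w t'. observes \<Pi> v w \<and> t' < length prev \<longrightarrow> (prev ! t') w s = h w t')"

definition belief_from ::
  "bnet \<Rightarrow> (nat \<Rightarrow> (nat \<Rightarrow> bool) \<Rightarrow> bool) list \<Rightarrow> nat \<Rightarrow> bool \<Rightarrow> (nat \<Rightarrow> nat \<Rightarrow> bool) \<Rightarrow> real" where
  "belief_from \<Pi> prev v b h =
     prob \<Pi> (\<lambda>\<theta> s. \<theta> \<and> s v = b \<and> hist_consistent \<Pi> prev v h s) /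
     prob \<Pi> (\<lambda>\<theta> s. s v = b \<and> hist_consistent \<Pi> prev v h s)"

text \<open>actseq t = [A(.,0), ..., A(.,t-1)]; A(v,t) = T iff mu(v,t) > 1/2 (ties toward F).\<close>
fun actseq :: "bnet \<Rightarrow> nat \<Rightarrow> (nat \<Rightarrow> (nat \<Rightarrow> bool) \<Rightarrow> bool) list" where
  "actseq \<Pi> 0 = []"
| "actseq \<Pi> (Suc t) = (let prev = actseq \<Pi> t in
     prev @ [\<lambda>v s. belief_from \<Pi> prev v (s v) (\<lambda>w t'. (prev ! t') w s) > 1/2])"

definition action :: "bnet \<Rightarrow> nat \<Rightarrow> nat \<Rightarrow> (nat \<Rightarrow> bool) \<Rightarrow> bool" where
  "action \<Pi> v t s = (actseq \<Pi> (Suc t) ! t) v s"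

definition belief :: "bnet \<Rightarrow> nat \<Rightarrow> nat \<Rightarrow> (nat \<Rightarrow> bool) \<Rightarrow> real" where
  "belief \<Pi> v t s = belief_from \<Pi> (actseq \<Pi> t) v (s v) (\<lambda>w t'. (actseq \<Pi> t ! t') w s)"

text \<open>An input (Pi, t, u, H(u,t)); hist w t' is the observed action A(w,t') of an
  out-neighbour w of u at time t' < t.\<close>
record bay_input =
  net :: bnet
  time :: nat
  agent :: nat
  hist :: "nat \<Rightarrow> nat \<Rightarrow> bool"

definition hist_prob :: "bay_input \<Rightarrow> real" where
  "hist_prob I = prob (net I) (\<lambda>\<theta> s. hist_consistent (net I) (actseq (net I) (time I)) (agent I) (hist I) s)"

text \<open>mu(u,t) = Pr[theta = T | H(u,t) = hist] (u has no private signal).\<close>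
definition posterior :: "bay_input \<Rightarrow> real" where
  "posterior I =
     prob (net I) (\<lambda>\<theta> s. \<theta> \<and> hist_consistent (net I) (actseq (net I) (time I)) (agent I) (hist I) s)
     / hist_prob I"

definition bay_input_wf :: "bay_input \<Rightarrow> bool" where
  "bay_input_wf I \<longleftrightarrow> bnet_wf (net I) \<and> agent I < n_agents (net I) \<and> 0 < hist_prob I"

definition enc_bay_discrete :: "bay_input \<Rightarrow> bool list" where
  "enc_bay_discrete I =
     enc_nat (n_agents (net I)) @
     enc_list (\<lambda>(v, w). enc_nat v @ enc_nat w) (edges (net I)) @
     enc_nat (time I) @ enc_nat (agent I) @
     enc_list (\<lambda>b. [b])
       (concat (map (\<lambda>t'. map (\<lambda>w. hist I w t')
                 (filter (\<lambda>w. observes (net I) (agent I) w) [0..<n_agents (net I)]))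
               [0..<time I]))"

definition is_approx :: "bool list \<Rightarrow> real \<Rightarrow> nat \<Rightarrow> bool" where
  "is_approx y x j \<longleftrightarrow> (\<exists>a b. 0 < b \<and> y = enc_int a @ enc_nat b \<and> \<bar>x - of_int a / of_nat b\<bar> \<le> 1 / 2 ^ j)"

definition poly_time_probs :: "(cnf \<Rightarrow> bay_input) \<Rightarrow> bool" where
  "poly_time_probs red \<longleftrightarrow>
     (\<exists>M c k. tm_wf M \<and>
        (\<forall>\<phi> v \<theta> j. is_3cnf \<phi> \<and> v < n_agents (net (red \<phi>)) \<longrightarrow>
           (let inp = enc_cnf \<phi> @ enc_nat v @ [\<theta>] @ enc_unary j in
            \<exists>y. tm_computes_in M inp y (c * (length inp + 1) ^ k) \<and>
                is_approx y (sig_prob (net (red \<phi>)) \<theta> v) j)))"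

end

theory Submission
  imports Defs
begin

text \<open>For every variable x there are two literal agents, whose signal 0 means that the literal
  x or its negation is true, and a pair agent observing them.  For every clause there is an agent
  without signal that observes its literal agents and a common switch agent.  The likelihood ratios
  are chosen such that at time 1 a pair agent with signal 1 computes the disjunction of the two
  signals it sees and a clause agent the conjunction of those it sees.  If the decision maker sees
  action T from all pair agents and action F from all clause agents, then the signals encode a
  partial assignment satisfying the formula, or the switch has signal 0, which disables all clauses.
  Switch signal 0 has probability 2^-(3(N+1)) given F and 2^-(10(N+1)) given T, so it is strong
  evidence for F, but unlikely enough to be negligible when satisfying assignments exist.  In that
  case the signals of the pair agents, with odds 8 for T each, outweigh the odds of at worst 1/4
  of each pair of literal agents, and T becomes exponentially likely.

  Both the discrete part of the input and the signal probabilities, which are rational numbers, are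
  printed by programs over a fixed number of bit stacks, and these are simulated by Turing machines
  with quadratic overhead.\<close>

section \<open>Stack programs\<close>

text \<open>The gates have to be forced through odds for T. A literal agent contributes the factor 2
  by signal 1 and 1/8 by signal 0, so a single 0 outweighs two 1s (2 * 2 / 8 < 1) and an agent
  without signal computes a conjunction of up to three literals; a private factor 8 turns the same
  evidence into a disjunction of two (8 * 2 / 8 > 1, but 8 / 64 < 1). The exponents of the switch
  meet two opposing demands. An unsatisfiable formula leaves only profiles with switch signal 0, in
  which each variable may contribute odds up to 8 * 2 * 2 = 32; the ratio 2^-(7(N+1)) of the switch
  probabilities reduces this to at most (32/128)^N. For a satisfiable formula, the disabled profiles
  must not dominate under F. There an assignment has weight at least 1/72 = 1/8 * 1/9 per variable,
  and 1/9 is also paid by the disabled profiles, so probability 8^-(N+1) of switch signal 0 is small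
  enough. Hence 3 and 10 = 3 + 7. Polynomial time refers to concrete machines with exact output. In
  the stack programs, the command still to be executed is the program counter, so the compiler needs
  no labels.\<close>

datatype 'r com =
    Skip
  | Push 'r bool
  | Seq "'r com" "'r com"
  | Branch 'r "'r com" "'r com" "'r com"
  | While 'r "'r com"

datatype ('r, 'c) instruction =
    Stop
  | Goto 'c
  | PushI 'r bool 'c
  | PopI 'r 'c 'c 'c

text \<open>The first instruction of a command, whose continuations are again commands: what is left
  to do after it. \<open>Stop\<close> arises from \<open>Skip\<close> only.\<close>

fun instr :: "'r com \<Rightarrow> ('r, 'r com) instruction" where
  "instr Skip = Stop"
| "instr (Push r b) = PushI r b Skip"
| "instr (Seq c d) = (if c = Skip then Goto d else map_instruction id (\<lambda>c'. Seq c' d) (instr c))"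
| "instr (Branch r e f t) = PopI r e f t"
| "instr (While r c) = PopI r Skip Skip (Seq c (While r c))"

definition mstep :: "'r com \<times> ('r \<Rightarrow> bool list) \<Rightarrow> 'r com \<times> ('r \<Rightarrow> bool list)" where
  "mstep cs = (case cs of (c, s) \<Rightarrow>
     (case instr c of
        Stop \<Rightarrow> (c, s)
      | Goto c' \<Rightarrow> (c', s)
      | PushI r b c' \<Rightarrow> (c', s(r := b # s r))
      | PopI r e f t \<Rightarrow>
          (case s r of [] \<Rightarrow> (e, s) | b # bs \<Rightarrow> (if b then t else f, s(r := bs)))))"

text \<open>Because \<open>Skip\<close> is a fixed point of \<open>mstep\<close>, \<open>n\<close>
  is an upper bound on the running time rather than its exact value. Costs can thus be rounded up
  freely.\<close>

definition runs :: "'r com \<Rightarrow> ('r \<Rightarrow> bool list) \<Rightarrow> nat \<Rightarrow> ('r \<Rightarrow> bool list) \<Rightarrow> bool" where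
  "runs c s n s' \<longleftrightarrow> (mstep ^^ n) (c, s) = (Skip, s')"

lemma instr_eq_Stop [simp]: "instr c = Stop \<longleftrightarrow> c = Skip"
proof (induction c)
  case (Seq c d)
  then show ?case by (cases "instr c") auto
qed auto

lemma mstep_Skip [simp]: "mstep (Skip, s) = (Skip, s)"
  by (simp add: mstep_def)

lemma funpow_mstep_Skip [simp]: "(mstep ^^ n) (Skip, s) = (Skip, s)"
  by (induction n) auto

lemma runs_mono:
  assumes "runs c s n s'" "n \<le> m"
  shows "runs c s m s'"
proof -
  have "m = (m - n) + n" using assms(2) by simp
  then have "(mstep ^^ m) (c, s) = (mstep ^^ (m - n)) ((mstep ^^ n) (c, s))"
    by (metis comp_apply funpow_add)
  then show ?thesis using assms(1) by (simp add: runs_def)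
qed

lemma runs_Skip: "runs Skip s n s"
  by (simp add: runs_def)

lemma runs_Push: "runs (Push r b) s 1 (s(r := b # s r))"
  by (simp add: runs_def mstep_def)

lemma runs_step: "mstep (c, s) = (c', s') \<Longrightarrow> runs c' s' n s'' \<Longrightarrow> runs c s (Suc n) s''"
  unfolding runs_def by (simp add: funpow_Suc_right del: funpow.simps)

lemma mstep_Seq: "c \<noteq> Skip \<Longrightarrow> mstep (c, s) = (c', s') \<Longrightarrow> mstep (Seq c d, s) = (Seq c' d, s')"
  by (cases "instr c") (auto simp: mstep_def split: list.splits if_splits)

lemma runs_Seq:
  assumes "runs c s n s'" and "runs d s' m s''" 
  shows "runs (Seq c d) s (n + m + 1) s''"
  using assms(1)
proof (induction n arbitrary: c s)
  case 0
  then have "c = Skip" "s = s'" by (auto simp: runs_def)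
  then have "mstep (Seq c d, s) = (d, s')" by (simp add: mstep_def)
  then show ?case using assms(2) runs_step by fastforce
next
  case (Suc n)
  show ?case
  proof (cases "c = Skip")
    case True
    then have "s = s'" using Suc.prems by (auto simp: runs_def simp del: funpow.simps)
    with True have "mstep (Seq c d, s) = (d, s')" by (simp add: mstep_def)
    then show ?thesis using assms(2) runs_step runs_mono
      by (metis Suc_eq_plus1 le_add2)
  next
    case False
    obtain c' s1 where c': "mstep (c, s) = (c', s1)" by fastforce
    have "runs c' s1 n s'"
      using Suc.prems c' by (simp add: runs_def funpow_Suc_right del: funpow.simps)
    from Suc.IH[OF this] mstep_Seq[OF False c'] show ?thesis
      using runs_step by fastforce
  qed
qed

lemma runs_Branch:
  assumes "s r = [] \<Longrightarrow> runs e s n s'"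
    and "\<And>bs. s r = False # bs \<Longrightarrow> runs f (s(r := bs)) n s'"
    and "\<And>bs. s r = True # bs \<Longrightarrow> runs t (s(r := bs)) n s'"
  shows "runs (Branch r e f t) s (Suc n) s'"
proof (cases "s r")
  case Nil
  then show ?thesis using assms(1) by (intro runs_step[of _ _ e s]) (auto simp: mstep_def)
next
  case (Cons b bs)
  then show ?thesis using assms(2,3)
    by (intro runs_step[of _ _ "if b then t else f" "s(r := bs)"]) (auto simp: mstep_def)
qed

lemma runs_While_stop:
  assumes "s r = [] \<or> hd (s r) = False"
  shows "runs (While r c) s 1 (s(r := tl (s r)))"
  using assms by (cases "s r") (auto simp: mstep_def runs_def)

lemma runs_While_step:
  assumes "s r = True # bs" "runs c (s(r := bs)) n s'" "runs (While r c) s' m s''"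
  shows "runs (While r c) s (n + m + 2) s''"
  using runs_step[of "While r c" s "Seq c (While r c)" "s(r := bs)" "n + m + 1" s''] runs_Seq[OF assms(2,3)] assms(1)
  by (simp add: mstep_def)

text \<open>The commands that may be left over during a run, in the manner of the derivatives of a
  regular expression. There are finitely many, and they become control states of the
  machine.\<close>

fun residuals :: "'r com \<Rightarrow> 'r com set" where
  "residuals Skip = {Skip}"
| "residuals (Push r b) = {Push r b, Skip}"
| "residuals (Seq c d) = (\<lambda>c'. Seq c' d) ` residuals c \<union> residuals d"
| "residuals (Branch r e f t) =
     insert (Branch r e f t) (residuals e \<union> residuals f \<union> residuals t)"
| "residuals (While r c) = {While r c, Skip} \<union> (\<lambda>c'. Seq c' (While r c)) ` residuals c"

lemma finite_residuals: "finite (residuals c)"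
  by (induction c) auto

lemma self_in_residuals: "c \<in> residuals c"
  by (induction c) auto

text \<open>\<open>set2_instruction\<close> collects the continuations of an instruction, so this is
  closure of \<open>residuals\<close> under execution.\<close>

lemma set2_instruction_residuals:
  "d \<in> residuals c \<Longrightarrow> set2_instruction (instr d) \<subseteq> residuals c"
proof (induction c arbitrary: d)
  case (Seq c1 c2)
  then show ?case
    using self_in_residuals by (fastforce simp: instruction.set_map split: if_splits)
next
  case (Branch r e f t)
  from Branch.prems consider "d = Branch r e f t" | "d \<in> residuals e" | "d \<in> residuals f" | "d \<in> residuals t"
    by auto
  then show ?case
  proof cases
    case 1
    then show ?thesis using self_in_residuals[of e] self_in_residuals[of f] self_in_residuals[of t] by auto
  next
    case 2
    from Branch.IH(1)[OF this] show ?thesis by auto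
  next
    case 3
    from Branch.IH(2)[OF this] show ?thesis by auto
  next
    case 4
    from Branch.IH(3)[OF this] show ?thesis by auto
  qed
next
  case (While r c)
  then show ?case
    using self_in_residuals[of c] by (fastforce simp: instruction.set_map split: if_splits)
qed auto

section \<open>Tape machines over arbitrary finite alphabets\<close>

text \<open>\<open>tm_step\<close> with types of states and symbols left open, so that the compiler
  can work with structured data; numbers are assigned only in \<open>tm_of_gstep\<close>.\<close>

definition gstep ::
  "('q \<Rightarrow> 'a \<Rightarrow> 'q \<times> 'a \<times> int) \<Rightarrow> 'q \<Rightarrow> 'a \<Rightarrow> 'q \<times> 'a list \<times> 'a list \<Rightarrow> 'q \<times> 'a list \<times> 'a list" where
  "gstep \<delta> h bl c = (case c of (q, l, r) \<Rightarrow>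
     (if q = h then (q, l, r) else
      (case \<delta> q (case r of [] \<Rightarrow> bl | x # _ \<Rightarrow> x) of (q', b, d) \<Rightarrow>
         (if d = -1 then (case l of [] \<Rightarrow> (q', [], bl # b # drop 1 r)
                                   | x # l' \<Rightarrow> (q', l', x # b # drop 1 r))
          else if d = 1 then (q', b # l, drop 1 r)
          else (q', l, b # drop 1 r)))))"

text \<open>The machine format reserves numbers for the start state, the halting state, the blank
  and the two bits. The elements of \<open>xs\<close> take such reserved places.\<close>

lemma ex_enumeration_from:
  assumes "finite A" "distinct xs" "set xs \<subseteq> A"
  shows "\<exists>g :: 'a \<Rightarrow> nat. bij_betw g A {..<card A} \<and> (\<forall>i < length xs. g (xs ! i) = i)"
proof -
  obtain ys where ys: "set ys = A - set xs" "distinct ys"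
    using finite_distinct_list[of "A - set xs"] assms(1) by auto
  define zs where "zs = xs @ ys"
  have zs: "set zs = A" "distinct zs"
    using ys assms by (auto simp: zs_def)
  then have len: "length zs = card A" by (metis distinct_card)
  have bij: "bij_betw (nth zs) {..<length zs} A"
    using bij_betw_nth[OF zs(2) refl zs(1)[symmetric]] .
  let ?g = "the_inv_into {..<length zs} (nth zs)"
  have "bij_betw ?g A {..<length zs}"
    using bij_betw_the_inv_into[OF bij] .
  moreover have "?g (xs ! i) = i" if "i < length xs" for i
  proof -
    have "xs ! i = zs ! i" "i < length zs" using that by (auto simp: zs_def nth_append)
    then show ?thesis using the_inv_into_f_f[OF bij_betw_imp_inj_on[OF bij]] by simp
  qed
  ultimately show ?thesis using len by auto
qed

text \<open>Renaming states by \<open>f\<close> and symbols by \<open>g\<close> commutes with every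
  single step, so the simulation is in lockstep and costs no time.\<close>

lemma tm_of_gstep:
  fixes \<delta> :: "'q \<Rightarrow> 'a \<Rightarrow> 'q \<times> 'a \<times> int"
  assumes fin: "finite Q" "finite (UNIV :: 'a set)"
    and q0: "q0 \<in> Q" "h \<in> Q" "q0 \<noteq> h"
    and sy: "distinct [bl, x1, x2]"
    and cl: "\<And>q a. q \<in> Q \<Longrightarrow> fst (\<delta> q a) \<in> Q"
    and mv: "\<And>q a. snd (snd (\<delta> q a)) \<in> {-1, 0, 1}"
  shows "\<exists>M f g. tm_wf M \<and> inj_on f Q \<and> inj g \<and> f q0 = 0 \<and> f h = 1 \<and>
     g bl = 0 \<and> g x1 = 1 \<and> g x2 = 2 \<and>
     (\<forall>n q l r. q \<in> Q \<longrightarrow>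
        (case (gstep \<delta> h bl ^^ n) (q, l, r) of (q', l', r') \<Rightarrow>
           (tm_step M ^^ n) (f q, map g l, map g r) = (f q', map g l', map g r')))"
proof -
  obtain f where f: "bij_betw f Q {..<card Q}" "f q0 = 0" "f h = 1"
    using ex_enumeration_from[of Q "[q0, h]"] fin q0 by (force simp: less_Suc_eq)
  obtain g where g: "bij_betw g (UNIV :: 'a set) {..<card (UNIV :: 'a set)}" "g bl = 0" "g x1 = 1" "g x2 = 2"
    using ex_enumeration_from[of "UNIV :: 'a set" "[bl, x1, x2]"] fin sy
    by (force simp: less_Suc_eq nth_Cons')
  define fi where "fi = the_inv_into Q f"
  define gi where "gi = the_inv_into UNIV g"
  have inj: "inj_on f Q" "inj g" using f g by (auto simp: bij_betw_def)
  have fi: "fi (f q) = q" if "q \<in> Q" for q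
    using that inj by (simp add: fi_def the_inv_into_f_f)
  have gi: "gi (g a) = a" for a
    using inj by (simp add: gi_def the_inv_into_f_f)
  define M where "M = \<lparr>tm_states = card Q, tm_syms = card (UNIV :: 'a set),
    tm_delta = (\<lambda>q a. case \<delta> (fi q) (gi a) of (q', b, d) \<Rightarrow> (f q', g b, d))\<rparr>"
  have fQ: "f q < card Q" if "q \<in> Q" for q using that f by (auto simp: bij_betw_def)
  have gA: "g a < card (UNIV :: 'a set)" for a using g by (auto simp: bij_betw_def)
  have "tm_wf M"
    unfolding tm_wf_def
  proof (intro conjI allI impI)
    show "2 \<le> tm_states M" using fQ[OF q0(2)] f(3) by (simp add: M_def)
    show "3 \<le> tm_syms M" using gA[of x2] g(4) by (simp add: M_def)
    fix q a assume "q < tm_states M" "a < tm_syms M"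
    then have "q \<in> f ` Q" using f by (auto simp: M_def bij_betw_def)
    then have "fi q \<in> Q" using fi by auto
    then show "case tm_delta M q a of (q', b, d) \<Rightarrow> q' < tm_states M \<and> b < tm_syms M \<and> d \<in> {-1, 0, 1}"
      using cl[of "fi q" "gi a"] mv[of "fi q" "gi a"] fQ gA by (auto simp: M_def split: prod.splits)
  qed
  moreover have step: "(case gstep \<delta> h bl (q, l, r) of (q', l', r') \<Rightarrow>
      q' \<in> Q \<and> tm_step M (f q, map g l, map g r) = (f q', map g l', map g r'))" if "q \<in> Q" for q l r
  proof -
    have h1: "f q = Suc 0 \<longleftrightarrow> q = h"
      using that inj(1) q0(2) f(3) by (metis One_nat_def inj_on_def)
    obtain q' b d where qd: "\<delta> q (case r of [] \<Rightarrow> bl | x # _ \<Rightarrow> x) = (q', b, d)" by (metis prod_cases3)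
    have hd: "(case map g r of [] \<Rightarrow> 0 | x # _ \<Rightarrow> x) = g (case r of [] \<Rightarrow> bl | x # _ \<Rightarrow> x)"
      using g by (cases r) auto
    have d: "tm_delta M (f q) (g (case r of [] \<Rightarrow> bl | x # _ \<Rightarrow> x)) = (f q', g b, d)"
      using qd fi[OF that] gi by (simp add: M_def)
    have "q' \<in> Q" using cl[OF that] qd by (metis fst_conv)
    then show ?thesis
      using h1 that hd d qd g(2)
      by (cases l) (auto simp: tm_step_def gstep_def Let_def drop_map)
  qed
  moreover have "(case (gstep \<delta> h bl ^^ n) (q, l, r) of (q', l', r') \<Rightarrow>
      q' \<in> Q \<and> (tm_step M ^^ n) (f q, map g l, map g r) = (f q', map g l', map g r'))" if "q \<in> Q" for n q l r
    using that
  proof (induction n)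
    case (Suc n)
    then show ?case using step by (fastforce split: prod.splits)
  qed auto
  ultimately have "tm_wf M \<and> inj_on f Q \<and> inj g \<and> f q0 = 0 \<and> f h = 1 \<and>
     g bl = 0 \<and> g x1 = 1 \<and> g x2 = 2 \<and>
     (\<forall>n q l r. q \<in> Q \<longrightarrow>
        (case (gstep \<delta> h bl ^^ n) (q, l, r) of (q', l', r') \<Rightarrow>
           (tm_step M ^^ n) (f q, map g l, map g r) = (f q', map g l', map g r')))"
    using inj f g by (simp add: case_prod_beta)
  then show ?thesis by blast
qed

lemma length_mstep:
  assumes "mstep (c, s) = (c', s')" "\<And>r. length (s r) \<le> H"
  shows "length (s' r) \<le> Suc H"
proof -
  have H: "length (s r) \<le> Suc H" for r using assms(2)[of r] by simp
  show ?thesis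
  proof (cases "instr c")
    case (PopI r1 e f t)
    have "length bs \<le> Suc H" if "s r1 = b # bs" for b bs using H[of r1] that by simp
    then show ?thesis using assms(1) H PopI by (auto simp: mstep_def split: list.splits)
  qed (use assms H in \<open>auto simp: mstep_def\<close>)
qed

lemma length_runs:
  assumes "runs c s n s'" "\<And>r. length (s r) \<le> H"
  shows "length (s' r) \<le> H + n"
  using assms
proof (induction n arbitrary: c s H)
  case (Suc n)
  obtain c1 s1 where c1: "mstep (c, s) = (c1, s1)" by fastforce
  then have "runs c1 s1 n s'" using Suc.prems by (simp add: runs_def funpow_Suc_right del: funpow.simps)
  from Suc.IH[OF this length_mstep[OF c1 Suc.prems(2)]] show ?case by simp
qed (simp add: runs_def)

section \<open>Compiling stack programs to Turing machines\<close>

text \<open>Each stack occupies one track, with its bottom in cell 0; the head rests on cell 0, which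
  carries the marker, between any two program steps.\<close>

datatype 'r cell = Blank | Bit bool | Cell bool "'r \<Rightarrow> bool option"

fun marked :: "'r cell \<Rightarrow> bool" where
  "marked (Cell m f) = m"
| "marked _ = False"

fun track :: "'r cell \<Rightarrow> 'r \<Rightarrow> bool option" where
  "track (Cell m f) = f"
| "track _ = (\<lambda>_. None)"

definition set_track :: "'r cell \<Rightarrow> 'r \<Rightarrow> bool option \<Rightarrow> 'r cell" where
  "set_track x r v = Cell (marked x) ((track x)(r := v))"

lemma marked_set_track [simp]: "marked (set_track x r v) = marked x"
  by (simp add: set_track_def)

lemma track_set_track [simp]: "track (set_track x r v) = (track x)(r := v)"
  by (simp add: set_track_def)

lemma finite_cell: "finite (UNIV :: 'r::finite cell set)"
proof -
  have "(UNIV :: 'r cell set) = {Blank} \<union> range Bit \<union> range (\<lambda>(m, f). Cell m f)"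
    by (auto simp: image_iff) (metis cell.exhaust)
  then show ?thesis by (metis finite_Un finite.emptyI finite.insertI finite_imageI finite_code)
qed

text \<open>A program step is one excursion of the head. \<open>Psh\<close> and \<open>Pop\<close>
  go right to the first free cell of a track, \<open>Popped\<close> stands on the top bit after
  stepping back, and \<open>Ret c\<close> returns to the marker in order to continue with
  \<open>c\<close>.\<close>

datatype 'r state =
    Load0 | Load | Ret "'r com" | Run "'r com"
  | Psh 'r bool "'r com" | Pop 'r "'r com" "'r com" "'r com" | Popped 'r "'r com" "'r com"
  | Unload | Rewind | Done

locale compiler =
  fixes inp out :: "'r::finite" and prog :: "'r com"
begin

text \<open>\<open>Unload\<close> overwrites the marker, so \<open>Rewind\<close> needs another way
  to find cell 0: it leaves the tape on the left, where the step function supplies a fresh blank,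
  and goes back one cell.\<close>

fun ctl :: "'r state \<Rightarrow> 'r cell \<Rightarrow> 'r state \<times> 'r cell \<times> int" where
  "ctl Load0 x = (case x of Bit b \<Rightarrow> (Load, Cell True ((\<lambda>_. None)(inp := Some b)), 1)
                          | _ \<Rightarrow> (Run prog, Cell True (\<lambda>_. None), 0))"
| "ctl Load x = (case x of Bit b \<Rightarrow> (Load, Cell False ((\<lambda>_. None)(inp := Some b)), 1)
                         | _ \<Rightarrow> (Ret prog, x, -1))"
| "ctl (Ret c) x = (if marked x then (Run c, x, 0) else (Ret c, x, -1))"
| "ctl (Run c) x = (case instr c of
       Stop \<Rightarrow> (Unload, x, 0)
     | Goto c' \<Rightarrow> (Run c', x, 0)
     | PushI r b c' \<Rightarrow> (Psh r b c', x, 0)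
     | PopI r e f t \<Rightarrow> (Pop r e f t, x, 0))"
| "ctl (Psh r b c) x = (if track x r = None then (Ret c, set_track x r (Some b), 0) else (Psh r b c, x, 1))"
| "ctl (Pop r e f t) x = (if track x r \<noteq> None then (Pop r e f t, x, 1)
     else if marked x then (Run e, x, 0) else (Popped r f t, x, -1))"
| "ctl (Popped r f t) x = (Ret (if track x r = Some True then t else f), set_track x r None, 0)"
| "ctl Unload x = (case track x out of Some b \<Rightarrow> (Unload, Bit b, 1) | None \<Rightarrow> (Rewind, Blank, -1))"
| "ctl Rewind x = (if x = Blank then (Done, x, 1) else (Rewind, x, -1))"
| "ctl Done x = (Done, x, 0)"

definition ctl_states :: "'r state set" where
  "ctl_states = (let R = residuals prog in
     {Load0, Load, Unload, Rewind, Done} \<union> Ret ` R \<union> Run ` R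
     \<union> (\<lambda>(r, b, c). Psh r b c) ` (UNIV \<times> UNIV \<times> R)
     \<union> (\<lambda>(r, e, f, t). Pop r e f t) ` (UNIV \<times> R \<times> R \<times> R)
     \<union> (\<lambda>(r, f, t). Popped r f t) ` (UNIV \<times> R \<times> R))"

lemma finite_ctl_states: "finite ctl_states"
  by (simp add: ctl_states_def Let_def finite_residuals)

lemma ctl_states_iff:
  "Ret c \<in> ctl_states \<longleftrightarrow> c \<in> residuals prog"
  "Run c \<in> ctl_states \<longleftrightarrow> c \<in> residuals prog"
  "Psh r b c \<in> ctl_states \<longleftrightarrow> c \<in> residuals prog"
  "Pop r e f t \<in> ctl_states \<longleftrightarrow> {e, f, t} \<subseteq> residuals prog"
  "Popped r f t \<in> ctl_states \<longleftrightarrow> {f, t} \<subseteq> residuals prog"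
  "{Load0, Load, Unload, Rewind, Done} \<subseteq> ctl_states"
  by (auto simp: ctl_states_def Let_def image_iff)

lemma ctl_closed: "q \<in> ctl_states \<Longrightarrow> fst (ctl q x) \<in> ctl_states"
proof (cases q)
  case (Run c)
  assume "q \<in> ctl_states"
  with Run have "set2_instruction (instr c) \<subseteq> residuals prog"
    using set2_instruction_residuals by (auto simp: ctl_states_iff)
  with Run show ?thesis
    using ctl_states_iff(6) by (cases "instr c") (auto simp: ctl_states_iff)
qed (use ctl_states_iff self_in_residuals in \<open>auto split: cell.splits option.splits\<close>)

lemma ctl_move: "snd (snd (ctl q x)) \<in> {-1, 0, 1}"
  by (cases q) (auto split: cell.splits instruction.splits option.splits)

text \<open>The head is at position p; the cells beyond the end of w are blank.\<close>

definition conf :: "'r state \<Rightarrow> nat \<Rightarrow> 'r cell list \<Rightarrow> 'r state \<times> 'r cell list \<times> 'r cell list" where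
  "conf q p w = (q, rev (take p w), drop p w)"

definition cell_at :: "'r cell list \<Rightarrow> nat \<Rightarrow> 'r cell" where
  "cell_at w i = (if i < length w then w ! i else Blank)"

definition wr :: "'r cell list \<Rightarrow> nat \<Rightarrow> 'r cell \<Rightarrow> 'r cell list" where
  "wr w p b = (if p < length w then w[p := b] else w @ [b])"

lemma cell_at_wr: "p \<le> length w \<Longrightarrow> cell_at (wr w p b) i = (if i = p then b else cell_at w i)"
  by (auto simp: cell_at_def wr_def nth_append)

lemma length_wr: "p \<le> length w \<Longrightarrow> length (wr w p b) = max (length w) (Suc p)"
  by (auto simp: wr_def)

lemma wr_same: "p < length w \<Longrightarrow> wr w p (cell_at w p) = w"
  by (simp add: wr_def cell_at_def)

definition step :: "'r state \<times> 'r cell list \<times> 'r cell list \<Rightarrow> 'r state \<times> 'r cell list \<times> 'r cell list" where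
  "step = gstep ctl Done Blank"

text \<open>Left moves at position 0 are excluded, since there the tape grows and all positions
  shift. Only the final rewinding makes such a move, and \<open>unload_phase\<close> computes it by
  hand.\<close>

lemma step_conf:
  assumes "ctl q (cell_at w p) = (q', b, d)" "q \<noteq> Done" "p \<le> length w" "d = -1 \<Longrightarrow> 0 < p"
  shows "step (conf q p w) = conf q' (nat (int p + d)) (wr w p b)"
proof -
  have d: "d \<in> {-1, 0, 1}" using ctl_move[of q "cell_at w p"] assms(1) by simp
  have hd: "(case drop p w of [] \<Rightarrow> Blank | x # _ \<Rightarrow> x) = cell_at w p"
    by (cases "p < length w") (simp_all add: cell_at_def Cons_nth_drop_Suc[symmetric])
  have wr_eq: "drop p (wr w p b) = b # drop (Suc p) w" "take p (wr w p b) = take p w"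
    "drop (Suc p) (wr w p b) = drop (Suc p) w" "take (Suc p) (wr w p b) = take p w @ [b]"
    using assms(3) by (auto simp: wr_def drop_update_swap take_Suc_conv_app_nth Cons_nth_drop_Suc[symmetric])
  have tl: "drop 1 (drop p w) = drop (Suc p) w" by simp
  show ?thesis
  proof (cases "d = -1")
    case True
    then obtain k where k: "p = Suc k" using assms(4) by (cases p) auto
    then have "k < length w" using assms(3) by simp
    moreover have "k < length (wr w p b)" using calculation assms(3) by (simp add: length_wr)
    moreover have "wr w p b ! k = w ! k" using k calculation by (simp add: wr_def nth_append)
    ultimately have "rev (take p w) = w ! k # rev (take k w)"
      "drop k (wr w p b) = w ! k # b # drop (Suc p) w" "take k (wr w p b) = take k w"
      using wr_eq k by (simp_all add: take_Suc_conv_app_nth Cons_nth_drop_Suc[symmetric])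
    then show ?thesis
      using True assms(1,2) hd tl k by (simp add: step_def gstep_def conf_def)
  next
    case False
    then consider "d = 0" | "d = 1" using d by auto
    then show ?thesis
      using assms(1,2) hd tl wr_eq by cases (simp_all add: step_def gstep_def conf_def nat_add_distrib)
  qed
qed

section \<open>Reachability within a time bound, and sweeps of the head\<close>

definition reach :: "nat \<Rightarrow> 'r state \<times> 'r cell list \<times> 'r cell list \<Rightarrow> 'r state \<times> 'r cell list \<times> 'r cell list \<Rightarrow> bool" where
  "reach B c c' \<longleftrightarrow> (\<exists>n \<le> B. (step ^^ n) c = c')"

lemma reach_refl: "reach B c c"
  unfolding reach_def by (intro exI[of _ 0]) simp

lemma reach_step: "reach 1 c (step c)"
  unfolding reach_def by (intro exI[of _ 1]) simp

lemma reach_trans: "reach A c d \<Longrightarrow> reach B d e \<Longrightarrow> reach (A + B) c e"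
  unfolding reach_def
proof (elim exE conjE)
  fix m n assume "m \<le> A" "(step ^^ m) c = d" "n \<le> B" "(step ^^ n) d = e"
  then show "\<exists>k \<le> A + B. (step ^^ k) c = e"
    by (intro exI[of _ "n + m"]) (simp add: funpow_add)
qed

lemma reach_mono: "reach A c d \<Longrightarrow> A \<le> B \<Longrightarrow> reach B c d"
  unfolding reach_def using order_trans by blast

lemma reach_conf:
  assumes "ctl q (cell_at w p) = (q', b, d)" "q \<noteq> Done" "p \<le> length w" "d = -1 \<Longrightarrow> 0 < p"
  shows "reach 1 (conf q p w) (conf q' (nat (int p + d)) (wr w p b))"
  using reach_step step_conf[OF assms] by metis

lemma sweep_right:
  assumes "\<And>i. p \<le> i \<Longrightarrow> i < p + k \<Longrightarrow> ctl q (cell_at w i) = (q, cell_at w i, 1)" "q \<noteq> Done"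
    "p + k \<le> length w"
  shows "reach k (conf q p w) (conf q (p + k) w)"
  using assms
proof (induction k)
  case (Suc k)
  have "reach 1 (conf q (p + k) w) (conf q (nat (int (p + k) + 1)) (wr w (p + k) (cell_at w (p + k))))"
    using Suc.prems by (intro reach_conf) auto
  moreover have "nat (int (p + k) + 1) = p + Suc k" by simp
  moreover have "wr w (p + k) (cell_at w (p + k)) = w" using Suc.prems(3) by (intro wr_same) simp
  moreover have "reach k (conf q p w) (conf q (p + k) w)" using Suc by auto
  ultimately show ?case using reach_trans by fastforce
qed (simp add: reach_refl)

lemma sweep_left:
  assumes "\<And>i. 0 < i \<Longrightarrow> i \<le> p \<Longrightarrow> ctl q (cell_at w i) = (q, cell_at w i, -1)" "q \<noteq> Done"
    "p < length w"
  shows "reach p (conf q p w) (conf q 0 w)"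
  using assms
proof (induction p)
  case (Suc p)
  have "reach 1 (conf q (Suc p) w) (conf q (nat (int (Suc p) + - 1)) (wr w (Suc p) (cell_at w (Suc p))))"
    using Suc.prems by (intro reach_conf) auto
  moreover have "nat (int (Suc p) + - 1) = p" by simp
  moreover have "wr w (Suc p) (cell_at w (Suc p)) = w" using Suc.prems(3) by (intro wr_same) simp
  moreover have "reach p (conf q p w) (conf q 0 w)" using Suc by auto
  ultimately show ?case using reach_trans[of 1 _ _ p] by fastforce
qed (simp add: reach_refl)

text \<open>The reversal puts the bottom of each stack into cell 0. Since cells past the end of
  \<open>w\<close> read as \<open>Blank\<close>, trailing empty cells do not matter.\<close>

definition represents :: "'r cell list \<Rightarrow> ('r \<Rightarrow> bool list) \<Rightarrow> bool" where
  "represents w s \<longleftrightarrow> (\<forall>i. marked (cell_at w i) = (i = 0)) \<and>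
     (\<forall>i r. track (cell_at w i) r = (if i < length (s r) then Some (rev (s r) ! i) else None))"

lemma represents_nonempty: "represents w s \<Longrightarrow> 0 < length w"
  by (cases w) (auto simp: represents_def cell_at_def)

lemma represents_length:
  assumes "represents w s"
  shows "length (s r) \<le> length w"
proof (rule ccontr)
  assume "\<not> ?thesis"
  moreover have "track (cell_at w (length w)) r =
      (if length w < length (s r) then Some (rev (s r) ! length w) else None)"
    using assms by (simp only: represents_def)
  ultimately show False by (simp add: cell_at_def)
qed

lemma represents_push:
  assumes "represents w s" and "p = length (s r)"
  shows "represents (wr w p (set_track (cell_at w p) r (Some b))) (s(r := b # s r))"
  using assms represents_length[OF assms(1), of r]
  unfolding represents_def by (auto simp: cell_at_wr nth_append)

lemma represents_pop:
  assumes "represents w s" and "s r = b # bs" and "p = length bs"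
  shows "represents (wr w p (set_track (cell_at w p) r None)) (s(r := bs))"
  using assms represents_length[OF assms(1), of r]
  unfolding represents_def by (auto simp: cell_at_wr nth_append)

lemma stay:
  assumes "ctl q (cell_at w p) = (q', cell_at w p, 0)" "q \<noteq> Done" "p < length w"
  shows "reach 1 (conf q p w) (conf q' p w)"
  using reach_conf[OF assms(1,2)] assms(3) wr_same[of p w] by simp

lemma return_sweep:
  assumes "represents w s" "p < length w"
  shows "reach (p + 1) (conf (Ret c) p w) (conf (Run c) 0 w)"
proof -
  have m: "marked (cell_at w i) = (i = 0)" for i using assms by (simp add: represents_def)
  have "reach p (conf (Ret c) p w) (conf (Ret c) 0 w)"
    using assms m by (intro sweep_left) auto
  moreover have "reach 1 (conf (Ret c) 0 w) (conf (Run c) 0 w)"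
    using m[of 0] represents_nonempty[OF assms(1)] by (intro stay) simp_all
  ultimately show ?thesis by (rule reach_trans)
qed

text \<open>One sweep to the top of a stack, at most \<open>H\<close> cells away, one sweep back,
  and a constant number of changes of state.\<close>

lemma simulate_step:
  assumes rep: "represents w s" and c: "c \<noteq> Skip" and step: "mstep (c, s) = (c', s')"
    and H: "\<And>r. length (s r) \<le> H"
  shows "\<exists>w'. represents w' s' \<and> reach (2 * H + 5) (conf (Run c) 0 w) (conf (Run c') 0 w')"
proof (cases "instr c")
  case Stop
  then show ?thesis using c by simp
next
  case (Goto d)
  then have "reach 1 (conf (Run c) 0 w) (conf (Run d) 0 w)"
    using represents_nonempty[OF rep] by (intro stay) auto
  then show ?thesis using Goto step rep reach_mono by (fastforce simp: mstep_def)
next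
  case (PushI r b d)
  have d: "c' = d" "s' = s(r := b # s r)" using step PushI by (auto simp: mstep_def)
  let ?p = "length (s r)"
  have p: "?p \<le> length w" using rep by (rule represents_length)
  have tr: "track (cell_at w i) r = (if i < ?p then Some (rev (s r) ! i) else None)" for i
    using rep by (simp add: represents_def)
  let ?w = "wr w ?p (set_track (cell_at w ?p) r (Some b))"
  have rep': "represents ?w s'" unfolding d using rep refl by (rule represents_push)
  have 1: "reach 1 (conf (Run c) 0 w) (conf (Psh r b d) 0 w)"
    using PushI represents_nonempty[OF rep] by (intro stay) auto
  have "reach ?p (conf (Psh r b d) 0 w) (conf (Psh r b d) (0 + ?p) w)"
    using tr p by (intro sweep_right) auto
  then have 2: "reach ?p (conf (Psh r b d) 0 w) (conf (Psh r b d) ?p w)" by simp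
  have "reach 1 (conf (Psh r b d) ?p w) (conf (Ret d) (nat (int ?p + 0)) ?w)"
    using tr p by (intro reach_conf) auto
  then have 3: "reach 1 (conf (Psh r b d) ?p w) (conf (Ret d) ?p ?w)" by simp
  have 4: "reach (?p + 1) (conf (Ret d) ?p ?w) (conf (Run d) 0 ?w)"
    using rep' p by (intro return_sweep[of _ s']) (auto simp: length_wr)
  have "reach (1 + ?p + 1 + (?p + 1)) (conf (Run c) 0 w) (conf (Run d) 0 ?w)"
    by (rule reach_trans[OF reach_trans[OF reach_trans[OF 1 2] 3] 4])
  moreover have "1 + ?p + 1 + (?p + 1) \<le> 2 * H + 5" using H[of r] by simp
  ultimately show ?thesis using rep' d reach_mono by blast
next
  case (PopI r e f t)
  let ?p = "length (s r)"
  have p: "?p \<le> length w" using rep by (rule represents_length)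
  have tr: "track (cell_at w i) r = (if i < ?p then Some (rev (s r) ! i) else None)" for i
    using rep by (simp add: represents_def)
  have m: "marked (cell_at w i) = (i = 0)" for i using rep by (simp add: represents_def)
  have 1: "reach 1 (conf (Run c) 0 w) (conf (Pop r e f t) 0 w)"
    using PopI represents_nonempty[OF rep] by (intro stay) auto
  show ?thesis
  proof (cases "s r")
    case Nil
    then have d: "c' = e" "s' = s" using step PopI by (auto simp: mstep_def)
    have "reach 1 (conf (Pop r e f t) 0 w) (conf (Run e) 0 w)"
      using tr m Nil represents_nonempty[OF rep] by (intro stay) auto
    with 1 have "reach (1 + 1) (conf (Run c) 0 w) (conf (Run e) 0 w)" by (rule reach_trans)
    then have "reach (2 * H + 5) (conf (Run c) 0 w) (conf (Run e) 0 w)" by (rule reach_mono) simp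
    then show ?thesis using rep d by blast
  next
    case (Cons b bs)
    then have d: "c' = (if b then t else f)" "s' = s(r := bs)" using step PopI by (auto simp: mstep_def)
    let ?k = "length bs"
    \<comment> \<open>The head inspects the first free cell, which may lie just past the end of
      \<open>w\<close>. Writing its content back makes this cell explicit.\<close>
    let ?v = "wr w ?p (cell_at w ?p)"
    have v: "represents ?v s" using rep p by (simp add: represents_def cell_at_wr)
    have k: "?k < length ?v" using Cons p by (simp add: length_wr)
    let ?w = "wr ?v ?k (set_track (cell_at ?v ?k) r None)"
    have rep': "represents ?w s'" unfolding d using v Cons refl by (rule represents_pop)
    have trv: "track (cell_at ?v ?k) r = Some b"
      using v Cons by (simp add: represents_def nth_append)
    have "reach ?p (conf (Pop r e f t) 0 w) (conf (Pop r e f t) (0 + ?p) w)"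
      using tr p by (intro sweep_right) auto
    then have 2: "reach ?p (conf (Pop r e f t) 0 w) (conf (Pop r e f t) ?p w)" by simp
    have "reach 1 (conf (Pop r e f t) ?p w) (conf (Popped r f t) (nat (int ?p + - 1)) ?v)"
      using tr m p Cons by (intro reach_conf) auto
    moreover have "nat (int ?p + - 1) = ?k" using Cons by simp
    ultimately have 3: "reach 1 (conf (Pop r e f t) ?p w) (conf (Popped r f t) ?k ?v)" by simp
    have "reach 1 (conf (Popped r f t) ?k ?v) (conf (Ret c') (nat (int ?k + 0)) ?w)"
      using trv d k by (intro reach_conf) auto
    then have 4: "reach 1 (conf (Popped r f t) ?k ?v) (conf (Ret c') ?k ?w)" by simp
    have 5: "reach (?k + 1) (conf (Ret c') ?k ?w) (conf (Run c') 0 ?w)"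
      using rep' k by (intro return_sweep[of _ s']) (auto simp: length_wr)
    have "reach (1 + ?p + 1 + 1 + (?k + 1)) (conf (Run c) 0 w) (conf (Run c') 0 ?w)"
      by (rule reach_trans[OF reach_trans[OF reach_trans[OF reach_trans[OF 1 2] 3] 4] 5])
    moreover have "1 + ?p + 1 + 1 + (?k + 1) \<le> 2 * H + 5" using H[of r] Cons by simp
    ultimately show ?thesis using rep' reach_mono by blast
  qed
qed

text \<open>Stacks grow by at most one bit per step, so all heights stay below \<open>H + n\<close>;
  this makes the overhead quadratic.\<close>

lemma simulate_run:
  assumes "represents w s" "runs c s n s'" "\<And>r. length (s r) \<le> H"
  shows "\<exists>w'. represents w' s' \<and> reach (n * (2 * (H + n) + 5)) (conf (Run c) 0 w) (conf (Run Skip) 0 w')"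
  using assms
proof (induction n arbitrary: c s w H)
  case 0
  then show ?case using reach_refl by (fastforce simp: runs_def)
next
  case (Suc n)
  show ?case
  proof (cases "c = Skip")
    case True
    then show ?thesis using Suc.prems reach_refl by (fastforce simp: runs_def simp del: funpow.simps)
  next
    case False
    obtain c1 s1 where c1: "mstep (c, s) = (c1, s1)" by fastforce
    obtain w1 where w1: "represents w1 s1" "reach (2 * H + 5) (conf (Run c) 0 w) (conf (Run c1) 0 w1)"
      using simulate_step[OF Suc.prems(1) False c1 Suc.prems(3)] by blast
    have "runs c1 s1 n s'"
      using Suc.prems(2) c1 by (simp add: runs_def funpow_Suc_right del: funpow.simps)
    then obtain w2 where w2: "represents w2 s'"
        "reach (n * (2 * (Suc H + n) + 5)) (conf (Run c1) 0 w1) (conf (Run Skip) 0 w2)"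
      using Suc.IH[OF w1(1) _ length_mstep[OF c1 Suc.prems(3)]] by blast
    have "reach (2 * H + 5 + n * (2 * (Suc H + n) + 5)) (conf (Run c) 0 w) (conf (Run Skip) 0 w2)"
      using reach_trans[OF w1(2) w2(2)] .
    moreover have "2 * H + 5 + n * (2 * (Suc H + n) + 5) \<le> Suc n * (2 * (H + Suc n) + 5)"
      by simp
    ultimately show ?thesis using w2(1) reach_mono by blast
  qed
qed

text \<open>The input is already laid out like a stack with its first bit at the bottom, so it is
  converted in place; the last bit ends up on top, whence \<open>rev x\<close>.\<close>

lemma load_phase:
  "\<exists>w. represents w ((\<lambda>_. [])(inp := rev x)) \<and>
     reach (2 * length x + 2) (conf Load0 0 (map Bit x)) (conf (Run prog) 0 w)"
proof (cases x)
  case Nil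
  let ?w = "wr [] 0 (Cell True (\<lambda>_. None))"
  have "reach 1 (conf Load0 0 []) (conf (Run prog) (nat (int 0 + 0)) ?w)"
    by (intro reach_conf) (auto simp: cell_at_def)
  moreover have "represents ?w ((\<lambda>_. [])(inp := rev x))"
    using Nil by (auto simp: represents_def cell_at_wr) (auto simp: cell_at_def)
  ultimately show ?thesis using Nil reach_mono by fastforce
next
  case (Cons b bs)
  define loaded where
    "loaded k = map (\<lambda>i. Cell (i = 0) ((\<lambda>_. None)(inp := Some (x ! i)))) [0..<k] @ map Bit (drop k x)" for k
  have len: "length (loaded k) = length x" if "k \<le> length x" for k
    using that by (simp add: loaded_def)
  have at: "cell_at (loaded k) i = (if i < k then Cell (i = 0) ((\<lambda>_. None)(inp := Some (x ! i)))
      else if i < length x then Bit (x ! i) else Blank)" if "k \<le> length x" for k i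
    using that by (auto simp: cell_at_def len) (auto simp: loaded_def nth_append)
  have wr_eq: "wr (loaded k) k (Cell (k = 0) ((\<lambda>_. None)(inp := Some (x ! k)))) = loaded (Suc k)"
    if "k < length x" for k
    using that by (intro nth_equalityI) 
      (auto simp: wr_def len nth_list_update, auto simp: loaded_def nth_append)
  have "reach (Suc k) (conf Load0 0 (map Bit x)) (conf Load (Suc k) (loaded (Suc k)))" if "k < length x" for k
    using that
  proof (induction k)
    case 0
    have "reach 1 (conf Load0 0 (loaded 0)) (conf Load (nat (int 0 + 1))
        (wr (loaded 0) 0 (Cell (0 = (0 :: nat)) ((\<lambda>_. None)(inp := Some (x ! 0))))))"
      using 0 by (intro reach_conf) (auto simp: at)
    then show ?case using wr_eq[OF 0] by (simp add: loaded_def)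
  next
    case (Suc k)
    have "reach 1 (conf Load (Suc k) (loaded (Suc k))) (conf Load (nat (int (Suc k) + 1))
        (wr (loaded (Suc k)) (Suc k) (Cell (Suc k = 0) ((\<lambda>_. None)(inp := Some (x ! Suc k))))))"
      using Suc.prems len[of "Suc k"] by (intro reach_conf) (auto simp: at)
    moreover have "nat (int (Suc k) + 1) = Suc (Suc k)" by simp
    ultimately have "reach 1 (conf Load (Suc k) (loaded (Suc k))) (conf Load (Suc (Suc k)) (loaded (Suc (Suc k))))"
      using wr_eq[OF Suc.prems] by metis
    then show ?case using Suc reach_trans[of "Suc k" _ _ 1] by fastforce
  qed
  from this[of "length bs"] Cons have "reach (length x) (conf Load0 0 (map Bit x)) (conf Load (length x) (loaded (length x)))"
    by simp
  moreover let ?w = "wr (loaded (length x)) (length x) Blank"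
  have "reach 1 (conf Load (length x) (loaded (length x))) (conf (Ret prog) (nat (int (length x) + - 1)) ?w)"
    using Cons by (intro reach_conf) (auto simp: at len)
  moreover have "nat (int (length x) + - 1) = length bs" using Cons by simp
  moreover have rep: "represents ?w ((\<lambda>_. [])(inp := rev x))"
    using Cons by (auto simp: represents_def cell_at_wr len at)
  then have "reach (length bs + 1) (conf (Ret prog) (length bs) ?w) (conf (Run prog) 0 ?w)"
    by (rule return_sweep) (simp add: length_wr len Cons)
  ultimately have "reach (length x + 1 + (length bs + 1)) (conf Load0 0 (map Bit x)) (conf (Run prog) 0 ?w)"
    by (metis (no_types) reach_trans)
  then have "reach (2 * length x + 2) (conf Load0 0 (map Bit x)) (conf (Run prog) 0 ?w)"
    by (rule reach_mono) (simp add: Cons)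
  then show ?thesis using rep by blast
qed

text \<open>The output is read from the bottom of the stack, so the printed word is the reversed
  stack. The \<open>Blank\<close> after it separates it from what the tracks still contain further
  right.\<close>

lemma unload_phase:
  assumes rep: "represents w s"
  shows "\<exists>l v. reach (2 * length (s out) + 4) (conf (Run Skip) 0 w) (Done, l, map Bit (rev (s out)) @ Blank # v)"
proof -
  define y where "y = rev (s out)"
  have tr: "track (cell_at w i) out = (if i < length y then Some (y ! i) else None)" for i
    using rep by (simp add: represents_def y_def)
  have len: "length y \<le> length w" using represents_length[OF rep] by (simp add: y_def)
  have 1: "reach 1 (conf (Run Skip) 0 w) (conf Unload 0 w)"
    using represents_nonempty[OF rep] by (intro stay) auto
  define unl where "unl k = map Bit (take k y) @ drop k w" for k
  have lu: "length (unl k) = length w" if "k \<le> length y" for k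
    using that len by (simp add: unl_def)
  have at: "cell_at (unl k) i = (if i < k then Bit (y ! i) else cell_at w i)" if "k \<le> length y" for k i
    using that len by (auto simp: cell_at_def lu) (auto simp: unl_def nth_append)
  have wr_eq: "wr (unl k) k (Bit (y ! k)) = unl (Suc k)" if "k < length y" for k
    using that len lu by (intro nth_equalityI)
      (auto simp: wr_def lu nth_list_update, auto simp: unl_def nth_append)
  have "reach k (conf Unload 0 w) (conf Unload k (unl k))" if "k \<le> length y" for k
    using that
  proof (induction k)
    case (Suc k)
    have "reach 1 (conf Unload k (unl k)) (conf Unload (nat (int k + 1)) (wr (unl k) k (Bit (y ! k))))"
      using Suc.prems len lu[of k] tr[of k] by (intro reach_conf) (auto simp: at)
    moreover have "nat (int k + 1) = Suc k" by simp
    ultimately have "reach 1 (conf Unload k (unl k)) (conf Unload (Suc k) (unl (Suc k)))"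
      using wr_eq Suc.prems by (metis Suc_le_lessD)
    then show ?case using Suc reach_trans[of k _ _ 1] by fastforce
  qed (simp add: unl_def reach_refl)
  then have 2: "reach (length y) (conf Unload 0 w) (conf Unload (length y) (unl (length y)))" by simp
  let ?k = "length y"
  define v where "v = drop (Suc ?k) w"
  let ?z = "map Bit y @ Blank # v"
  have z: "wr (unl ?k) ?k Blank = ?z"
    using len by (auto simp: wr_def unl_def v_def list_update_append Cons_nth_drop_Suc[symmetric])
  have ctl: "ctl Unload (cell_at (unl ?k) ?k) = (Rewind, Blank, -1)"
    using tr[of ?k] by (simp add: at)
  have final: "step (Rewind, [], Blank # u) = (Done, [Blank], u)" for u
    by (simp add: step_def gstep_def)
  have "reach (?k + 2) (conf Unload ?k (unl ?k)) (Done, [Blank], ?z)"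
  \<comment> \<open>For empty output the head stands in cell 0 already when it turns round, and so
    leaves the tape at once.\<close>
  proof (cases "?k = 0")
    case True
    then have "step (conf Unload ?k (unl ?k)) = (Rewind, [], Blank # ?z)"
      using ctl z len by (cases w) (auto simp: step_def gstep_def conf_def unl_def cell_at_def v_def)
    then have "reach 1 (conf Unload ?k (unl ?k)) (Rewind, [], Blank # ?z)" using reach_step by metis
    moreover have "reach 1 (Rewind, [], Blank # ?z) (Done, [Blank], ?z)" using reach_step final by metis
    ultimately show ?thesis using reach_trans[of 1 _ _ 1] True by fastforce
  next
    case False
    then obtain j where j: "?k = Suc j" by (cases ?k) auto
    have "reach 1 (conf Unload ?k (unl ?k)) (conf Rewind (nat (int ?k + - 1)) (wr (unl ?k) ?k Blank))"
      using ctl False len lu by (intro reach_conf) auto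
    then have "reach 1 (conf Unload ?k (unl ?k)) (conf Rewind j ?z)" using j z by simp
    moreover have cz: "cell_at ?z i = Bit (y ! i)" if "i < ?k" for i
      using that by (auto simp: cell_at_def nth_append)
    then have "reach j (conf Rewind j ?z) (conf Rewind 0 ?z)"
      using j by (intro sweep_left) auto
    moreover have "step (conf Rewind 0 ?z) = (Rewind, [], Blank # ?z)"
      using j by (cases y) (auto simp: step_def gstep_def conf_def)
    then have "reach 1 (conf Rewind 0 ?z) (Rewind, [], Blank # ?z)" using reach_step by metis
    moreover have "reach 1 (Rewind, [], Blank # ?z) (Done, [Blank], ?z)" using reach_step final by metis
    ultimately have "reach (1 + j + 1 + 1) (conf Unload ?k (unl ?k)) (Done, [Blank], ?z)"
      by (blast intro: reach_trans)
    then show ?thesis using j by simp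
  qed
  from reach_trans[OF reach_trans[OF 1 2] this]
  have "reach (1 + ?k + (?k + 2)) (conf (Run Skip) 0 w) (Done, [Blank], ?z)" .
  then have "reach (2 * length (s out) + 4) (conf (Run Skip) 0 w) (Done, [Blank], ?z)"
    by (rule reach_mono) (simp add: y_def)
  then show ?thesis unfolding y_def by blast
qed

lemma total_run:
  assumes "runs prog ((\<lambda>_. [])(inp := rev x)) n s'"
  shows "\<exists>l v. reach (20 * (length x + n + 1) ^ 2) (Load0, [], map Bit x) (Done, l, map Bit (rev (s' out)) @ Blank # v)"
proof -
  let ?s = "(\<lambda>_. [])(inp := rev x)" and ?N = "length x + n + 1"
  obtain w where w: "represents w ?s" "reach (2 * length x + 2) (conf Load0 0 (map Bit x)) (conf (Run prog) 0 w)"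
    using load_phase by blast
  have H: "length (?s r) \<le> length x" for r by simp
  obtain w' where w': "represents w' s'" "reach (n * (2 * (length x + n) + 5)) (conf (Run prog) 0 w) (conf (Run Skip) 0 w')"
    using simulate_run[OF w(1) assms H] by blast
  obtain l v where lv: "reach (2 * length (s' out) + 4) (conf (Run Skip) 0 w') (Done, l, map Bit (rev (s' out)) @ Blank # v)"
    using unload_phase[OF w'(1)] by blast
  have bound: "a + b + d \<le> 20 * Q" if "a \<le> 2 * N" "b \<le> 7 * Q" "d \<le> 4 * N" "N \<le> Q" for a b d N Q :: nat
    using that by linarith
  have "n * (2 * (length x + n) + 5) \<le> ?N * (7 * ?N)" by (rule mult_mono) auto
  then have "n * (2 * (length x + n) + 5) \<le> 7 * ?N ^ 2" by (simp only: power2_eq_square mult.left_commute)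
  then have "2 * length x + 2 + n * (2 * (length x + n) + 5) + (2 * length (s' out) + 4) \<le> 20 * ?N ^ 2"
    using length_runs[OF assms H, of out] by (intro bound[of _ ?N]) (simp_all add: power2_eq_square)
  then show ?thesis using reach_mono[OF reach_trans[OF reach_trans[OF w(2) w'(2)] lv]]
    by (auto simp: conf_def)
qed

end

theorem tm_of_program:
  fixes inp out :: "'r::finite"
  shows "\<exists>M. tm_wf M \<and> (\<forall>x n s'. runs prog ((\<lambda>_. [])(inp := rev x)) n s' \<longrightarrow>
     tm_computes_in M x (rev (s' out)) (20 * (length x + n + 1) ^ 2))"
proof -
  interpret compiler inp out prog .
  obtain M f g where M: "tm_wf M" "inj_on f ctl_states" "inj g" "f Load0 = 0" "f Done = 1"
     "g Blank = 0" "g (Bit False) = 1" "g (Bit True) = 2"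
     "\<And>n q l r. q \<in> ctl_states \<Longrightarrow> (case (step ^^ n) (q, l, r) of (q', l', r') \<Rightarrow>
           (tm_step M ^^ n) (f q, map g l, map g r) = (f q', map g l', map g r'))"
  proof -
    have "Load0 \<in> ctl_states" "Done \<in> ctl_states" "Load0 \<noteq> Done" "distinct [Blank, Bit False, Bit True :: 'r cell]"
      using ctl_states_iff(6) by auto
    from tm_of_gstep[of ctl_states, OF finite_ctl_states finite_cell this, of ctl, OF ctl_closed ctl_move]
    show ?thesis using that unfolding step_def by blast
  qed
  have g: "g (Bit b) = (if b then 2 else 1)" for b using M by simp
  have "tm_computes_in M x (rev (s' out)) (20 * (length x + n + 1) ^ 2)"
    if run: "runs prog ((\<lambda>_. [])(inp := rev x)) n s'" for x n s'
  proof -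
    obtain k l v where k: "k \<le> 20 * (length x + n + 1) ^ 2"
        "(step ^^ k) (Load0, [], map Bit x) = (Done, l, map Bit (rev (s' out)) @ Blank # v)"
      using total_run[OF run] unfolding reach_def by blast
    have init: "tm_init x = (f Load0, map g [], map g (map Bit x))"
      using M g by (simp add: tm_init_def)
    have Q: "Load0 \<in> ctl_states" using ctl_states_iff(6) by simp
    have "(tm_step M ^^ k) (tm_init x) = (f Done, map g l, map g (map Bit (rev (s' out)) @ Blank # v))"
      using M(9)[OF Q, of k "[]" "map Bit x"] k(2) init by simp
    \<comment> \<open>\<open>tm_output\<close> stops at the symbol 0, the code of the
      \<open>Blank\<close> behind the last output bit, whatever follows it.\<close>
    moreover have "map (\<lambda>a. a = 2) (takeWhile (\<lambda>a. a = 1 \<or> a = 2) (map (g \<circ> Bit) y @ 0 # v')) = y" for y and v' :: "nat list"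
      by (induction y) (auto simp: g)
    ultimately show ?thesis
      unfolding tm_computes_in_def using k(1) M by (intro exI[of _ k]) (simp add: tm_output_def)
  qed
  with M(1) show ?thesis by blast
qed

section \<open>Subroutines on stacks\<close>

lemma runs_weaken:
  assumes "runs c s n s1" "n \<le> m" "s1 = s'"
  shows "runs c s m s'"
  using runs_mono assms by blast

fun pushes :: "'r \<Rightarrow> bool list \<Rightarrow> 'r com" where
  "pushes r [] = Skip"
| "pushes r (b # bs) = Seq (Push r b) (pushes r bs)"

lemma runs_pushes: "runs (pushes r bs) s (2 * length bs) (s(r := rev bs @ s r))"
proof (induction bs arbitrary: s)
  case Nil
  then show ?case by (simp add: runs_Skip)
next
  case (Cons b bs)
  show ?case
    by (rule runs_weaken, unfold pushes.simps, rule runs_Seq[OF runs_Push Cons]) auto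
qed

lemma runs_pop:
  assumes "s r = b # bs"
  shows "runs (Branch r Skip Skip Skip) s 1 (s(r := bs))"
proof -
  have "runs (Branch r Skip Skip Skip) s (Suc 0) (s(r := bs))"
    by (rule runs_Branch) (use assms in \<open>auto intro: runs_Skip\<close>)
  then show ?thesis by simp
qed

text \<open>The code \<open>enc_nat\<close> without its terminator. The \<open>True\<close> before
  every bit is what a \<open>While\<close> loop tests, so that such codes can be traversed directly;
  counters are also stored in this form.\<close>

definition pairs :: "bool list \<Rightarrow> bool list" where
  "pairs bs = concat (map (\<lambda>b. [True, b]) bs)"

lemma pairs_simps [simp]:
  "pairs [] = []" "pairs (b # bs) = True # b # pairs bs" "pairs (bs @ cs) = pairs bs @ pairs cs"
  by (simp_all add: pairs_def)

lemma length_pairs [simp]: "length (pairs bs) = 2 * length bs"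
  by (induction bs) auto

lemma enc_nat_pairs: "enc_nat n = pairs (bits n) @ [False, False]"
  by (simp add: enc_nat_def pairs_def)

declare bits.simps [simp del]

text \<open>\<open>While\<close> consumes the leading \<open>True\<close> of a pair and
  \<open>Branch\<close> the bit itself. The failing last test also consumes the \<open>False\<close>
  after the pairs, if there is one; this is the \<open>tl rest\<close> below.\<close>

definition transfer :: "'r \<Rightarrow> (bool \<Rightarrow> 'r com) \<Rightarrow> 'r com" where
  "transfer a c = While a (Branch a Skip (c False) (c True))"

lemma runs_transfer:
  assumes "s a = pairs bs @ rest" "rest = [] \<or> hd rest = False"
    and body: "\<And>b s. runs (c b) s B (g b s)"
    and g: "\<And>b s. g b s a = s a"
  shows "\<exists>s'. s' = (fold (\<lambda>b s. g b (s(a := tl (tl (s a))))) bs s) \<and>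
    runs (transfer a c) s (length bs * (B + 3) + 1) (s'(a := tl rest))"
  using assms(1)
proof (induction bs arbitrary: s)
  case Nil
  have "s a = [] \<or> hd (s a) = False" "tl (s a) = tl rest" using Nil assms(2) by auto
  with runs_While_stop[of s a, OF this(1), of "Branch a Skip (c False) (c True)"] show ?case
    by (simp add: transfer_def del: fun_upd_apply)
next
  case (Cons b bs)
  let ?s = "g b (s(a := tl (tl (s a))))"
  have "?s a = pairs bs @ rest" using Cons.prems g by simp
  from Cons.IH[of ?s, OF this] obtain s' where s': 
    "s' = fold (\<lambda>b s. g b (s(a := tl (tl (s a))))) bs ?s"
    "runs (transfer a c) ?s (length bs * (B + 3) + 1) (s'(a := tl rest))" by blast
  have "runs (Branch a Skip (c False) (c True)) (s(a := b # pairs bs @ rest)) (Suc B) ?s"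
    using Cons.prems body[of b "s(a := pairs bs @ rest)"]
    by (intro runs_Branch) auto
  from runs_While_step[OF _ this s'(2)[unfolded transfer_def]] Cons.prems
  have "runs (transfer a c) s (Suc B + (length bs * (B + 3) + 1) + 2) (s'(a := tl rest))"
    by (simp add: transfer_def)
  then have "runs (transfer a c) s (length (b # bs) * (B + 3) + 1) (s'(a := tl rest))"
    by (rule runs_mono) simp
  then show ?case using s'(1) by (simp del: fun_upd_apply)
qed

text \<open>Pushing the bit first and \<open>True\<close> second leaves a stack that can be
  traversed again, with the bits in reverse order.\<close>

lemma runs_transfer_reverse:
  assumes "s a = pairs bs @ rest" "rest = [] \<or> hd rest = False" "a \<noteq> b"
  shows "runs (transfer a (\<lambda>x. pushes b [x, True])) s (length bs * 7 + 1)
    (s(a := tl rest, b := pairs (rev bs) @ s b))"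
proof -
  let ?g = "\<lambda>x s. s(b := True # x # s b)"
  have 1: "runs (pushes b [x, True]) s 4 (?g x s)" for x s
    using runs_pushes[of b "[x, True]" s] by simp
  have "(fold (\<lambda>x s. ?g x (s(a := tl (tl (s a))))) bs s)(a := tl rest) =
      s(a := tl rest, b := pairs (rev bs) @ s b)" for s
    using assms(3) by (induction bs arbitrary: s) (auto simp: fun_upd_twist fun_eq_iff)
  with runs_transfer[of s a bs rest "\<lambda>x. pushes b [x, True]" 4 ?g, OF assms(1,2) 1] assms(3)
  show ?thesis by auto
qed

text \<open>The opposite order of pushes yields the code as read from the bottom, which is how
  output stacks are read.\<close>

lemma runs_transfer_pairs:
  assumes "s a = pairs bs" "a \<noteq> b"
  shows "runs (transfer a (\<lambda>x. pushes b [True, x])) s (length bs * 7 + 1)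
    (s(a := [], b := rev (pairs bs) @ s b))"
proof -
  let ?g = "\<lambda>x s. s(b := x # True # s b)"
  have 1: "runs (pushes b [True, x]) s 4 (?g x s)" for x s
    using runs_pushes[of b "[True, x]" s] by simp
  have "(fold (\<lambda>x s. ?g x (s(a := tl (tl (s a))))) bs s)(a := []) =
      s(a := [], b := rev (pairs bs) @ s b)" for s
    using assms(2) by (induction bs arbitrary: s) (auto simp: fun_upd_twist fun_eq_iff)
  with runs_transfer[of s a bs "[]" "\<lambda>x. pushes b [True, x]" 4 ?g, OF _ _ 1] assms
  show ?thesis by auto
qed

lemma runs_transfer_both:
  assumes "s a = pairs bs" "distinct [a, b, d]"
  shows "runs (transfer a (\<lambda>x. Seq (pushes b [True, x]) (pushes d [x, True]))) s (length bs * 12 + 1)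
    (s(a := [], b := rev (pairs bs) @ s b, d := pairs (rev bs) @ s d))"
proof -
  let ?g = "\<lambda>x s. s(b := x # True # s b, d := True # x # s d)"
  have 1: "runs (Seq (pushes b [True, x]) (pushes d [x, True])) s 9 (?g x s)" for x s
    by (rule runs_weaken, rule runs_Seq, rule runs_pushes, rule runs_pushes) (use assms(2) in auto)
  have "(fold (\<lambda>x s. ?g x (s(a := tl (tl (s a))))) bs s)(a := []) =
      s(a := [], b := rev (pairs bs) @ s b, d := pairs (rev bs) @ s d)" for s
    using assms(2) by (induction bs arbitrary: s) (auto simp: fun_upd_twist fun_eq_iff)
  with runs_transfer[of s a bs "[]" "\<lambda>x. Seq (pushes b [True, x]) (pushes d [x, True])" 9 ?g, OF _ _ 1] assms
  show ?thesis by auto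
qed

text \<open>The loops below run until a stack is empty or a carry is absorbed; they are controlled by
  a flag stack holding True as long as another round is due.\<close>

definition move :: "'r \<Rightarrow> 'r \<Rightarrow> 'r \<Rightarrow> 'r com" where
  "move fl a b = Seq (Push fl True)
     (While fl (Branch a Skip (Seq (Push b False) (Push fl True)) (Seq (Push b True) (Push fl True))))"

lemma runs_move:
  assumes "s fl = []" "distinct [fl, a, b]"
  shows "runs (move fl a b) s (6 * length (s a) + 7) (s(a := [], b := rev (s a) @ s b))"
proof -
  let ?body = "Branch a Skip (Seq (Push b False) (Push fl True)) (Seq (Push b True) (Push fl True))"
  have push: "runs (Seq (Push b x) (Push fl True)) s 3 (s(b := x # s b, fl := True # s fl))" for x s
    by (rule runs_weaken, rule runs_Seq, rule runs_Push, rule runs_Push) (use assms(2) in auto)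
  have loop: "runs (While fl ?body) s (6 * length (s a) + 5)
      (s(a := [], fl := [], b := rev (s a) @ s b))" if "s fl = [True]" for s
    using that
  proof (induction "s a" arbitrary: s)
    case Nil
    have "runs ?body (s(fl := [])) 1 (s(fl := []))"
      unfolding One_nat_def using Nil(1) assms(2) by (intro runs_Branch) (auto simp: runs_Skip)
    then have "runs (While fl ?body) s (1 + 1 + 2) (s(fl := []))"
      using Nil by (intro runs_While_step[of _ _ _ _ _ "s(fl := [])"] runs_weaken[OF runs_While_stop]) auto
    then show ?case using Nil(1) assms(2)
      by (elim runs_weaken) (auto simp: fun_eq_iff)
  next
    case (Cons x xs)
    let ?s = "s(a := xs, b := x # s b)"
    have sa: "s a = x # xs" using Cons(2) by simp
    have "runs ?body (s(fl := [])) (Suc 3) ?s"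
      using push[of x "s(fl := [], a := xs)"] assms(2) sa Cons.prems
      by (intro runs_Branch) (auto simp: fun_upd_twist elim!: runs_weaken intro!: ext)
    moreover have "runs (While fl ?body) ?s (6 * length xs + 5) (?s(a := [], fl := [], b := rev xs @ ?s b))"
      using Cons.hyps(1)[of ?s] Cons.prems assms(2) by auto
    ultimately have "runs (While fl ?body) s (Suc 3 + (6 * length xs + 5) + 2) (?s(a := [], fl := [], b := rev xs @ ?s b))"
      using Cons.prems by (intro runs_While_step[of s fl "[]"]) auto
    then show ?case using sa assms(2) by (elim runs_weaken) (auto simp: fun_eq_iff)
  qed
  have "runs (move fl a b) s (1 + (6 * length ((s(fl := [True])) a) + 5) + 1)
      ((s(fl := [True]))(a := [], fl := [], b := rev ((s(fl := [True])) a) @ (s(fl := [True])) b))"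
    unfolding move_def using runs_Push[of fl True s] assms(1)
    by (intro runs_Seq[OF _ loop]) (simp_all only: fun_upd_same)
  then show ?thesis using assms by (elim runs_weaken) (auto simp: fun_eq_iff)
qed

text \<open>Reading a counter destroys it; a reversed copy on \<open>t\<close> is turned back in
  order to restore it.\<close>

definition print_num :: "'r \<Rightarrow> 'r \<Rightarrow> 'r \<Rightarrow> 'r com" where
  "print_num a t b = Seq (transfer a (\<lambda>x. Seq (pushes b [True, x]) (pushes t [x, True])))
     (Seq (transfer t (\<lambda>x. pushes a [x, True])) (pushes b [False, False]))"

lemma runs_print_num:
  assumes "s a = pairs (bits n)" "s t = []" "distinct [a, t, b]"
  shows "runs (print_num a t b) s (20 * (length (bits n) + 1)) (s(b := rev (enc_nat n) @ s b))"
proof -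
  let ?s1 = "s(a := [], b := rev (pairs (bits n)) @ s b, t := pairs (rev (bits n)))"
  let ?s2 = "s(b := rev (pairs (bits n)) @ s b)"
  have 1: "runs (transfer a (\<lambda>x. Seq (pushes b [True, x]) (pushes t [x, True]))) s (length (bits n) * 12 + 1) ?s1"
    by (rule runs_weaken, rule runs_transfer_both[where s = s and a = a, OF assms(1)]) (use assms in auto)
  have 2: "runs (transfer t (\<lambda>x. pushes a [x, True])) ?s1 (length (bits n) * 7 + 1) ?s2"
    by (rule runs_weaken, rule runs_transfer_reverse[of _ _ "rev (bits n)" "[]"]) (use assms in \<open>auto simp: fun_eq_iff\<close>)
  show ?thesis unfolding print_num_def
    by (rule runs_weaken[OF runs_Seq[OF 1 runs_Seq[OF 2 runs_pushes]]]) (auto simp: enc_nat_pairs)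
qed

section \<open>Incrementing a binary counter\<close>

fun increment :: "bool list \<Rightarrow> bool list" where
  "increment [] = [True]"
| "increment (False # bs) = True # bs"
| "increment (True # bs) = False # increment bs"

lemma bits_0 [simp]: "bits 0 = []"
  by (simp add: bits.simps)

lemma bits_double: "0 < n \<or> b \<Longrightarrow> bits (2 * n + of_bool b) = b # bits n"
  by (subst bits.simps) (auto split: if_splits)

lemma bits_Suc: "bits (Suc n) = increment (bits n)"
proof (induction n rule: less_induct)
  case (less n)
  show ?case
  proof (cases "odd n")
    case True
    then obtain k where k: "n = 2 * k + 1" by (elim oddE)
    have "bits (Suc n) = False # bits (Suc k)" using bits_double[of "Suc k" False] k by simp
    moreover have "bits n = True # bits k" using bits_double[of k True] k by simp
    ultimately show ?thesis using less[of k] k by simp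
  next
    case False
    then obtain k where k: "n = 2 * k" by auto
    have "bits (Suc n) = True # bits k" using bits_double[of k True] k by simp
    moreover have "bits n = (if k = 0 then [] else False # bits k)" using bits_double[of k False] k by simp
    ultimately show ?thesis by simp
  qed
qed

lemma length_increment: "length (increment bs) \<le> Suc (length bs)"
  by (induction bs rule: increment.induct) auto

lemma length_bits: "length (bits n) \<le> n"
proof (induction n)
  case (Suc n)
  then show ?case using length_increment[of "bits n"] by (simp add: bits_Suc)
qed simp

text \<open>The low bits through which the carry passes become \<open>False\<close> and are parked
  on \<open>t\<close>. As they are all equal, the reversal by \<open>transfer\<close> does not
  disturb them.\<close>

definition add_one :: "'r \<Rightarrow> 'r \<Rightarrow> 'r \<Rightarrow> 'r com" where
  "add_one fl t a = Seq (Push fl True) (Seq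
     (While fl (Branch a (pushes a [True, True]) Skip
        (Branch a Skip (pushes a [True, True]) (Seq (pushes t [False, True]) (Push fl True)))))
     (transfer t (\<lambda>x. pushes a [x, True])))"

lemma runs_add_one:
  assumes "s a = pairs (bits n)" "s t = []" "s fl = []" "distinct [fl, t, a]"
  shows "runs (add_one fl t a) s (20 * (length (bits n) + 1)) (s(a := pairs (bits (Suc n))))"
proof -
  let ?body = "Branch a (pushes a [True, True]) Skip
        (Branch a Skip (pushes a [True, True]) (Seq (pushes t [False, True]) (Push fl True)))"
  have tt: "runs (pushes a [True, True]) s 4 (s(a := True # True # s a))" for s
    using runs_pushes[of a "[True, True]" s] by simp
  have carry: "runs (Seq (pushes t [False, True]) (Push fl True)) s 6 (s(t := True # False # s t, fl := True # s fl))" for s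
    by (rule runs_weaken, rule runs_Seq, rule runs_pushes, rule runs_Push) (use assms(4) in auto)
  \<comment> \<open>Here \<open>k\<close> is the number of positions the carry passes and
    \<open>cs\<close> the part left on the counter after the carry is absorbed.\<close>
  have loop: "\<exists>k cs. k \<le> length bs \<and> increment bs = replicate k False @ cs \<and>
      runs (While fl ?body) s (10 * length bs + 8)
        (s(a := pairs cs, fl := [], t := pairs (replicate k False) @ s t))"
    if "s fl = [True]" "s a = pairs bs" for s bs
    using that
  proof (induction bs arbitrary: s rule: increment.induct)
    case 1
    let ?s = "s(fl := [], a := [True, True])"
    have "runs ?body (s(fl := [])) (Suc 4) ?s"
      using 1 assms(4) tt[of "s(fl := [])"] by (intro runs_Branch) auto
    then have "runs (While fl ?body) s (Suc 4 + 1 + 2) ?s"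
      using 1 assms(4) by (intro runs_While_step[of s fl "[]" ?body _ ?s] runs_weaken[OF runs_While_stop]) auto
    then have "runs (While fl ?body) s (10 * length [] + 8)
        (s(a := pairs [True], fl := [], t := pairs (replicate 0 False) @ s t))"
      by (rule runs_weaken) (use assms(4) in \<open>auto simp: fun_eq_iff\<close>)
    then show ?case by (intro exI[of _ 0] exI[of _ "[True]"]) (simp del: fun_upd_apply pushes.simps)
  next
    case (2 bs)
    let ?s = "s(fl := [], a := pairs (True # bs))"
    have "runs ?body (s(fl := [])) (Suc (Suc 4)) ?s"
      using 2 assms(4) tt[of "s(fl := [], a := pairs bs)"]
      by (intro runs_Branch) auto
    then have "runs (While fl ?body) s (Suc (Suc 4) + 1 + 2) ?s"
      using 2 assms(4) by (intro runs_While_step[of s fl "[]" ?body _ ?s] runs_weaken[OF runs_While_stop]) auto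
    then have "runs (While fl ?body) s (10 * length (False # bs) + 8)
        (s(a := pairs (True # bs), fl := [], t := pairs (replicate 0 False) @ s t))"
      by (rule runs_weaken) (use assms(4) in \<open>auto simp: fun_eq_iff\<close>)
    then show ?case by (intro exI[of _ 0] exI[of _ "True # bs"]) (simp del: fun_upd_apply pushes.simps)
  next
    case (3 bs)
    let ?s = "s(a := pairs bs, t := True # False # s t)"
    have "?s fl = [True]" "?s a = pairs bs" using 3 assms(4) by auto
    from 3(1)[OF this] obtain k cs where k: "k \<le> length bs" "increment bs = replicate k False @ cs"
        "runs (While fl ?body) ?s (10 * length bs + 8)
          (?s(a := pairs cs, fl := [], t := pairs (replicate k False) @ ?s t))" by blast
    have "runs ?body (s(fl := [])) (Suc (Suc 6)) ?s"
      using 3(2,3) assms(4) carry[of "s(fl := [], a := pairs bs)"]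
      by (intro runs_Branch) (auto elim!: runs_weaken simp: fun_eq_iff)
    with k(3) have "runs (While fl ?body) s (Suc (Suc 6) + (10 * length bs + 8) + 2)
          (?s(a := pairs cs, fl := [], t := pairs (replicate k False) @ ?s t))"
      using 3(2) by (intro runs_While_step[of _ _ "[]" _ _ ?s]) auto
    moreover have "pairs (replicate k False) @ [True, False] = pairs (replicate (Suc k) False)"
      by (induction k) auto
    then have "pairs (replicate k False) @ True # False # u = pairs (replicate (Suc k) False) @ u" for u
      by (metis append.assoc append_Cons append_Nil)
    ultimately have "runs (While fl ?body) s (10 * length (True # bs) + 8)
          (s(a := pairs cs, fl := [], t := pairs (replicate (Suc k) False) @ s t))"
      using assms(4) by (elim runs_weaken) (auto simp: fun_eq_iff)
    then show ?case using k(1,2) by (intro exI[of _ "Suc k"] exI[of _ cs]) (simp del: fun_upd_apply pushes.simps pairs_simps(2))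
  qed
  have "(s(fl := [True])) fl = [True]" "(s(fl := [True])) a = pairs (bits n)" using assms by auto
  from loop[OF this] obtain k cs where k: "k \<le> length (bits n)" "increment (bits n) = replicate k False @ cs"
    "runs (While fl ?body) (s(fl := [True])) (10 * length (bits n) + 8)
        (s(fl := [True], a := pairs cs, fl := [], t := pairs (replicate k False) @ (s(fl := [True])) t))" by blast
  let ?s = "s(a := pairs cs, t := pairs (replicate k False))"
  have 1: "runs (Push fl True) s 1 (s(fl := [True]))" using runs_Push[of fl True s] assms by simp
  have 2: "runs (While fl ?body) (s(fl := [True])) (10 * length (bits n) + 8) ?s"
    using k(3) assms by (elim runs_weaken) (auto simp: fun_eq_iff)
  have 3: "runs (transfer t (\<lambda>x. pushes a [x, True])) ?s (length (replicate k False) * 7 + 1)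
      (?s(t := tl [], a := pairs (rev (replicate k False)) @ ?s a))"
    using assms by (intro runs_transfer_reverse) auto
  show ?thesis unfolding add_one_def
    by (rule runs_weaken[OF runs_Seq[OF 1 runs_Seq[OF 2 3]]]) (use k assms in \<open>auto simp: bits_Suc fun_eq_iff\<close>)
qed

section \<open>The network\<close>

text \<open>Agent 0 is the decision maker and agent 1 the switch, whose signal 0 disables all clauses.
  The signal 0 of the literal agent for (v, b) means that the literal (v, b) is true.  The pair
  agent of a variable checks that its two literals are not both true, a clause agent that one of
  its literals is true or the clause is disabled.\<close>

definition pair_agent :: "nat \<Rightarrow> nat" where "pair_agent i = 8 * i + 4"
definition clause_agent :: "nat \<Rightarrow> nat" where "clause_agent i = 8 * i + 5"
definition lit_agent :: "nat \<times> bool \<Rightarrow> nat" where "lit_agent l = 8 * fst l + 6 + of_bool (snd l)"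

definition variable_edges :: "nat \<Rightarrow> (nat \<times> nat) list" where
  "variable_edges i = [(0, pair_agent i), (pair_agent i, lit_agent (i, False)), (pair_agent i, lit_agent (i, True))]"

definition clause_edges :: "nat \<Rightarrow> (nat \<times> bool) list \<Rightarrow> (nat \<times> nat) list" where
  "clause_edges i c = [(0, clause_agent i), (clause_agent i, 1)] @ map (\<lambda>l. (clause_agent i, lit_agent l)) c"

definition network_edges :: "cnf \<Rightarrow> (nat \<times> nat) list" where
  "network_edges \<phi> = concat (map variable_edges [0..<fst \<phi>]) @
     concat (map (\<lambda>j. clause_edges (fst \<phi> + j) (snd \<phi> ! j)) [0..<length (snd \<phi>)])"

text \<open>The requirements pT = 2 pF and 1 - pT = (1 - pF) / 8 for literal agents have the
  solution 14/15 and 7/15; pair agents have the factor 8 and, symmetrically, 1/8. The residue modulo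
  4 identifies the kind of an agent; numbers outside all gates belong to isolated agents, which are
  summed out later.\<close>

definition network :: "cnf \<Rightarrow> bnet" where
  "network \<phi> = \<lparr>n_agents = 8 * (num_vars \<phi> + num_clauses \<phi>) + 4, edges = network_edges \<phi>,
     pT = (\<lambda>v. if v = 0 then 1/2 else if v = 1 then 1 - (1/2) ^ (10 * (num_vars \<phi> + 1))
             else if v mod 4 = 0 then 8/9 else if v mod 4 = 1 then 1/2 else 14/15),
     pF = (\<lambda>v. if v = 0 then 1/2 else if v = 1 then 1 - (1/2) ^ (3 * (num_vars \<phi> + 1))
             else if v mod 4 = 0 then 1/9 else if v mod 4 = 1 then 1/2 else 7/15)\<rparr>"

text \<open>Pair agents are even and clause agents odd, so one formula prescribes T for the former
  and F for the latter, in both rounds. In round 0 this forces signal 1 of the pair agents, while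
  clause agents are undecided and play F by the tie rule anyway.\<close>

definition reduction :: "cnf \<Rightarrow> bay_input" where
  "reduction \<phi> = \<lparr>net = network \<phi>, time = 2, agent = 0, hist = (\<lambda>w t. even w)\<rparr>"

lemma network_simps [simp]:
  "n_agents (network \<phi>) = 8 * (num_vars \<phi> + num_clauses \<phi>) + 4" "edges (network \<phi>) = network_edges \<phi>"
  by (simp_all add: network_def)

lemma reduction_simps [simp]:
  "net (reduction \<phi>) = network \<phi>" "time (reduction \<phi>) = 2" "agent (reduction \<phi>) = 0"
  "hist (reduction \<phi>) = (\<lambda>w t. even w)"
  by (simp_all add: reduction_def)

lemma pair_agent_eq [simp]:
  "pair_agent i = pair_agent j \<longleftrightarrow> i = j" "pair_agent i \<noteq> 0" "pair_agent i \<noteq> 1" "pair_agent i \<noteq> Suc 0"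
  "pair_agent i \<noteq> clause_agent k" "pair_agent i \<noteq> lit_agent l"
  by (auto simp: pair_agent_def clause_agent_def lit_agent_def of_bool_def; presburger)+

lemma clause_agent_eq [simp]:
  "clause_agent i = clause_agent j \<longleftrightarrow> i = j" "clause_agent i \<noteq> 0" "clause_agent i \<noteq> 1" "clause_agent i \<noteq> Suc 0"
  "clause_agent i \<noteq> pair_agent k" "clause_agent i \<noteq> lit_agent l"
  by (auto simp: pair_agent_def clause_agent_def lit_agent_def of_bool_def; presburger)+

lemma lit_agent_eq [simp]:
  "lit_agent l = lit_agent l' \<longleftrightarrow> l = l'" "lit_agent l \<noteq> 0" "lit_agent l \<noteq> 1" "lit_agent l \<noteq> Suc 0"
  "lit_agent l \<noteq> pair_agent k" "lit_agent l \<noteq> clause_agent k"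
  by (auto simp: pair_agent_def clause_agent_def lit_agent_def of_bool_def prod_eq_iff; presburger)+

lemma edges_variable:
  "(v, w) \<in> set (variable_edges i) \<longleftrightarrow>
     v = 0 \<and> w = pair_agent i \<or> v = pair_agent i \<and> (w = lit_agent (i, False) \<or> w = lit_agent (i, True))"
  by (auto simp: variable_edges_def)

lemma edges_clause:
  "(v, w) \<in> set (clause_edges i c) \<longleftrightarrow>
     v = 0 \<and> w = clause_agent i \<or> v = clause_agent i \<and> (w = 1 \<or> w \<in> lit_agent ` set c)"
  by (auto simp: clause_edges_def)

lemma observes_network:
  "observes (network \<phi>) v w \<longleftrightarrow>
     (\<exists>i < num_vars \<phi>. (v, w) \<in> set (variable_edges i)) \<or>
     (\<exists>j < num_clauses \<phi>. (v, w) \<in> set (clause_edges (num_vars \<phi> + j) (snd \<phi> ! j)))"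
  by (auto simp: observes_def network_edges_def num_vars_def num_clauses_def)

lemma observes_decider:
  "observes (network \<phi>) 0 w \<longleftrightarrow>
     w \<in> pair_agent ` {..<num_vars \<phi>} \<union> clause_agent ` {num_vars \<phi>..<num_vars \<phi> + num_clauses \<phi>}"
proof -
  have "w \<in> clause_agent ` {num_vars \<phi>..<num_vars \<phi> + num_clauses \<phi>} \<longleftrightarrow>
      (\<exists>j < num_clauses \<phi>. w = clause_agent (num_vars \<phi> + j))"
    by (auto simp: image_iff) (metis add_diff_inverse_nat add_less_cancel_left not_less)
  then show ?thesis
    by (auto simp: observes_network edges_variable edges_clause)
qed

text \<open>The history is encoded in the order of agent numbers. Clause indices start at N, so that
  all pair agents precede all clause agents and each part is a constant block.\<close>

lemma observed_agents:
  "filter (observes (network \<phi>) 0) [0..<n_agents (network \<phi>)] =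
     map pair_agent [0..<num_vars \<phi>] @ map clause_agent [num_vars \<phi>..<num_vars \<phi> + num_clauses \<phi>]"
    (is "?l = ?r")
proof (rule sorted_distinct_set_unique)
  show "sorted ?l" by (simp add: sorted_wrt_filter)
  show "distinct ?l" by simp
  show "sorted ?r"
    by (auto simp: sorted_append sorted_map pair_agent_def clause_agent_def sorted_wrt_upt
        intro!: sorted_wrt_mono_rel[OF _ sorted_upt])
  show "distinct ?r"
    by (auto simp: distinct_map inj_on_def)
  show "set ?l = set ?r"
    by (auto simp: observes_decider pair_agent_def clause_agent_def)
qed

text \<open>The summand 4 keeps the third bit set even for index 0, so the kind of an agent is a
  prefix of fixed length and the program can print agents from a counter of indices.\<close>

lemma bits_agent: "bits (8 * n + 4 + 2 * of_bool b + of_bool a) = a # b # True # bits n"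
proof -
  have "bits (2 * (4 * n + 2 + of_bool b) + of_bool a) = a # bits (4 * n + 2 + of_bool b)"
    by (rule bits_double) simp
  moreover have "bits (2 * (2 * n + 1) + of_bool b) = b # bits (2 * n + 1)" by (rule bits_double) simp
  moreover have "bits (2 * n + of_bool True) = True # bits n" by (rule bits_double) simp
  moreover have "2 * (4 * n + 2 + of_bool b) = 8 * n + 4 + 2 * of_bool b"
    "2 * (2 * n + 1) + of_bool b = 4 * n + 2 + of_bool b" by (simp_all add: algebra_simps)
  ultimately show ?thesis by (simp only: of_bool_eq mult_1_right)
qed

lemma enc_nat_agents:
  "enc_nat (pair_agent i) = [True, False, True, False, True, True] @ enc_nat i"
  "enc_nat (clause_agent i) = [True, True, True, False, True, True] @ enc_nat i"
  "enc_nat (lit_agent (v, b)) = [True, b, True, True, True, True] @ enc_nat v"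
  using bits_agent[of i False False] bits_agent[of i False True] bits_agent[of v True b]
  by (simp_all add: enc_nat_pairs pair_agent_def clause_agent_def lit_agent_def add.commute add.left_commute)

lemma enc_nat_small:
  "enc_nat 0 = [False, False]" "enc_nat 1 = [True, True, False, False]"
  "enc_nat (Suc 0) = [True, True, False, False]" "enc_nat 2 = [True, False, True, True, False, False]"
  by (simp_all add: enc_nat_def bits.simps)

text \<open>The number of agents happens to be \<open>pair_agent\<close> of N + M, hence the first
  prefix. The eight bits before the history encode time 2 and agent 0, and the history repeats
  itself in the second round.\<close>

lemma enc_reduction:
  "enc_bay_discrete (reduction \<phi>) =
     [True, False, True, False, True, True] @ enc_nat (num_vars \<phi> + num_clauses \<phi>) @
     enc_list (\<lambda>(v, w). enc_nat v @ enc_nat w) (network_edges \<phi>) @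
     [True, False, True, True, False, False, False, False] @
     (let h = concat (replicate (num_vars \<phi>) [True, True]) @ concat (replicate (num_clauses \<phi>) [True, False])
      in h @ h @ [False])"
proof -
  let ?N = "num_vars \<phi>" and ?M = "num_clauses \<phi>"
  have even: "even (pair_agent i)" "odd (clause_agent i)" for i
    by (simp_all add: pair_agent_def clause_agent_def)
  have h: "concat (map (\<lambda>t'. map (\<lambda>w. hist (reduction \<phi>) w t')
      (filter (\<lambda>w. observes (net (reduction \<phi>)) (agent (reduction \<phi>)) w) [0..<n_agents (net (reduction \<phi>))]))
      [0..<time (reduction \<phi>)]) =
    (replicate ?N True @ replicate ?M False) @ (replicate ?N True @ replicate ?M False)"
  proof -
    have "[0..<2] = [0, Suc 0]" by (simp add: upt_rec)
    moreover have "map (\<lambda>i. True) [0..<?N] = replicate ?N True" "map (\<lambda>i. False) [?N..<?N + ?M] = replicate ?M False"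
      by (simp_all add: map_replicate_const)
    ultimately show ?thesis
      using observed_agents[of \<phi>] by (simp add: comp_def even)
  qed
  have n: "n_agents (net (reduction \<phi>)) = pair_agent (?N + ?M)"
    by (simp add: pair_agent_def)
  have c: "concat (map (\<lambda>x. True # [x]) (replicate k b)) = concat (replicate k [True, b])" for k b
    by (induction k) auto
  show ?thesis
    unfolding enc_bay_discrete_def h unfolding n enc_nat_agents
    by (simp add: enc_nat_small enc_list_def c Let_def)
qed

section \<open>A program printing the reduction\<close>

datatype reg = Inp | Src | Out | Flag | Cnt | Aux | Edg | Hst1 | Hst2 | Lit

instance reg :: finite
proof
  have "(UNIV :: reg set) \<subseteq> {Inp, Src, Out, Flag, Cnt, Aux, Edg, Hst1, Hst2, Lit}"
    using reg.exhaust by blast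
  then show "finite (UNIV :: reg set)" by (rule finite_subset) simp
qed

text \<open>The stacks Inp, Flag, Aux and Lit are empty between the blocks of the program, which only
  leaves a state of the following form.\<close>

definition mem :: "bool list \<Rightarrow> bool list \<Rightarrow> bool list \<Rightarrow> bool list \<Rightarrow> bool list \<Rightarrow> bool list \<Rightarrow> reg \<Rightarrow> bool list" where
  "mem src out cnt edg h1 h2 = (\<lambda>_. [])(Src := src, Out := out, Cnt := cnt, Edg := edg, Hst1 := h1, Hst2 := h2)"

lemma mem_lookup [simp]:
  "mem a b c d e f Inp = []" "mem a b c d e f Src = a" "mem a b c d e f Out = b" "mem a b c d e f Flag = []"
  "mem a b c d e f Cnt = c" "mem a b c d e f Aux = []" "mem a b c d e f Edg = d" "mem a b c d e f Hst1 = e"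
  "mem a b c d e f Hst2 = f" "mem a b c d e f Lit = []"
  by (simp_all add: mem_def)

lemma mem_update [simp]:
  "(mem a b c d e f)(Src := x) = mem x b c d e f" "(mem a b c d e f)(Out := x) = mem a x c d e f"
  "(mem a b c d e f)(Cnt := x) = mem a b x d e f" "(mem a b c d e f)(Edg := x) = mem a b c x e f"
  "(mem a b c d e f)(Hst1 := x) = mem a b c d x f" "(mem a b c d e f)(Hst2 := x) = mem a b c d e x"
  by (auto simp: mem_def fun_eq_iff)

definition print_prefixed :: "reg \<Rightarrow> bool list \<Rightarrow> reg com" where
  "print_prefixed r p = Seq (pushes r p) (print_num Cnt Aux r)"

lemma runs_print_prefixed:
  assumes "s Cnt = pairs (bits n)" "s Aux = []" "r \<noteq> Cnt" "r \<noteq> Aux"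
    and "length (bits n) \<le> D" "length p \<le> 6"
  shows "runs (print_prefixed r p) s (20 * D + 33) (s(r := rev (p @ enc_nat n) @ s r))"
  unfolding print_prefixed_def
  by (rule runs_weaken, rule runs_Seq, rule runs_pushes, rule runs_print_num[of _ _ n]) (use assms in auto)

definition print_pair_agent :: "reg com" where
  "print_pair_agent = print_prefixed Edg [True, False, True, False, True, True]"

definition print_clause_agent :: "reg com" where
  "print_clause_agent = print_prefixed Edg [True, True, True, False, True, True]"

definition print_lit_agent :: "bool \<Rightarrow> reg com" where
  "print_lit_agent b = print_prefixed Edg [True, b, True, True, True, True]"

lemma runs_print_agent:
  assumes "length (bits i) \<le> D"
  shows "runs print_pair_agent (mem a b (pairs (bits i)) d e f) (20 * D + 33)
      (mem a b (pairs (bits i)) (rev (enc_nat (pair_agent i)) @ d) e f)"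
    and "runs print_clause_agent (mem a b (pairs (bits i)) d e f) (20 * D + 33)
      (mem a b (pairs (bits i)) (rev (enc_nat (clause_agent i)) @ d) e f)"
    and "runs (print_lit_agent x) (mem a b (pairs (bits i)) d e f) (20 * D + 33)
      (mem a b (pairs (bits i)) (rev (enc_nat (lit_agent (i, x))) @ d) e f)"
  unfolding print_pair_agent_def print_clause_agent_def print_lit_agent_def
  by (rule runs_weaken, rule runs_print_prefixed[where n = i and D = D]; use assms in \<open>simp add: enc_nat_agents\<close>)+

definition next_index :: "reg com" where
  "next_index = add_one Flag Aux Cnt"

lemma runs_next_index:
  assumes "length (bits i) \<le> D"
  shows "runs next_index (mem a b (pairs (bits i)) d e f) (20 * D + 20) (mem a b (pairs (bits (Suc i))) d e f)"
  unfolding next_index_def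
  by (rule runs_weaken, rule runs_add_one[where n = i]) (use assms in auto)

text \<open>One copy for each of the two rounds; \<open>[True, b]\<close> is the entry of an encoded
  list of bits.\<close>

definition log_action :: "bool \<Rightarrow> reg com" where
  "log_action b = Seq (pushes Hst1 [True, b]) (pushes Hst2 [True, b])"

lemma runs_log_action:
  "runs (log_action x) (mem a b c d e f) 9 (mem a b c d (x # True # e) (x # True # f))"
  unfolding log_action_def by (rule runs_weaken, rule runs_Seq, rule runs_pushes, rule runs_pushes) auto

text \<open>In the pushed constants, the first \<open>True\<close> announces a list entry and
  \<open>[False, False]\<close> is the code of agent 0.\<close>

definition variable_block :: "reg com" where
  "variable_block = Seq (pushes Edg [True, False, False]) (Seq print_pair_agent
     (Seq (pushes Edg [True]) (Seq print_pair_agent (Seq (print_lit_agent False)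
     (Seq (pushes Edg [True]) (Seq print_pair_agent (Seq (print_lit_agent True)
     (Seq (log_action True) next_index))))))))"

definition enc_edges :: "(nat \<times> nat) list \<Rightarrow> bool list" where
  "enc_edges es = concat (map (\<lambda>x. True # (case x of (v, w) \<Rightarrow> enc_nat v @ enc_nat w)) es)"

lemma enc_edges_simps [simp]:
  "enc_edges [] = []" "enc_edges ((v, w) # es) = True # enc_nat v @ enc_nat w @ enc_edges es"
  "enc_edges (es @ es') = enc_edges es @ enc_edges es'"
  by (auto simp: enc_edges_def)

lemma runs_pushes_mem:
  "runs (pushes Edg bs) (mem a b c d e f) (2 * length bs) (mem a b c (rev bs @ d) e f)"
  "runs (pushes Out bs) (mem a b c d e f) (2 * length bs) (mem a (rev bs @ b) c d e f)"
  by (rule runs_weaken, rule runs_pushes; simp)+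

lemma runs_variable_block:
  assumes "length (bits i) \<le> D"
  shows "runs variable_block (mem a b (pairs (bits i)) d e f) (200 * D + 300)
    (mem a b (pairs (bits (Suc i))) (rev (enc_edges (variable_edges i)) @ d) (True # True # e) (True # True # f))"
  unfolding variable_block_def
  by (rule runs_weaken, (rule runs_Seq runs_pushes_mem runs_log_action runs_print_agent[OF assms] runs_next_index[OF assms])+)
    (simp_all add: variable_edges_def enc_nat_small(1))

text \<open>In the input the sign of a literal follows its variable, but in the code of the literal
  agent it comes first. The variable is therefore set aside, via \<open>Lit\<close> to restore its
  order on \<open>Aux\<close>, until the sign has been read.\<close>

definition literal_block :: "reg com" where
  "literal_block = Seq (pushes Edg [True]) (Seq print_clause_agent
     (Seq (transfer Src (\<lambda>x. pushes Lit [x, True])) (Seq (Branch Src Skip Skip Skip)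
     (Seq (transfer Lit (\<lambda>x. pushes Aux [x, True]))
     (Seq (Branch Src Skip (pushes Edg [True, False, True, True, True, True]) (pushes Edg [True, True, True, True, True, True]))
     (Seq (transfer Aux (\<lambda>x. pushes Edg [True, x])) (pushes Edg [False, False])))))))"

definition enc_lit :: "nat \<times> bool \<Rightarrow> bool list" where
  "enc_lit = (\<lambda>(v, s). enc_nat v @ [s])"

lemma runs_literal_block:
  assumes i: "length (bits i) \<le> D" and v: "length (bits (fst l)) \<le> D"
  shows "runs literal_block (mem (enc_lit l @ a) b (pairs (bits i)) d e f) (60 * D + 100)
    (mem a b (pairs (bits i)) (rev (enc_edges [(clause_agent i, lit_agent l)]) @ d) e f)"
proof -
  obtain v x where l: "l = (v, x)" by fastforce
  let ?V = "bits v"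
  let ?d = "rev (enc_nat (clause_agent i)) @ True # d"
  let ?m = "\<lambda>a d. mem a b (pairs (bits i)) d e f"
  have 1: "runs (transfer Src (\<lambda>x. pushes Lit [x, True])) (?m (enc_lit l @ a) ?d) (length ?V * 7 + 1)
      ((?m (False # x # a) ?d)(Lit := pairs (rev ?V)))"
    by (rule runs_weaken, rule runs_transfer_reverse[where bs = ?V and rest = "False # False # x # a"])
      (simp_all add: l enc_lit_def enc_nat_pairs)
  have 2: "runs (Branch Src Skip Skip Skip) ((?m (False # x # a) ?d)(Lit := pairs (rev ?V))) 1
      ((?m (x # a) ?d)(Lit := pairs (rev ?V)))"
    by (rule runs_weaken, rule runs_pop[where bs = "x # a" and b = False]) (auto simp: fun_eq_iff mem_def)
  have 3: "runs (transfer Lit (\<lambda>x. pushes Aux [x, True])) ((?m (x # a) ?d)(Lit := pairs (rev ?V))) (length (rev ?V) * 7 + 1)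
      ((?m (x # a) ?d)(Aux := pairs ?V))"
    by (rule runs_weaken, rule runs_transfer_reverse[where bs = "rev ?V" and rest = "[]"]) (auto simp: fun_eq_iff mem_def)
  let ?d' = "rev [True, x, True, True, True, True] @ ?d"
  have 4: "runs (Branch Src Skip (pushes Edg [True, False, True, True, True, True]) (pushes Edg [True, True, True, True, True, True]))
      ((?m (x # a) ?d)(Aux := pairs ?V)) (Suc 12) ((?m a ?d')(Aux := pairs ?V))"
    by (rule runs_Branch; (simp del: pushes.simps)?; rule runs_weaken, rule runs_pushes) (auto simp: fun_eq_iff mem_def)
  have 5: "runs (transfer Aux (\<lambda>x. pushes Edg [True, x])) ((?m a ?d')(Aux := pairs ?V)) (length ?V * 7 + 1)
      (?m a (rev (pairs ?V) @ ?d'))"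
    by (rule runs_weaken, rule runs_transfer_pairs[where bs = ?V]) (auto simp: fun_eq_iff mem_def)
  show ?thesis unfolding literal_block_def
    by (rule runs_weaken, (rule runs_Seq runs_pushes_mem runs_print_agent[OF i])+, simp only: rev.simps append.simps, rule 1,
        (rule runs_Seq 2 3 4 5 runs_pushes_mem)+) (use v in \<open>simp_all add: l enc_nat_agents(3), simp_all add: enc_nat_pairs\<close>)
qed

definition clause_block :: "reg com" where
  "clause_block = Seq (pushes Edg [True, False, False]) (Seq print_clause_agent
     (Seq (pushes Edg [True]) (Seq print_clause_agent (Seq (pushes Edg [True, True, False, False])
     (Seq (While Src literal_block) (Seq (log_action False) next_index))))))"

lemma runs_literal_loop:
  assumes i: "length (bits i) \<le> D" and "\<And>l. l \<in> set c \<Longrightarrow> length (bits (fst l)) \<le> D"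
  shows "runs (While Src literal_block) (mem (enc_list enc_lit c @ a) b (pairs (bits i)) d e f) (length c * (60 * D + 102) + 1)
    (mem a b (pairs (bits i)) (rev (enc_edges (map (\<lambda>l. (clause_agent i, lit_agent l)) c)) @ d) e f)"
  using assms(2)
proof (induction c arbitrary: d)
  case Nil
  show ?case by (rule runs_weaken, rule runs_While_stop) (simp_all add: enc_list_def)
next
  case (Cons l c)
  have "runs (While Src literal_block) (mem (enc_list enc_lit (l # c) @ a) b (pairs (bits i)) d e f)
      (60 * D + 100 + (length c * (60 * D + 102) + 1) + 2)
      (mem a b (pairs (bits i)) (rev (enc_edges (map (\<lambda>l. (clause_agent i, lit_agent l)) c)) @
         (rev (enc_edges [(clause_agent i, lit_agent l)]) @ d)) e f)"
  proof (rule runs_While_step)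
    show "mem (enc_list enc_lit (l # c) @ a) b (pairs (bits i)) d e f Src = True # enc_lit l @ (enc_list enc_lit c @ a)"
      by (simp add: enc_list_def)
    show "runs literal_block ((mem (enc_list enc_lit (l # c) @ a) b (pairs (bits i)) d e f)
        (Src := enc_lit l @ enc_list enc_lit c @ a)) (60 * D + 100)
        (mem (enc_list enc_lit c @ a) b (pairs (bits i)) (rev (enc_edges [(clause_agent i, lit_agent l)]) @ d) e f)"
      using runs_literal_block[OF i, of l] Cons.prems by simp
    show "runs (While Src literal_block)
        (mem (enc_list enc_lit c @ a) b (pairs (bits i)) (rev (enc_edges [(clause_agent i, lit_agent l)]) @ d) e f)
        (length c * (60 * D + 102) + 1)
        (mem a b (pairs (bits i)) (rev (enc_edges (map (\<lambda>l. (clause_agent i, lit_agent l)) c)) @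
         (rev (enc_edges [(clause_agent i, lit_agent l)]) @ d)) e f)"
      using Cons by simp
  qed
  then show ?case by (rule runs_weaken) simp_all
qed

lemma runs_clause_block:
  assumes i: "length (bits i) \<le> D" and l: "\<And>l. l \<in> set c \<Longrightarrow> length (bits (fst l)) \<le> D" and "length c \<le> 3"
  shows "runs clause_block (mem (enc_list enc_lit c @ a) b (pairs (bits i)) d e f) (300 * D + 600)
    (mem a b (pairs (bits (Suc i))) (rev (enc_edges (clause_edges i c)) @ d) (False # True # e) (False # True # f))"
proof -
  have "length c * (60 * D + 102) \<le> 3 * (60 * D + 102)" using assms(3) by (rule mult_right_mono) simp
  then show ?thesis unfolding clause_block_def
    by - (rule runs_weaken, (rule runs_Seq runs_pushes_mem runs_log_action runs_print_agent[OF i] runs_next_index[OF i]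
      runs_literal_loop[OF i l] | assumption)+,
      simp_all add: clause_edges_def enc_nat_small)
qed

lemma runs_variable_loop:
  assumes "i + k \<le> D"
  shows "runs (While Src variable_block) (mem (enc_unary k @ a) b (pairs (bits i)) d e f) (k * (200 * D + 302) + 1)
    (mem a b (pairs (bits (i + k))) (rev (enc_edges (concat (map variable_edges [i..<i + k]))) @ d)
      (rev (concat (replicate k [True, True])) @ e) (rev (concat (replicate k [True, True])) @ f))"
  using assms
proof (induction k arbitrary: i d e f)
  case 0
  show ?case by (rule runs_weaken, rule runs_While_stop) (simp_all add: enc_unary_def)
next
  case (Suc k)
  have rep: "concat (replicate k [True, True]) @ [True, True] = True # True # concat (replicate k [True, True])" for k
    by (induction k) auto
  have D: "length (bits i) \<le> D" using length_bits[of i] Suc.prems by simp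
  have "runs (While Src variable_block) (mem (enc_unary (Suc k) @ a) b (pairs (bits i)) d e f)
      (200 * D + 300 + (k * (200 * D + 302) + 1) + 2)
      (mem a b (pairs (bits (Suc i + k))) (rev (enc_edges (concat (map variable_edges [Suc i..<Suc i + k]))) @
        (rev (enc_edges (variable_edges i)) @ d))
      (rev (concat (replicate k [True, True])) @ True # True # e) (rev (concat (replicate k [True, True])) @ True # True # f))"
  proof (rule runs_While_step)
    let ?s = "mem (enc_unary k @ a) b (pairs (bits (Suc i))) (rev (enc_edges (variable_edges i)) @ d) (True # True # e) (True # True # f)"
    show "mem (enc_unary (Suc k) @ a) b (pairs (bits i)) d e f Src = True # enc_unary k @ a"
      by (simp add: enc_unary_def)
    show "runs variable_block ((mem (enc_unary (Suc k) @ a) b (pairs (bits i)) d e f)(Src := enc_unary k @ a)) (200 * D + 300) ?s"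
      using runs_variable_block[OF D] by simp
    show "runs (While Src variable_block) ?s (k * (200 * D + 302) + 1)
      (mem a b (pairs (bits (Suc i + k))) (rev (enc_edges (concat (map variable_edges [Suc i..<Suc i + k]))) @
        (rev (enc_edges (variable_edges i)) @ d))
      (rev (concat (replicate k [True, True])) @ True # True # e) (rev (concat (replicate k [True, True])) @ True # True # f))"
      using Suc.prems by (intro Suc.IH) simp
  qed
  moreover have "[i..<i + Suc k] = i # [Suc i..<Suc i + k]" by (simp add: upt_conv_Cons)
  moreover have "rev (concat (replicate k [True, True])) @ True # True # u = rev (concat (replicate (Suc k) [True, True])) @ u" for u
    using arg_cong[OF rep[of k], of rev] by (induction k) auto
  ultimately show ?case by (elim runs_weaken) simp_all
qed

lemma runs_clause_loop:
  assumes "i + length cs \<le> D"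
    and "\<And>c. c \<in> set cs \<Longrightarrow> length c \<le> 3 \<and> (\<forall>l \<in> set c. length (bits (fst l)) \<le> D)"
  shows "runs (While Src clause_block) (mem (enc_list (enc_list enc_lit) cs @ a) b (pairs (bits i)) d e f) (length cs * (300 * D + 602) + 1)
    (mem a b (pairs (bits (i + length cs)))
      (rev (enc_edges (concat (map (\<lambda>j. clause_edges (i + j) (cs ! j)) [0..<length cs]))) @ d)
      (rev (concat (replicate (length cs) [True, False])) @ e) (rev (concat (replicate (length cs) [True, False])) @ f))"
  using assms
proof (induction cs arbitrary: i d e f)
  case Nil
  show ?case by (rule runs_weaken, rule runs_While_stop) (simp_all add: enc_list_def)
next
  case (Cons c cs)
  have D: "length (bits i) \<le> D" using length_bits[of i] Cons.prems by simp
  have l: "\<And>l. l \<in> set c \<Longrightarrow> length (bits (fst l)) \<le> D" and c3: "length c \<le> 3" using Cons.prems by auto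
  have "runs (While Src clause_block) (mem (enc_list (enc_list enc_lit) (c # cs) @ a) b (pairs (bits i)) d e f)
      (300 * D + 600 + (length cs * (300 * D + 602) + 1) + 2)
      (mem a b (pairs (bits (Suc i + length cs)))
      (rev (enc_edges (concat (map (\<lambda>j. clause_edges (Suc i + j) (cs ! j)) [0..<length cs]))) @
        (rev (enc_edges (clause_edges i c)) @ d))
      (rev (concat (replicate (length cs) [True, False])) @ False # True # e)
      (rev (concat (replicate (length cs) [True, False])) @ False # True # f))"
  proof (rule runs_While_step)
    let ?s = "mem (enc_list (enc_list enc_lit) cs @ a) b (pairs (bits (Suc i))) (rev (enc_edges (clause_edges i c)) @ d) (False # True # e) (False # True # f)"
    show "mem (enc_list (enc_list enc_lit) (c # cs) @ a) b (pairs (bits i)) d e f Src = True # enc_list enc_lit c @ enc_list (enc_list enc_lit) cs @ a"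
      by (simp add: enc_list_def)
    show "runs clause_block ((mem (enc_list (enc_list enc_lit) (c # cs) @ a) b (pairs (bits i)) d e f)
        (Src := enc_list enc_lit c @ enc_list (enc_list enc_lit) cs @ a)) (300 * D + 600) ?s"
      using runs_clause_block[OF D l c3] by simp
    show "runs (While Src clause_block) ?s (length cs * (300 * D + 602) + 1)
      (mem a b (pairs (bits (Suc i + length cs)))
      (rev (enc_edges (concat (map (\<lambda>j. clause_edges (Suc i + j) (cs ! j)) [0..<length cs]))) @
        (rev (enc_edges (clause_edges i c)) @ d))
      (rev (concat (replicate (length cs) [True, False])) @ False # True # e)
      (rev (concat (replicate (length cs) [True, False])) @ False # True # f))"
      using Cons.prems by (intro Cons.IH) auto
  qed
  moreover have "[0..<length (c # cs)] = 0 # map Suc [0..<length cs]"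
    by (simp add: upt_conv_Cons map_Suc_upt del: upt_Suc)
  ultimately show ?case by (elim runs_weaken) (simp_all add: comp_def del: upt_Suc)
qed

text \<open>Edges and both histories are produced in one pass over the formula but appear one after
  the other in the output, after the number of agents, which is known only at the end. They are
  collected separately and appended here; the two moves cancel each other's reversal.\<close>

definition flush :: "reg \<Rightarrow> reg com" where
  "flush r = Seq (move Flag r Aux) (move Flag Aux Out)"

lemma runs_flush:
  assumes "s Flag = []" "s Aux = []" "distinct [Flag, Aux, Out, r]" "length (s r) \<le> L"
  shows "runs (flush r) s (12 * L + 15) (s(r := [], Out := s r @ s Out))"
proof -
  let ?s = "s(r := [], Aux := rev (s r) @ s Aux)"
  have 1: "runs (move Flag r Aux) s (6 * length (s r) + 7) ?s" using assms by (intro runs_move) auto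
  have 2: "runs (move Flag Aux Out) ?s (6 * length (?s Aux) + 7) (?s(Aux := [], Out := rev (?s Aux) @ ?s Out))"
    using assms by (intro runs_move) auto
  show ?thesis unfolding flush_def
    by (rule runs_weaken[OF runs_Seq[OF 1 2]]) (use assms in \<open>auto simp: fun_eq_iff\<close>)
qed

lemma runs_flush_mem:
  "length d \<le> L \<Longrightarrow> runs (flush Edg) (mem a b c d e f) (12 * L + 15) (mem a (d @ b) c [] e f)"
  "length e \<le> L \<Longrightarrow> runs (flush Hst1) (mem a b c d e f) (12 * L + 15) (mem a (e @ b) c d [] f)"
  "length f \<le> L \<Longrightarrow> runs (flush Hst2) (mem a b c d e f) (12 * L + 15) (mem a (f @ b) c d e [])"
  by (rule runs_weaken, rule runs_flush[where L = L]; simp)+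

definition print_edges :: "reg com" where
  "print_edges = Seq (move Flag Inp Src) (Seq (While Src variable_block) (Seq (While Src clause_block) (pushes Edg [False])))"

definition assemble :: "reg com" where
  "assemble = Seq (print_prefixed Out [True, False, True, False, True, True]) (Seq (flush Edg)
     (Seq (pushes Out [True, False, True, True, False, False, False, False])
     (Seq (flush Hst1) (Seq (flush Hst2) (pushes Out [False])))))"

lemma length_enc_list: "length xs \<le> length (enc_list f xs)"
  by (induction xs) (auto simp: enc_list_def)

lemma length_enc_list_mem: "x \<in> set xs \<Longrightarrow> length (f x) \<le> length (enc_list f xs)"
  by (induction xs) (auto simp: enc_list_def)

lemma enc_cnf_eq: "enc_cnf \<phi> = enc_unary (fst \<phi>) @ enc_list (enc_list enc_lit) (snd \<phi>)"
  by (simp add: enc_cnf_def enc_lit_def)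

lemma length_enc_cnf:
  "fst \<phi> + length (snd \<phi>) \<le> length (enc_cnf \<phi>)"
  "c \<in> set (snd \<phi>) \<Longrightarrow> l \<in> set c \<Longrightarrow> length (bits (fst l)) \<le> length (enc_cnf \<phi>)"
proof -
  show "fst \<phi> + length (snd \<phi>) \<le> length (enc_cnf \<phi>)"
    using length_enc_list[of "snd \<phi>" "enc_list enc_lit"] by (simp add: enc_cnf_eq enc_unary_def)
  assume c: "c \<in> set (snd \<phi>)" and l: "l \<in> set c"
  have "length (bits (fst l)) \<le> length (enc_lit l)"
    by (cases l) (simp add: enc_lit_def enc_nat_pairs)
  also have "\<dots> \<le> length (enc_list enc_lit c)" using l by (rule length_enc_list_mem)
  also have "\<dots> \<le> length (enc_list (enc_list enc_lit) (snd \<phi>))" using c by (rule length_enc_list_mem)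
  finally show "length (bits (fst l)) \<le> length (enc_cnf \<phi>)" by (simp add: enc_cnf_eq)
qed

lemma runs_print_edges:
  fixes \<phi> :: cnf
  defines "N \<equiv> num_vars \<phi>" and "M \<equiv> num_clauses \<phi>"
    and "h \<equiv> concat (replicate (num_vars \<phi>) [True, True]) @ concat (replicate (num_clauses \<phi>) [True, False])"
  assumes "is_3cnf \<phi>"
  shows "runs print_edges ((\<lambda>_. [])(Inp := rev (enc_cnf \<phi>))) (1000 * (length (enc_cnf \<phi>) + 1) ^ 2)
     (mem [] [] (pairs (bits (N + M))) (rev (enc_edges (network_edges \<phi>) @ [False])) (rev h) (rev h))"
proof -
  let ?D = "length (enc_cnf \<phi>)"
  have D: "N + M \<le> ?D" using length_enc_cnf(1)[of \<phi>] by (simp add: N_def M_def num_vars_def num_clauses_def)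
  have 1: "runs (move Flag Inp Src) ((\<lambda>_. [])(Inp := rev (enc_cnf \<phi>))) (6 * ?D + 7)
     (mem (enc_unary N @ enc_list (enc_list enc_lit) (snd \<phi>) @ []) [] (pairs (bits 0)) [] [] [])"
    by (rule runs_weaken, rule runs_move) (auto simp: mem_def fun_eq_iff enc_cnf_eq N_def num_vars_def)
  have 2: "runs (While Src variable_block) (mem (enc_unary N @ a) b (pairs (bits 0)) d e f) (N * (200 * ?D + 302) + 1)
    (mem a b (pairs (bits (0 + N))) (rev (enc_edges (concat (map variable_edges [0..<0 + N]))) @ d)
      (rev (concat (replicate N [True, True])) @ e) (rev (concat (replicate N [True, True])) @ f))" for a b d e f
    using D by (intro runs_variable_loop) simp
  have 3: "runs (While Src clause_block) (mem (enc_list (enc_list enc_lit) (snd \<phi>) @ a) b (pairs (bits (0 + N))) d e f)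
    (M * (300 * ?D + 602) + 1)
    (mem a b (pairs (bits (0 + N + M)))
      (rev (enc_edges (concat (map (\<lambda>j. clause_edges (N + j) (snd \<phi> ! j)) [0..<M]))) @ d)
      (rev (concat (replicate M [True, False])) @ e) (rev (concat (replicate M [True, False])) @ f))" for a b d e f
    by (rule runs_weaken, rule runs_clause_loop[where D = ?D])
      (use D assms(4) length_enc_cnf(2)[of _ \<phi>] in \<open>auto simp: M_def num_clauses_def is_3cnf_def\<close>)
  have cost: "6 * D + 7 + (N * (200 * D + 302) + 1 + (M * (300 * D + 602) + 1 + 2 * length [False] + 1) + 1) + 1 \<le> 1000 * (D + 1) ^ 2"
    if "N + M \<le> D" for D
  proof -
    have "N * (200 * D + 302) + M * (300 * D + 602) \<le> N * (602 * (D + 1)) + M * (602 * (D + 1))"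
      by (intro add_mono mult_left_mono) auto
    also have "\<dots> = (N + M) * (602 * (D + 1))" by (simp only: distrib_right)
    also have "\<dots> \<le> D * (602 * (D + 1))" using that by (rule mult_right_mono) simp
    finally show ?thesis by (simp add: power2_eq_square algebra_simps)
  qed
  show ?thesis unfolding print_edges_def
    by (rule runs_weaken[OF runs_Seq[OF 1 runs_Seq[OF 2 runs_Seq[OF 3 runs_pushes_mem(1)]]]])
      (use cost[OF D] in \<open>simp_all add: network_edges_def h_def N_def M_def num_vars_def num_clauses_def\<close>)
qed

lemma runs_printer:
  assumes "is_3cnf \<phi>"
  shows "\<exists>s'. s' Out = rev (enc_bay_discrete (reduction \<phi>)) \<and>
    runs (Seq print_edges assemble) ((\<lambda>_. [])(Inp := rev (enc_cnf \<phi>))) (50000 * (length (enc_cnf \<phi>) + 1) ^ 2) s'"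
proof -
  let ?D = "length (enc_cnf \<phi>)" and ?N = "num_vars \<phi>" and ?M = "num_clauses \<phi>"
  let ?h = "concat (replicate ?N [True, True]) @ concat (replicate ?M [True, False])"
  let ?e = "enc_edges (network_edges \<phi>) @ [False]"
  let ?L = "?D + 1000 * (?D + 1) ^ 2"
  have D: "?N + ?M \<le> ?D" using length_enc_cnf(1)[of \<phi>] by (simp add: num_vars_def num_clauses_def)
  have b: "length (bits (?N + ?M)) \<le> ?D" using length_bits[of "?N + ?M"] D by simp
  note 1 = runs_print_edges[OF assms]
  \<comment> \<open>A stack is never higher than its initial height plus the number of steps, so the
    running time already bounds the length of what is to be moved.\<close>
  have len: "length (mem [] [] (pairs (bits (?N + ?M))) (rev ?e) (rev ?h) (rev ?h) r) \<le> ?L" for r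
    by (rule length_runs[OF 1]) auto
  have L: "length (rev ?e) \<le> ?L" "length (rev ?h) \<le> ?L"
    using len[of Edg] len[of Hst1] by simp_all
  have 2: "runs (print_prefixed Out [True, False, True, False, True, True])
      (mem [] [] (pairs (bits (?N + ?M))) (rev ?e) (rev ?h) (rev ?h)) (20 * ?D + 33)
      (mem [] (rev (enc_nat (pair_agent (?N + ?M)))) (pairs (bits (?N + ?M))) (rev ?e) (rev ?h) (rev ?h))"
    by (rule runs_weaken, rule runs_print_prefixed[where n = "?N + ?M" and D = ?D]) (use b in \<open>simp_all add: enc_nat_agents\<close>)
  note 3 = runs_flush_mem(1)[OF L(1)] runs_flush_mem(2)[OF L(2)] runs_flush_mem(3)[OF L(2)]
  note all = runs_Seq[OF 1 runs_Seq[OF 2 runs_Seq[OF 3(1) runs_Seq[OF runs_pushes_mem(2) runs_Seq[OF 3(2) runs_Seq[OF 3(3) runs_pushes_mem(2)]]]]]]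
  have cost: "1000 * (D + 1) ^ 2 + (20 * D + 33 + (12 * (D + 1000 * (D + 1) ^ 2) + 15 + (2 * 8 +
     (12 * (D + 1000 * (D + 1) ^ 2) + 15 + (12 * (D + 1000 * (D + 1) ^ 2) + 15 + 2 * 1 + 1) + 1) + 1) + 1) + 1) + 1 \<le> 50000 * (D + 1) ^ 2" for D :: nat
    by (simp add: power2_eq_square algebra_simps)
  let ?t = "mem [] (rev (enc_bay_discrete (reduction \<phi>))) (pairs (bits (?N + ?M))) [] [] []"
  have "runs (Seq print_edges assemble) ((\<lambda>_. [])(Inp := rev (enc_cnf \<phi>))) (50000 * (?D + 1) ^ 2) ?t"
    unfolding assemble_def
  proof (rule runs_weaken[OF all])
    show "1000 * (?D + 1) ^ 2 + (20 * ?D + 33 + (12 * ?L + 15 + (2 * length [True, False, True, True, False, False, False, False] +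
     (12 * ?L + 15 + (12 * ?L + 15 + 2 * length [False] + 1) + 1) + 1) + 1) + 1) + 1 \<le> 50000 * (?D + 1) ^ 2"
      using cost[of ?D] by simp
  qed (simp add: enc_reduction enc_nat_agents Let_def enc_edges_def enc_list_def case_prod_unfold)
  then show ?thesis by (intro exI[of _ ?t]) simp
qed

text \<open>Quadratic time of the program and quadratic overhead of the simulation give degree
  4.\<close>

lemma tm_of_quadratic_program:
  fixes prog :: "'r::finite com"
  shows "\<exists>M. tm_wf M \<and> (\<forall>x s'. runs prog ((\<lambda>_. [])(inp := rev x)) (C * (length x + 1) ^ 2) s' \<longrightarrow>
     tm_computes_in M x (rev (s' out)) (20 * (C + 1) ^ 2 * (length x + 1) ^ 4))"
proof -
  obtain M where M: "tm_wf M" "\<And>x n s'. runs prog ((\<lambda>_. [])(inp := rev x)) n s' \<Longrightarrow>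
     tm_computes_in M x (rev (s' out)) (20 * (length x + n + 1) ^ 2)"
    using tm_of_program[of prog inp out] by blast
  have "20 * (length x + C * (length x + 1) ^ 2 + 1) ^ 2 \<le> 20 * (C + 1) ^ 2 * (length x + 1) ^ 4" for x :: "bool list"
  proof -
    let ?n = "length x + 1"
    have "?n \<le> ?n ^ 2" by (simp add: power2_eq_square)
    then have "length x + C * ?n ^ 2 + 1 \<le> (C + 1) * ?n ^ 2" by simp
    then have "(length x + C * ?n ^ 2 + 1) ^ 2 \<le> ((C + 1) * ?n ^ 2) ^ 2" by (rule power_mono) simp
    moreover have "(a * m ^ 2) ^ 2 = a ^ 2 * m ^ 4" for a m :: nat
      by (simp add: power_mult_distrib flip: power_mult)
    ultimately show ?thesis by (simp only: mult.assoc mult_le_mono2)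
  qed
  then have "tm_computes_in M x (rev (s' out)) (20 * (C + 1) ^ 2 * (length x + 1) ^ 4)"
    if "runs prog ((\<lambda>_. [])(inp := rev x)) (C * (length x + 1) ^ 2) s'" for x s'
    using M(2)[OF that] unfolding tm_computes_in_def by (meson order_trans)
  with M(1) show ?thesis by blast
qed

lemma poly_time_reduction: "poly_time_on is_3cnf enc_cnf (\<lambda>\<phi>. enc_bay_discrete (reduction \<phi>))"
proof -
  obtain M where M: "tm_wf M" "\<And>x s'. runs (Seq print_edges assemble) ((\<lambda>_. [])(Inp := rev x)) (50000 * (length x + 1) ^ 2) s' \<Longrightarrow>
     tm_computes_in M x (rev (s' Out)) (20 * (50000 + 1) ^ 2 * (length x + 1) ^ 4)"
    using tm_of_quadratic_program by blast
  have "tm_computes_in M (enc_cnf \<phi>) (enc_bay_discrete (reduction \<phi>)) (20 * (50000 + 1) ^ 2 * (length (enc_cnf \<phi>) + 1) ^ 4)"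
    if \<phi>: "is_3cnf \<phi>" for \<phi>
    using runs_printer[OF \<phi>] M(2) by (metis rev_rev_ident)
  with M(1) show ?thesis unfolding poly_time_on_def by blast
qed

section \<open>A program printing the signal probabilities\<close>

text \<open>All signal probabilities are rational with short codes, so a single exact fraction
  serves as an approximation to every precision.\<close>

definition signal_fraction :: "nat \<Rightarrow> bool \<Rightarrow> nat \<Rightarrow> int \<times> nat" where
  "signal_fraction N \<theta> v =
     (if v = 0 then (1, 2)
      else if v = 1 then (2 ^ ((if \<theta> then 10 else 3) * (N + 1)) - 1, 2 ^ ((if \<theta> then 10 else 3) * (N + 1)))
      else if v mod 4 = 0 then (if \<theta> then 8 else 1, 9)
      else if v mod 4 = 1 then (1, 2)
      else (if \<theta> then 14 else 7, 15))"

definition enc_fraction :: "int \<times> nat \<Rightarrow> bool list" where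
  "enc_fraction x = enc_int (fst x) @ enc_nat (snd x)"

lemma sig_prob_fraction:
  "sig_prob (network \<phi>) \<theta> v = of_int (fst (signal_fraction (num_vars \<phi>) \<theta> v)) / of_nat (snd (signal_fraction (num_vars \<phi>) \<theta> v))"
proof -
  have "1 - (1 / 2) ^ k = (2 ^ k - 1) / (2 :: real) ^ k" for k
    by (simp add: field_simps power_divide)
  then show ?thesis by (simp add: sig_prob_def network_def signal_fraction_def)
qed

lemma snd_signal_fraction: "0 < snd (signal_fraction N \<theta> v)"
  by (simp add: signal_fraction_def)

lemma bits_power: "bits (2 ^ k) = replicate k False @ [True]"
proof (induction k)
  case 0
  show ?case by (simp add: bits.simps)
next
  case (Suc k)
  then show ?case using bits_double[of "2 ^ k" False] by simp
qed

text \<open>Together with \<open>bits_power\<close>: numerator and denominator of the switch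
  probability are runs of equal bits, which can be printed without any arithmetic.\<close>

lemma bits_power_minus: "bits (2 ^ k - Suc 0) = replicate k True"
proof (induction k)
  case (Suc k)
  obtain m where "(2 :: nat) ^ k = Suc m" using not0_implies_Suc[of "2 ^ k"] by auto
  then show ?case using bits_double[of m True] Suc by simp
qed simp

definition drop_bit :: "reg com" where
  "drop_bit = Branch Src Skip Skip Skip"

definition drop_num :: "reg com" where
  "drop_num = Seq (While Src drop_bit) drop_bit"

lemma runs_drop_bit: "runs drop_bit (mem (x # a) b c d e f) 1 (mem a b c d e f)"
  unfolding drop_bit_def by (rule runs_weaken, rule runs_pop[where b = x and bs = a]) simp_all

lemma runs_drop_num: "runs drop_num (mem (pairs bs @ False # x # a) b c d e f) (3 * length bs + 3) (mem a b c d e f)"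
proof -
  have loop: "runs (While Src drop_bit) (mem (pairs bs @ False # x # a) b c d e f) (3 * length bs + 1) (mem (x # a) b c d e f)"
  proof (induction bs)
    case Nil
    show ?case by (rule runs_weaken, rule runs_While_stop) simp_all
  next
    case (Cons y bs)
    show ?case
      by (rule runs_weaken, rule runs_While_step[OF _ _ Cons, where n = 1 and bs = "y # pairs bs @ False # x # a"])
        (use runs_drop_bit[of y] in simp_all)
  qed
  show ?thesis unfolding drop_num_def
    by (rule runs_weaken, rule runs_Seq[OF loop runs_drop_bit]) simp_all
qed

definition drop_clauses :: "reg com" where
  "drop_clauses = While Src (While Src (Seq drop_num drop_bit))"

lemma runs_drop_clause:
  "runs (While Src (Seq drop_num drop_bit)) (mem (enc_list enc_lit cl @ a) b c d e f) (6 * length (enc_list enc_lit cl) + 1) (mem a b c d e f)"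
proof (induction cl)
  case Nil
  show ?case by (rule runs_weaken, rule runs_While_stop) (simp_all add: enc_list_def)
next
  case (Cons l cl)
  obtain v x where l: "l = (v, x)" by fastforce
  have 1: "runs (Seq drop_num drop_bit) (mem (pairs (bits v) @ False # False # x # enc_list enc_lit cl @ a) b c d e f)
      (3 * length (bits v) + 3 + 1 + 1) (mem (enc_list enc_lit cl @ a) b c d e f)"
    by (rule runs_Seq, rule runs_drop_num, rule runs_drop_bit)
  show ?case
    by (rule runs_weaken, rule runs_While_step[OF _ _ Cons, where n = "3 * length (bits v) + 3 + 1 + 1" and bs = "pairs (bits v) @ False # False # x # enc_list enc_lit cl @ a"])
      (use 1 in \<open>simp_all add: enc_list_def l enc_lit_def enc_nat_pairs\<close>)
qed

lemma runs_drop_clauses: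
  "runs drop_clauses (mem (enc_list (enc_list enc_lit) cls @ a) b c d e f) (6 * length (enc_list (enc_list enc_lit) cls) + 1) (mem a b c d e f)"
proof (induction cls)
  case Nil
  show ?case unfolding drop_clauses_def by (rule runs_weaken, rule runs_While_stop) (simp_all add: enc_list_def)
next
  case (Cons cl cls)
  show ?case unfolding drop_clauses_def
    by (rule runs_weaken, rule runs_While_step[OF _ _ Cons[unfolded drop_clauses_def],
          where n = "6 * length (enc_list enc_lit cl) + 1" and bs = "enc_list enc_lit cl @ enc_list (enc_list enc_lit) cls @ a"])
      (use runs_drop_clause[of cl "enc_list (enc_list enc_lit) cls @ a" b c d e f] in \<open>simp_all add: enc_list_def\<close>)
qed

definition read_state :: "(bool \<Rightarrow> reg com) \<Rightarrow> reg com" where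
  "read_state c = Branch Src Skip (c False) (c True)"

lemma runs_read_state:
  "runs (c \<theta>) (mem a b c' d e f) n s' \<Longrightarrow> runs (read_state c) (mem (\<theta> # a) b c' d e f) (Suc n) s'"
  unfolding read_state_def by (rule runs_Branch) auto

definition print_fraction :: "int \<times> nat \<Rightarrow> reg com" where
  "print_fraction x = pushes Out (enc_fraction x)"

text \<open>The exponent k(N + 1) is realised as k bits printed once and then N more times.
  \<open>Hst1\<close> and \<open>Hst2\<close> hold N in unary, one copy for the numerator and one
  for the denominator.\<close>

definition print_switch :: "nat \<Rightarrow> reg com" where
  "print_switch k = Seq (pushes Out (True # pairs (replicate k True)))
     (Seq (While Hst1 (pushes Out (pairs (replicate k True))))
     (Seq (pushes Out ([False, False] @ pairs (replicate k False)))
     (Seq (While Hst2 (pushes Out (pairs (replicate k False)))) (pushes Out [True, True, False, False]))))"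

text \<open>A decision tree on the code of the agent, lowest bit first: an immediate end means agent
  0, an end after one bit agent 1, and otherwise the two lowest bits give the residue modulo
  4.\<close>

definition print_signal :: "reg com" where
  "print_signal = Branch Src Skip
     (print_fraction (1, 2))
     (Branch Src Skip
        (Seq drop_bit (Branch Src Skip
           (Seq drop_num (read_state (\<lambda>\<theta>. print_fraction (if \<theta> then 8 else 1, 9))))
           (Seq drop_num (read_state (\<lambda>\<theta>. print_fraction (if \<theta> then 14 else 7, 15))))))
        (Branch Src Skip
           (Seq drop_bit (read_state (\<lambda>\<theta>. print_switch (if \<theta> then 10 else 3))))
           (Branch Src Skip
              (print_fraction (1, 2))
              (Seq drop_num (read_state (\<lambda>\<theta>. print_fraction (if \<theta> then 14 else 7, 15)))))))"

lemma runs_repeat: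
  assumes "r \<in> {Hst1, Hst2}" "s r = replicate N True"
  shows "runs (While r (pushes Out bs)) s (N * (2 * length bs + 2) + 1)
    (s(r := [], Out := rev (concat (replicate N bs)) @ s Out))"
  using assms(2)
proof (induction N arbitrary: s)
  case 0
  show ?case by (rule runs_weaken, rule runs_While_stop) (use 0 assms(1) in \<open>auto simp: fun_eq_iff\<close>)
next
  case (Suc N)
  let ?s = "s(r := replicate N True, Out := rev bs @ s Out)"
  have r: "r \<noteq> Out" using assms(1) by auto
  have 1: "runs (pushes Out bs) (s(r := replicate N True)) (2 * length bs) ?s"
    by (rule runs_weaken, rule runs_pushes) (use r in auto)
  have 2: "runs (While r (pushes Out bs)) ?s (N * (2 * length bs + 2) + 1)
    (?s(r := [], Out := rev (concat (replicate N bs)) @ ?s Out))"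
    using r by (intro Suc.IH) simp
  have c: "concat (replicate N bs) @ bs = bs @ concat (replicate N bs)" by (induction N) auto
  have "runs (While r (pushes Out bs)) s (2 * length bs + (N * (2 * length bs + 2) + 1) + 2)
    (?s(r := [], Out := rev (concat (replicate N bs)) @ ?s Out))"
    using Suc.prems by (intro runs_While_step[OF _ 1 2]) simp
  moreover have "rev (concat (replicate N bs)) @ rev bs @ u = rev (concat (replicate (Suc N) bs)) @ u" for u
    using arg_cong[OF c, of rev] by simp
  ultimately show ?case using r by (elim runs_weaken) (auto simp: fun_eq_iff)
qed

lemma pairs_repeat: "pairs (replicate k b) @ concat (replicate N (pairs (replicate k b))) = pairs (replicate (k * (N + 1)) b)"
proof -
  have "pairs (replicate (m * k) b) = concat (replicate m (pairs (replicate k b)))" for m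
    by (induction m) (simp_all add: replicate_add)
  from this[of "N + 1"] show ?thesis by (simp add: mult.commute)
qed

lemma runs_print_switch:
  assumes "k \<le> 10"
  shows "runs (print_switch k) (mem a [] [] [] (replicate N True) (replicate N True)) (100 * (N + 2))
    (mem a (rev (enc_fraction (2 ^ (k * (N + 1)) - 1, 2 ^ (k * (N + 1))))) [] [] [] [])"
proof -
  have rep: "runs (While Hst1 (pushes Out bs)) (mem a b c d (replicate N True) f) (N * (2 * length bs + 2) + 1)
      (mem a (rev (concat (replicate N bs)) @ b) c d [] f)"
    "runs (While Hst2 (pushes Out bs)) (mem a b c d e (replicate N True)) (N * (2 * length bs + 2) + 1)
      (mem a (rev (concat (replicate N bs)) @ b) c d e [])" for a b c d e f bs
    by (rule runs_weaken, rule runs_repeat[where N = N]; simp)+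
  let ?K = "k * (N + 1)"
  have pw: "nat (2 ^ ?K - 1) = 2 ^ ?K - 1"
    by (simp add: nat_diff_distrib nat_power_eq)
  have code: "enc_fraction (2 ^ ?K - 1, 2 ^ ?K) =
      True # pairs (replicate k True) @ concat (replicate N (pairs (replicate k True))) @
      [False, False] @ pairs (replicate k False) @ concat (replicate N (pairs (replicate k False))) @ [True, True, False, False]"
  proof -
    have "enc_fraction (2 ^ ?K - 1, 2 ^ ?K) =
        True # (pairs (replicate ?K True)) @ [False, False] @ pairs (replicate ?K False) @ [True, True, False, False]"
      using pw by (simp add: enc_fraction_def enc_int_def enc_nat_pairs bits_power bits_power_minus del: mult_Suc_right)
    then show ?thesis by (simp only: pairs_repeat[symmetric] append.assoc append_Cons append_Nil)
  qed
  have "N * k \<le> N * 10" using assms by (rule mult_le_mono2)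
  then have "8 * k + 8 * (N * k) \<le> 96 * N + 180" using assms by linarith
  then show ?thesis unfolding print_switch_def code
    by - (rule runs_weaken, (rule runs_Seq runs_pushes_mem rep)+, use assms in simp_all)
qed

lemma runs_print_fraction:
  "runs (print_fraction x) (mem a [] c d e f) (2 * length (enc_fraction x)) (mem a (rev (enc_fraction x)) c d e f)"
  unfolding print_fraction_def by (rule runs_weaken, rule runs_pushes_mem) simp_all

lemma length_enc_fraction:
  "length (enc_fraction x) \<le> 2 * nat \<bar>fst x\<bar> + 2 * snd x + 5"
  using length_bits[of "nat \<bar>fst x\<bar>"] length_bits[of "snd x"]
  by (simp add: enc_fraction_def enc_int_def enc_nat_pairs)

lemma runs_print_signal:
  "\<exists>s'. s' Out = rev (enc_fraction (signal_fraction N \<theta> v)) \<and>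
     runs print_signal (mem (enc_nat v @ \<theta> # a) [] [] [] (replicate N True) (replicate N True))
       (100 * (length (bits v) + N + 5)) s'"
proof -
  let ?m = "\<lambda>a. mem a [] [] [] (replicate N True) (replicate N True)"
  let ?B = "100 * (length (bits v) + N + 5)"
  have frac: "runs (print_fraction (p, q)) (?m a) 130 (mem a (rev (enc_fraction (p, q))) [] [] (replicate N True) (replicate N True))"
    if "0 \<le> p" "p \<le> 14" "q \<le> 15" for a p q
    by (rule runs_weaken[OF runs_print_fraction])
      (use that length_enc_fraction[of "(p, q)"] nat_mono[OF that(2)] in simp_all)
  have state: "runs (Seq drop_num (read_state (\<lambda>\<theta>. print_fraction (p \<theta>, q)))) (?m (pairs bs @ False # False # \<theta> # a)) (3 * length bs + 140)
      (mem a (rev (enc_fraction (p \<theta>, q))) [] [] (replicate N True) (replicate N True))"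
    if "\<And>\<theta>. 0 \<le> p \<theta> \<and> p \<theta> \<le> 14" "q \<le> 15" for bs p q
    by (rule runs_weaken[OF runs_Seq[OF runs_drop_num runs_read_state[OF frac]]]) (use that in auto)
  consider "v = 0" | "v = 1" | "2 \<le> v" by linarith
  then show ?thesis
  proof cases
    case 1
    let ?s = "mem (False # \<theta> # a) (rev (enc_fraction (1, 2))) [] [] (replicate N True) (replicate N True)"
    have "runs print_signal (?m (enc_nat v @ \<theta> # a)) (Suc 130) ?s"
      unfolding print_signal_def using frac[of 1 2 "False # \<theta> # a"]
      by (intro runs_Branch) (use 1 in \<open>auto simp: enc_nat_small\<close>)
    then have "runs print_signal (?m (enc_nat v @ \<theta> # a)) ?B ?s" by (rule runs_mono) simp
    then show ?thesis using 1 by (intro exI[of _ ?s]) (simp add: signal_fraction_def)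
  next
    case 2
    let ?k = "if \<theta> then 10 else 3 :: nat"
    let ?s = "mem a (rev (enc_fraction (2 ^ (?k * (N + 1)) - 1, 2 ^ (?k * (N + 1))))) [] [] [] []"
    have "runs (Seq drop_bit (read_state (\<lambda>\<theta>. print_switch (if \<theta> then 10 else 3)))) (?m (False # \<theta> # a)) (1 + Suc (100 * (N + 2)) + 1) ?s"
      by (intro runs_Seq[OF runs_drop_bit] runs_read_state runs_print_switch) simp
    then have "runs print_signal (?m (enc_nat v @ \<theta> # a)) (Suc (Suc (Suc (1 + Suc (100 * (N + 2)) + 1)))) ?s"
      unfolding print_signal_def
      by (intro runs_Branch) (use 2 in \<open>auto simp: enc_nat_small\<close>)
    then have "runs print_signal (?m (enc_nat v @ \<theta> # a)) ?B ?s" by (rule runs_mono) simp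
    then show ?thesis using 2 by (intro exI[of _ ?s]) (simp add: signal_fraction_def)
  next
    case 3
    define q x t where "q = v div 4" and "x = odd v" and "t = odd (v div 2)"
    have v: "v = 2 * (2 * q + of_bool t) + of_bool x"
      unfolding q_def x_def t_def by (auto simp: of_bool_def) presburger+
    then have pos: "0 < q \<or> t" "0 < 2 * q + of_bool t \<or> x" using 3 by (auto split: if_splits simp: of_bool_def)
    have "bits v = x # bits (2 * q + of_bool t)"
      unfolding v using pos(2) by (rule bits_double)
    then have bv: "bits v = x # t # bits q"
      using bits_double[OF pos(1)] by simp
    have md: "v mod 4 = 2 * of_bool t + of_bool x"
      unfolding v by (auto simp: of_bool_def)
    let ?src = "True # x # True # t # pairs (bits q) @ False # False # \<theta> # a"
    let ?out = "\<lambda>c a. mem a (rev (enc_fraction c)) [] [] (replicate N True) (replicate N True)"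
    have src: "enc_nat v @ \<theta> # a = ?src" by (simp add: enc_nat_pairs bv)
    consider "\<not> x \<and> \<not> t" | "x \<and> \<not> t" | "t" by blast
    then show ?thesis
    proof cases
      case 1
      let ?c = "(if \<theta> then 8 else 1, 9)"
      have "runs (Seq drop_bit (Branch Src Skip
           (Seq drop_num (read_state (\<lambda>\<theta>. print_fraction (if \<theta> then 8 else 1, 9))))
           (Seq drop_num (read_state (\<lambda>\<theta>. print_fraction (if \<theta> then 14 else 7, 15))))))
         (?m (True # t # pairs (bits q) @ False # False # \<theta> # a)) (1 + Suc (3 * length (bits q) + 140) + 1) (?out ?c a)"
        using 1 state[of "\<lambda>\<theta>. if \<theta> then 8 else 1" 9 "bits q"]
        by (intro runs_Seq[OF runs_drop_bit] runs_Branch) auto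
      then have "runs print_signal (?m ?src) (Suc (Suc (1 + Suc (3 * length (bits q) + 140) + 1))) (?out ?c a)"
        unfolding print_signal_def by (intro runs_Branch) (use 1 in auto)
      then have "runs print_signal (?m ?src) ?B (?out ?c a)" by (rule runs_mono) (simp add: bv)
      then show ?thesis using 1 3 md src
        by (intro exI[of _ "?out ?c a"]) (simp add: signal_fraction_def)
    next
      case 2
      let ?c = "(1, 2)" and ?a = "pairs (bits q) @ False # False # \<theta> # a"
      have "runs print_signal (?m ?src) (Suc (Suc (Suc (Suc 130)))) (?out ?c ?a)"
        unfolding print_signal_def using frac[of 1 2 ?a]
        by (intro runs_Branch) (use 2 in auto)
      then have "runs print_signal (?m ?src) ?B (?out ?c ?a)" by (rule runs_mono) simp
      then show ?thesis using 2 3 md src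
        by (intro exI[of _ "?out ?c ?a"]) (simp add: signal_fraction_def)
    next
      case t: 3
      let ?c = "(if \<theta> then 14 else 7, 15)"
      note st = state[of "\<lambda>\<theta>. if \<theta> then 14 else 7" 15 "bits q"]
      have "runs print_signal (?m ?src) (Suc (Suc (1 + Suc (3 * length (bits q) + 140) + 1))) (?out ?c a)"
      proof (cases x)
        case True
        have "runs print_signal (?m ?src) (Suc (Suc (Suc (Suc (3 * length (bits q) + 140))))) (?out ?c a)"
          unfolding print_signal_def using st
          by (intro runs_Branch) (use t True in auto)
        then show ?thesis by (rule runs_mono) simp
      next
        case False
        have "runs (Seq drop_bit (Branch Src Skip
             (Seq drop_num (read_state (\<lambda>\<theta>. print_fraction (if \<theta> then 8 else 1, 9))))
             (Seq drop_num (read_state (\<lambda>\<theta>. print_fraction (if \<theta> then 14 else 7, 15))))))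
           (?m (True # t # pairs (bits q) @ False # False # \<theta> # a)) (1 + Suc (3 * length (bits q) + 140) + 1) (?out ?c a)"
          using t st by (intro runs_Seq[OF runs_drop_bit] runs_Branch) auto
        then show ?thesis
          unfolding print_signal_def by (intro runs_Branch) (use False in auto)
      qed
      then have "runs print_signal (?m ?src) ?B (?out ?c a)" by (rule runs_mono) (simp add: bv)
      then show ?thesis using t 3 md src
        by (intro exI[of _ "?out ?c a"]) (simp add: signal_fraction_def)
    qed
  qed
qed

definition probability_program :: "reg com" where
  "probability_program = Seq (move Flag Inp Src)
     (Seq (While Src (Seq (Push Hst1 True) (Push Hst2 True))) (Seq drop_clauses print_signal))"

lemma runs_probability_program:
  fixes \<phi> :: cnf and v j :: nat and \<theta> :: bool
  defines "x \<equiv> enc_cnf \<phi> @ enc_nat v @ [\<theta>] @ enc_unary j"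
  shows "\<exists>s'. s' Out = rev (enc_fraction (signal_fraction (num_vars \<phi>) \<theta> v)) \<and>
     runs probability_program ((\<lambda>_. [])(Inp := rev x)) (2000 * (length x + 1) ^ 2) s'"
proof -
  let ?N = "num_vars \<phi>"
  let ?tl = "enc_list (enc_list enc_lit) (snd \<phi>) @ enc_nat v @ \<theta> # enc_unary j"
  have x: "x = enc_unary ?N @ ?tl" by (simp add: x_def enc_cnf_eq num_vars_def)
  have 1: "runs (move Flag Inp Src) ((\<lambda>_. [])(Inp := rev x)) (6 * length x + 7) (mem (enc_unary ?N @ ?tl) [] [] [] [] [])"
    by (rule runs_weaken, rule runs_move) (auto simp: x mem_def fun_eq_iff)
  have 2: "runs (While Src (Seq (Push Hst1 True) (Push Hst2 True))) (mem (enc_unary k @ a) [] [] [] e f) (5 * k + 1)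
      (mem a [] [] [] (replicate k True @ e) (replicate k True @ f))" for k a e f
  proof (induction k arbitrary: e f)
    case 0
    show ?case by (rule runs_weaken, rule runs_While_stop) (simp_all add: enc_unary_def)
  next
    case (Suc k)
    have step: "runs (Seq (Push Hst1 True) (Push Hst2 True)) (mem (enc_unary k @ a) [] [] [] e f) 3
        (mem (enc_unary k @ a) [] [] [] (True # e) (True # f))"
      by (rule runs_weaken, rule runs_Seq, rule runs_Push, rule runs_Push) simp_all
    show ?case
      by - (rule runs_weaken, rule runs_While_step[OF _ _ Suc, where n = 3 and bs = "enc_unary k @ a"],
        use step in \<open>simp_all add: enc_unary_def\<close>, simp add: replicate_app_Cons_same)
  qed
  obtain s' where s': "s' Out = rev (enc_fraction (signal_fraction ?N \<theta> v))"
     "runs print_signal (mem (enc_nat v @ \<theta> # enc_unary j) [] [] [] (replicate ?N True @ []) (replicate ?N True @ []))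
       (100 * (length (bits v) + ?N + 5)) s'"
    using runs_print_signal[of ?N \<theta> v "enc_unary j"] by auto
  have "length (enc_nat v) = 2 * length (bits v) + 2" by (simp add: enc_nat_pairs)
  then have lx: "?N + length (enc_list (enc_list enc_lit) (snd \<phi>)) + length (bits v) \<le> length x"
    by (simp add: x enc_unary_def)
  have bound: "6 * y + 7 + (5 * n + 1 + (6 * l + 1 + 100 * (b + n + 5) + 1) + 1) + 1 \<le> 2000 * q"
    if "n + l + b \<le> y" "y + 1 \<le> q" for n l b y q :: nat
    using that by (simp add: distrib_left)
  have "length x + 1 \<le> (length x + 1) ^ 2" by (simp add: power2_eq_square)
  then have cost: "6 * length x + 7 + (5 * ?N + 1 + (6 * length (enc_list (enc_list enc_lit) (snd \<phi>)) + 1 +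
      100 * (length (bits v) + ?N + 5) + 1) + 1) + 1 \<le> 2000 * (length x + 1) ^ 2"
    using lx by (intro bound)
  have "runs probability_program ((\<lambda>_. [])(Inp := rev x)) (2000 * (length x + 1) ^ 2) s'"
    unfolding probability_program_def
    by (rule runs_weaken[OF runs_Seq[OF 1 runs_Seq[OF 2 runs_Seq[OF runs_drop_clauses s'(2)]]] cost refl])
  with s'(1) show ?thesis by blast
qed

lemma poly_time_probs_reduction: "poly_time_probs reduction"
proof -
  obtain M where M: "tm_wf M" "\<And>x s'. runs probability_program ((\<lambda>_. [])(Inp := rev x)) (2000 * (length x + 1) ^ 2) s' \<Longrightarrow>
     tm_computes_in M x (rev (s' Out)) (20 * (2000 + 1) ^ 2 * (length x + 1) ^ 4)"
    using tm_of_quadratic_program by blast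
  have "let inp = enc_cnf \<phi> @ enc_nat v @ [\<theta>] @ enc_unary j in
     \<exists>y. tm_computes_in M inp y (20 * (2000 + 1) ^ 2 * (length inp + 1) ^ 4) \<and>
        is_approx y (sig_prob (net (reduction \<phi>)) \<theta> v) j" for \<phi> v \<theta> j
  proof -
    let ?y = "enc_fraction (signal_fraction (num_vars \<phi>) \<theta> v)" and ?x = "enc_cnf \<phi> @ enc_nat v @ [\<theta>] @ enc_unary j"
    have "tm_computes_in M ?x ?y (20 * (2000 + 1) ^ 2 * (length ?x + 1) ^ 4)"
      using runs_probability_program[where \<phi> = \<phi> and v = v and \<theta> = \<theta> and j = j] M(2) by (metis rev_rev_ident)
    moreover have "is_approx ?y (sig_prob (net (reduction \<phi>)) \<theta> v) j"
      unfolding is_approx_def enc_fraction_def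
      using snd_signal_fraction by (intro exI conjI) (auto simp: sig_prob_fraction)
    ultimately show ?thesis unfolding Let_def by blast
  qed
  with M(1) show ?thesis unfolding poly_time_probs_def by blast
qed

section \<open>Marginals of the signal distribution\<close>

definition likelihood :: "bnet \<Rightarrow> bool \<Rightarrow> nat \<Rightarrow> bool \<Rightarrow> real" where
  "likelihood \<Pi> \<theta> v b = (if b then sig_prob \<Pi> \<theta> v else 1 - sig_prob \<Pi> \<theta> v)"

definition profiles_on :: "'a set \<Rightarrow> ('a \<Rightarrow> bool) set" where
  "profiles_on D = {s. \<forall>v. v \<notin> D \<longrightarrow> \<not> s v}"

text \<open>The joint probability of state and event, including the prior 1/2. Beliefs are compared
  through these masses, without division.\<close>

definition mass :: "bnet \<Rightarrow> bool \<Rightarrow> ((nat \<Rightarrow> bool) \<Rightarrow> bool) \<Rightarrow> real" where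
  "mass \<Pi> \<theta> E = (\<Sum>s \<in> profiles \<Pi>. if E s then weight \<Pi> \<theta> s else 0)"

lemma profiles_on_insert:
  assumes "v \<notin> A"
  shows "profiles_on (insert v A) = profiles_on A \<union> (\<lambda>s. s(v := True)) ` profiles_on A"
proof -
  have "s \<in> profiles_on A \<union> (\<lambda>s. s(v := True)) ` profiles_on A" if "s \<in> profiles_on (insert v A)" for s
  proof (cases "s v")
    case True
    then have "s = (s(v := False))(v := True)" by (simp add: fun_upd_idem)
    moreover have "s(v := False) \<in> profiles_on A" using that by (auto simp: profiles_on_def)
    ultimately show ?thesis by blast
  qed (use that in \<open>auto simp: profiles_on_def\<close>)
  then show ?thesis by (auto simp: profiles_on_def)
qed

lemma finite_profiles_on: "finite A \<Longrightarrow> finite (profiles_on A)"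
proof (induction A rule: finite_induct)
  case empty
  have "profiles_on {} = {\<lambda>_ :: 'a. False}" by (auto simp: profiles_on_def)
  then show ?case by simp
qed (simp add: profiles_on_insert)

lemma sum_profiles_on_insert:
  assumes "finite A" "v \<notin> A"
  shows "(\<Sum>s \<in> profiles_on (insert v A). f s) = (\<Sum>s \<in> profiles_on A. f s + f (s(v := True)))"
proof -
  have F: "\<not> s v" if "s \<in> profiles_on A" for s using that assms(2) by (simp add: profiles_on_def)
  have inj: "inj_on (\<lambda>s. s(v := True)) (profiles_on A)"
  proof (rule inj_onI)
    fix s s' assume s: "s \<in> profiles_on A" "s' \<in> profiles_on A" "s(v := True) = s'(v := True)"
    then have "s w = s' w" if "w \<noteq> v" for w using that by (metis fun_upd_other)
    then show "s = s'" using F[OF s(1)] F[OF s(2)] by (intro ext) metis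
  qed
  have "profiles_on A \<inter> (\<lambda>s. s(v := True)) ` profiles_on A = {}" using F by fastforce
  then show ?thesis
    using assms finite_profiles_on[OF assms(1)] inj
    by (simp add: profiles_on_insert sum.union_disjoint sum.reindex sum.distrib)
qed

text \<open>Coordinates outside \<open>D\<close> are summed out one at a time, the two values of
  each contributing \<open>q v False + q v True = 1\<close>.\<close>

lemma sum_marginal:
  fixes q :: "'a \<Rightarrow> bool \<Rightarrow> real"
  assumes "finite A" "D \<subseteq> A" and q: "\<And>v. q v False + q v True = 1"
    and E: "\<And>s s'. \<forall>v \<in> D. s v = s' v \<Longrightarrow> E s = E s'"
  shows "(\<Sum>s \<in> profiles_on A. if E s then \<Prod>v \<in> A. q v (s v) else 0) =
    (\<Sum>s \<in> profiles_on D. if E s then \<Prod>v \<in> D. q v (s v) else 0)"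
proof -
  have "(\<Sum>s \<in> profiles_on (D \<union> B). if E s then \<Prod>v \<in> D \<union> B. q v (s v) else 0) =
      (\<Sum>s \<in> profiles_on D. if E s then \<Prod>v \<in> D. q v (s v) else 0)" if "finite B" "B \<inter> D = {}" for B
    using that
  proof (induction B rule: finite_induct)
    case empty
    show ?case by (simp only: Un_empty_right)
  next
    case (insert w B)
    have D: "finite D" using assms(1,2) finite_subset by blast
    have w: "w \<notin> D \<union> B" using insert by auto
    have fin: "finite (D \<union> B)" using D insert by simp
    have "(if E s then \<Prod>v \<in> insert w (D \<union> B). q v (s v) else 0) +
        (if E (s(w := True)) then \<Prod>v \<in> insert w (D \<union> B). q v ((s(w := True)) v) else 0) =
        (if E s then \<Prod>v \<in> D \<union> B. q v (s v) else 0)" if "s \<in> profiles_on (D \<union> B)" for s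
    proof -
      have "E (s(w := True)) = E s" using w by (intro E) auto
      moreover have "(\<Prod>v \<in> D \<union> B. q v ((s(w := True)) v)) = (\<Prod>v \<in> D \<union> B. q v (s v))"
        using w by (intro prod.cong) auto
      moreover have "\<not> s w" using that w by (simp add: profiles_on_def)
      ultimately show ?thesis using q[of w] fin w
        by (simp flip: distrib_right)
    qed
    then have "(\<Sum>s \<in> profiles_on (insert w (D \<union> B)). if E s then \<Prod>v \<in> insert w (D \<union> B). q v (s v) else 0) =
        (\<Sum>s \<in> profiles_on (D \<union> B). if E s then \<Prod>v \<in> D \<union> B. q v (s v) else 0)"
      unfolding sum_profiles_on_insert[OF fin w] by (rule sum.cong[OF refl])
    with insert show ?case by (simp only: Un_insert_right) simp
  qed
  from this[of "A - D"] have "(\<Sum>s \<in> profiles_on (D \<union> (A - D)). if E s then \<Prod>v \<in> D \<union> (A - D). q v (s v) else 0) =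
      (\<Sum>s \<in> profiles_on D. if E s then \<Prod>v \<in> D. q v (s v) else 0)" using assms(1) by blast
  moreover have "D \<union> (A - D) = A" using assms(2) by blast
  ultimately show ?thesis by (simp only:)
qed

lemma profiles_eq: "profiles \<Pi> = profiles_on {..<n_agents \<Pi>}"
  by (auto simp: profiles_def profiles_on_def)

lemma weight_eq: "weight \<Pi> \<theta> s = 1/2 * (\<Prod>v < n_agents \<Pi>. likelihood \<Pi> \<theta> v (s v))"
  by (simp add: weight_def likelihood_def)

lemma mass_marginal:
  assumes "D \<subseteq> {..<n_agents \<Pi>}" "\<And>s s'. \<forall>v \<in> D. s v = s' v \<Longrightarrow> E s = E s'"
  shows "mass \<Pi> \<theta> E = 1/2 * (\<Sum>s \<in> profiles_on D. if E s then \<Prod>v \<in> D. likelihood \<Pi> \<theta> v (s v) else 0)"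
proof -
  have "mass \<Pi> \<theta> E = 1/2 * (\<Sum>s \<in> profiles_on {..<n_agents \<Pi>}.
      if E s then \<Prod>v \<in> {..<n_agents \<Pi>}. likelihood \<Pi> \<theta> v (s v) else 0)"
    unfolding mass_def profiles_eq weight_eq sum_distrib_left by (intro sum.cong) auto
  also have "\<dots> = 1/2 * (\<Sum>s \<in> profiles_on D. if E s then \<Prod>v \<in> D. likelihood \<Pi> \<theta> v (s v) else 0)"
    using assms by (subst sum_marginal[of _ D]) (auto simp: likelihood_def)
  finally show ?thesis .
qed

lemma mass_fixed:
  assumes "D \<subseteq> {..<n_agents \<Pi>}"
  shows "mass \<Pi> \<theta> (\<lambda>s. \<forall>v \<in> D. s v = g v) = 1/2 * (\<Prod>v \<in> D. likelihood \<Pi> \<theta> v (g v))"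
proof -
  have fin: "finite D" using assms finite_subset by blast
  let ?g = "\<lambda>v. v \<in> D \<and> g v"
  have "(\<Sum>s \<in> profiles_on D. if \<forall>v \<in> D. s v = g v then \<Prod>v \<in> D. likelihood \<Pi> \<theta> v (s v) else 0) =
      (\<Sum>s \<in> profiles_on D. if s = ?g then \<Prod>v \<in> D. likelihood \<Pi> \<theta> v (g v) else 0)"
    by (intro sum.cong) (auto simp: profiles_on_def fun_eq_iff intro!: prod.cong)
  also have "\<dots> = (\<Prod>v \<in> D. likelihood \<Pi> \<theta> v (g v))"
    using finite_profiles_on[OF fin] by (simp add: profiles_on_def)
  finally show ?thesis by (subst mass_marginal[OF assms]) auto
qed

lemma prob_mass:
  "prob \<Pi> (\<lambda>\<theta> s. \<theta> \<and> E s) = mass \<Pi> True E"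
  "prob \<Pi> (\<lambda>\<theta> s. E s) = mass \<Pi> True E + mass \<Pi> False E"
  by (simp_all add: prob_def mass_def UNIV_bool)

lemma likelihood_nonneg: "bnet_wf \<Pi> \<Longrightarrow> v < n_agents \<Pi> \<Longrightarrow> 0 \<le> likelihood \<Pi> \<theta> v b"
  unfolding bnet_wf_def likelihood_def sig_prob_def
  by (metis (full_types) diff_ge_0_iff_ge order_trans)

lemma weight_nonneg: "bnet_wf \<Pi> \<Longrightarrow> 0 \<le> weight \<Pi> \<theta> s"
  unfolding weight_eq by (intro mult_nonneg_nonneg prod_nonneg) (auto simp: likelihood_nonneg)

lemma mass_nonneg: "bnet_wf \<Pi> \<Longrightarrow> 0 \<le> mass \<Pi> \<theta> E"
  unfolding mass_def by (intro sum_nonneg) (auto simp: weight_nonneg)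

lemma mass_mono:
  assumes "bnet_wf \<Pi>" "\<And>s. E s \<Longrightarrow> E' s"
  shows "mass \<Pi> \<theta> E \<le> mass \<Pi> \<theta> E'"
  unfolding mass_def using assms by (intro sum_mono) (auto simp: weight_nonneg)

lemma mass_split: "mass \<Pi> \<theta> E = mass \<Pi> \<theta> (\<lambda>s. E s \<and> A s) + mass \<Pi> \<theta> (\<lambda>s. E s \<and> \<not> A s)"
  unfolding mass_def sum.distrib[symmetric] by (intro sum.cong) auto

lemma mass_le_half:
  assumes "bnet_wf \<Pi>"
  shows "mass \<Pi> \<theta> E \<le> 1/2"
  using mass_mono[OF assms, of E "\<lambda>s. \<forall>v \<in> {}. s v = True" \<theta>] mass_fixed[of "{}" \<Pi> \<theta> "\<lambda>_. True"] by simp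

text \<open>The event contains every profile that agrees with \<open>s\<close> on \<open>D\<close>,
  and by \<open>mass_fixed\<close> those have a mass in product form.\<close>

lemma mass_pos:
  assumes wf: "bnet_wf \<Pi>" and D: "D \<subseteq> {..<n_agents \<Pi>}" and E: "\<And>s'. \<forall>v \<in> D. s' v = s v \<Longrightarrow> E s'"
  shows "1/2 * (\<Prod>v \<in> D. likelihood \<Pi> \<theta> v (s v)) \<le> mass \<Pi> \<theta> E"
  unfolding mass_fixed[OF D, symmetric] by (rule mass_mono[OF wf]) (use E in auto)

text \<open>A bound on likelihood ratios that holds for each signal pattern in the event carries
  over to the event by summation.\<close>

lemma mass_compare:
  assumes wf: "bnet_wf \<Pi>" and D: "D \<subseteq> {..<n_agents \<Pi>}"
    and E: "\<And>s s'. \<forall>v \<in> D. s v = s' v \<Longrightarrow> E s = E s'"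
    and le: "\<And>s. E s \<Longrightarrow> a * (\<Prod>v \<in> D. likelihood \<Pi> \<theta> v (s v)) \<le> b * (\<Prod>v \<in> D. likelihood \<Pi> \<theta>' v (s v))"
  shows "a * mass \<Pi> \<theta> E \<le> b * mass \<Pi> \<theta>' E"
proof -
  have "(\<Sum>s \<in> profiles_on D. a * (if E s then \<Prod>v \<in> D. likelihood \<Pi> \<theta> v (s v) else 0))
    \<le> (\<Sum>s \<in> profiles_on D. b * (if E s then \<Prod>v \<in> D. likelihood \<Pi> \<theta>' v (s v) else 0))"
    using le by (intro sum_mono) auto
  moreover have "mass \<Pi> \<theta> E = 1/2 * (\<Sum>s \<in> profiles_on D. if E s then \<Prod>v \<in> D. likelihood \<Pi> \<theta> v (s v) else 0)" for \<theta>
    using D E by (rule mass_marginal)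
  ultimately show ?thesis by (simp only: sum_distrib_left[symmetric])
qed

lemma half_less_fraction:
  fixes x y :: real
  assumes "0 \<le> x" "0 \<le> y"
  shows "1/2 < x / (x + y) \<longleftrightarrow> y < x"
proof (cases "x + y = 0")
  \<comment> \<open>An impossible history has belief 0/0 = 0, hence action F, which agrees with the
    comparison of two zeros.\<close>
  case True
  then show ?thesis using assms by simp
next
  case False
  then have "0 < x + y" using assms by simp
  then show ?thesis by (simp add: field_simps)
qed

lemma belief_from_gt_half:
  assumes "bnet_wf \<Pi>"
  shows "1/2 < belief_from \<Pi> prev v b h \<longleftrightarrow>
    mass \<Pi> False (\<lambda>s. s v = b \<and> hist_consistent \<Pi> prev v h s) < mass \<Pi> True (\<lambda>s. s v = b \<and> hist_consistent \<Pi> prev v h s)"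
  using half_less_fraction[OF mass_nonneg[OF assms] mass_nonneg[OF assms]]
  unfolding belief_from_def prob_mass by simp

section \<open>The first two rounds of actions\<close>

definition action0 :: "bnet \<Rightarrow> nat \<Rightarrow> (nat \<Rightarrow> bool) \<Rightarrow> bool" where
  "action0 \<Pi> v s \<longleftrightarrow> 1/2 < belief_from \<Pi> [] v (s v) (\<lambda>w t. ([] ! t) w s)"

definition action1 :: "bnet \<Rightarrow> nat \<Rightarrow> (nat \<Rightarrow> bool) \<Rightarrow> bool" where
  "action1 \<Pi> v s \<longleftrightarrow> 1/2 < belief_from \<Pi> [action0 \<Pi>] v (s v) (\<lambda>w t. ([action0 \<Pi>] ! t) w s)"

lemma actseq_2: "actseq \<Pi> 2 = [action0 \<Pi>, action1 \<Pi>]"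
  by (simp add: numeral_2_eq_2 Let_def action0_def[abs_def] action1_def[abs_def])

text \<open>Without history the belief depends on the own signal alone; an uninformative signal is a
  tie, and ties go to F.\<close>

lemma action0_iff:
  assumes wf: "bnet_wf \<Pi>" and v: "v < n_agents \<Pi>"
  shows "action0 \<Pi> v s \<longleftrightarrow> s v \<and> pF \<Pi> v < pT \<Pi> v"
proof -
  have E: "(\<lambda>s'. s' v = s v \<and> hist_consistent \<Pi> [] v h s') = (\<lambda>s'. \<forall>w \<in> {v}. s' w = s w)" for h
    by (simp add: hist_consistent_def)
  have "action0 \<Pi> v s \<longleftrightarrow> likelihood \<Pi> False v (s v) < likelihood \<Pi> True v (s v)"
    unfolding action0_def belief_from_gt_half[OF wf] E using v by (subst (1 2) mass_fixed) auto
  moreover have "pF \<Pi> v \<le> pT \<Pi> v" using wf v by (simp add: bnet_wf_def)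
  ultimately show ?thesis by (auto simp: likelihood_def sig_prob_def)
qed

text \<open>Round 0 actions of informative neighbours reveal exactly their signals. In round 1 the
  agent therefore knows the signals in \<open>?D\<close>, and conditional independence turns its
  decision into a comparison of two products.\<close>

lemma action1_iff:
  assumes wf: "bnet_wf \<Pi>" and v: "v < n_agents \<Pi>"
    and inf: "\<And>w. observes \<Pi> v w \<Longrightarrow> pF \<Pi> w < pT \<Pi> w"
  shows "action1 \<Pi> v s \<longleftrightarrow>
    (\<Prod>w \<in> insert v {w. observes \<Pi> v w}. likelihood \<Pi> False w (s w)) <
    (\<Prod>w \<in> insert v {w. observes \<Pi> v w}. likelihood \<Pi> True w (s w))"
proof -
  let ?D = "insert v {w. observes \<Pi> v w}"
  have w: "w < n_agents \<Pi>" if "observes \<Pi> v w" for w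
    using wf that by (auto simp: bnet_wf_def observes_def)
  have "hist_consistent \<Pi> [action0 \<Pi>] v (\<lambda>w t. ([action0 \<Pi>] ! t) w s) s' \<longleftrightarrow> (\<forall>w. observes \<Pi> v w \<longrightarrow> s' w = s w)" for s'
    using action0_iff[OF wf w] inf by (auto simp: hist_consistent_def)
  then have E: "(\<lambda>s'. s' v = s v \<and> hist_consistent \<Pi> [action0 \<Pi>] v (\<lambda>w t. ([action0 \<Pi>] ! t) w s) s') = (\<lambda>s'. \<forall>w \<in> ?D. s' w = s w)"
    by auto
  have "?D \<subseteq> {..<n_agents \<Pi>}" using v w by auto
  then show ?thesis
    unfolding action1_def belief_from_gt_half[OF wf] E by (simp only: mass_fixed) simp
qed

section \<open>The gates of the network\<close>

text \<open>The probability of switch signal 0 given the state.\<close>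

definition eps :: "cnf \<Rightarrow> bool \<Rightarrow> real" where
  "eps \<phi> \<theta> = (1/2) ^ ((if \<theta> then 10 else 3) * (num_vars \<phi> + 1))"

lemma eps_bounds: "0 < eps \<phi> \<theta>" "eps \<phi> \<theta> \<le> 1/8"
proof -
  have "(1/2 :: real) ^ ((if \<theta> then 10 else 3) * (num_vars \<phi> + 1)) \<le> (1/2) ^ 3"
    by (intro power_decreasing) auto
  then show "eps \<phi> \<theta> \<le> 1/8" by (simp add: eps_def power3_eq_cube del: mult_Suc_right)
qed (simp add: eps_def)

lemma eps_ratio: "eps \<phi> True = (1/2) ^ (7 * (num_vars \<phi> + 1)) * eps \<phi> False"
proof -
  have "10 * (num_vars \<phi> + 1) = 7 * (num_vars \<phi> + 1) + 3 * (num_vars \<phi> + 1)" by simp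
  then show ?thesis unfolding eps_def by (simp only: power_add if_True if_False)
qed

text \<open>128 is well above the factor 2^3 that three literal agents can contribute, so switch
  signal 0 overrules them in \<open>clause_gate\<close>.\<close>

lemma eps_ratio_le: "128 * eps \<phi> True \<le> eps \<phi> False"
proof -
  have "(1/2 :: real) ^ (7 * (num_vars \<phi> + 1)) \<le> (1/2) ^ 7" by (intro power_decreasing) auto
  also have "\<dots> = 1/128" by (simp add: power_divide)
  finally have "(1/2 :: real) ^ (7 * (num_vars \<phi> + 1)) * eps \<phi> False \<le> 1/128 * eps \<phi> False"
    using eps_bounds(1)[of \<phi> False] by (intro mult_right_mono) auto
  then show ?thesis unfolding eps_ratio by simp
qed

lemma network_prob:
  "pT (network \<phi>) 0 = 1/2" "pF (network \<phi>) 0 = 1/2"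
  "pT (network \<phi>) 1 = 1 - eps \<phi> True" "pF (network \<phi>) 1 = 1 - eps \<phi> False"
  "pT (network \<phi>) (pair_agent i) = 8/9" "pF (network \<phi>) (pair_agent i) = 1/9"
  "pT (network \<phi>) (clause_agent i) = 1/2" "pF (network \<phi>) (clause_agent i) = 1/2"
  "pT (network \<phi>) (lit_agent l) = 14/15" "pF (network \<phi>) (lit_agent l) = 7/15"
proof -
  have "pair_agent i mod 4 = 0" "clause_agent i mod 4 = 1" "lit_agent l mod 4 = 2 + of_bool (snd l)"
    unfolding pair_agent_def clause_agent_def lit_agent_def by (auto simp: of_bool_def) presburger+
  then show "pT (network \<phi>) 0 = 1/2" "pF (network \<phi>) 0 = 1/2"
  "pT (network \<phi>) 1 = 1 - eps \<phi> True" "pF (network \<phi>) 1 = 1 - eps \<phi> False"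
  "pT (network \<phi>) (pair_agent i) = 8/9" "pF (network \<phi>) (pair_agent i) = 1/9"
  "pT (network \<phi>) (clause_agent i) = 1/2" "pF (network \<phi>) (clause_agent i) = 1/2"
  "pT (network \<phi>) (lit_agent l) = 14/15" "pF (network \<phi>) (lit_agent l) = 7/15"
    by (simp_all add: network_def eps_def)
qed

lemma network_likelihood:
  "likelihood (network \<phi>) \<theta> 1 b = (if b then 1 - eps \<phi> \<theta> else eps \<phi> \<theta>)"
  "likelihood (network \<phi>) \<theta> (pair_agent i) b = (if \<theta> = b then 8/9 else 1/9)"
  "likelihood (network \<phi>) \<theta> (clause_agent i) b = 1/2"
  "likelihood (network \<phi>) \<theta> (lit_agent l) b = (if b then (if \<theta> then 14/15 else 7/15) else (if \<theta> then 1/15 else 8/15))"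
  unfolding likelihood_def sig_prob_def network_prob by (cases \<theta>; simp)+

text \<open>The extreme case is the switch in state T; every other agent stays within 1/15 and
  14/15, well inside the bound 1/1024 on \<open>eps \<phi> True\<close>.\<close>

lemma network_prob_bounds:
  "(1/2) ^ (10 * (num_vars \<phi> + 1)) \<le> sig_prob (network \<phi>) \<theta> v"
  "sig_prob (network \<phi>) \<theta> v \<le> 1 - (1/2) ^ (10 * (num_vars \<phi> + 1))"
  "pF (network \<phi>) v \<le> pT (network \<phi>) v"
proof -
  have e: "eps \<phi> True \<le> eps \<phi> \<theta>" for \<theta>
    using eps_ratio_le[of \<phi>] eps_bounds(1)[of \<phi> True] by (cases \<theta>) auto
  have small: "eps \<phi> True \<le> 1/1024"
    using eps_ratio_le[of \<phi>] eps_bounds(2)[of \<phi> False] by simp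
  have "(1/2) ^ (10 * (num_vars \<phi> + 1)) = eps \<phi> True" by (simp add: eps_def)
  moreover have "eps \<phi> True \<le> sig_prob (network \<phi>) \<theta> v \<and> sig_prob (network \<phi>) \<theta> v \<le> 1 - eps \<phi> True"
  proof (cases "v = 1")
    case True
    then show ?thesis
      using e[of \<theta>] eps_bounds(2)[of \<phi> \<theta>] small network_prob(3,4)[of \<phi>] by (auto simp: sig_prob_def)
  next
    case False
    then show ?thesis using small by (auto simp: sig_prob_def network_def)
  qed
  ultimately show "(1/2) ^ (10 * (num_vars \<phi> + 1)) \<le> sig_prob (network \<phi>) \<theta> v"
    "sig_prob (network \<phi>) \<theta> v \<le> 1 - (1/2) ^ (10 * (num_vars \<phi> + 1))" by auto
  show "pF (network \<phi>) v \<le> pT (network \<phi>) v"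
  proof (cases "v = 1")
    case True
    then show ?thesis using e[of False] network_prob(3,4)[of \<phi>] by simp
  next
    case False
    then show ?thesis by (simp add: network_def)
  qed
qed

lemma clause_lits:
  assumes "is_3cnf \<phi>" "j < num_clauses \<phi>" "l \<in> set (snd \<phi> ! j)"
  shows "fst l < num_vars \<phi>"
proof -
  have "snd \<phi> ! j \<in> set (snd \<phi>)" using assms(2) by (simp add: num_clauses_def)
  then show ?thesis using assms(1,3) unfolding is_3cnf_def num_vars_def by fastforce
qed

lemma card_clause:
  assumes "is_3cnf \<phi>" "j < num_clauses \<phi>"
  shows "card (set (snd \<phi> ! j)) \<le> 3"
proof -
  have "snd \<phi> ! j \<in> set (snd \<phi>)" using assms(2) by (simp add: num_clauses_def)
  then have "length (snd \<phi> ! j) \<le> 3" using assms(1) unfolding is_3cnf_def by blast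
  then show ?thesis using card_length order_trans by blast
qed

lemma agents_less:
  "0 < n_agents (network \<phi>)" "1 < n_agents (network \<phi>)" "Suc 0 < n_agents (network \<phi>)"
  "i < num_vars \<phi> + num_clauses \<phi> \<Longrightarrow> pair_agent i < n_agents (network \<phi>)"
  "i < num_vars \<phi> + num_clauses \<phi> \<Longrightarrow> clause_agent i < n_agents (network \<phi>)"
  "fst l < num_vars \<phi> \<Longrightarrow> lit_agent l < n_agents (network \<phi>)"
  by (auto simp: pair_agent_def clause_agent_def lit_agent_def of_bool_def)

lemma network_wf:
  assumes "is_3cnf \<phi>"
  shows "bnet_wf (network \<phi>)"
proof -
  have "v < n_agents (network \<phi>) \<and> w < n_agents (network \<phi>)" if "observes (network \<phi>) v w" for v w
    using that by (auto simp: observes_network edges_variable edges_clause simp del: network_simps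
        intro!: agents_less dest: clause_lits[OF assms])
  moreover have "0 \<le> pF (network \<phi>) v" "pT (network \<phi>) v \<le> 1" for v
  proof -
    have e: "(0 :: real) \<le> (1/2) ^ (10 * (num_vars \<phi> + 1))" by simp
    have "0 \<le> sig_prob (network \<phi>) False v" "sig_prob (network \<phi>) True v \<le> 1"
      using network_prob_bounds(1)[of \<phi> False v] network_prob_bounds(2)[of \<phi> True v] e by linarith+
    then show "0 \<le> pF (network \<phi>) v" "pT (network \<phi>) v \<le> 1" by (simp_all add: sig_prob_def)
  qed
  ultimately show ?thesis
    using network_prob_bounds(3) unfolding bnet_wf_def observes_def by blast
qed

lemma observes_pair: "{w. observes (network \<phi>) (pair_agent i) w} =
    (if i < num_vars \<phi> then {lit_agent (i, False), lit_agent (i, True)} else {})"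
  by (auto simp: observes_network edges_variable edges_clause)

lemma observes_clause:
  assumes "j < num_clauses \<phi>"
  shows "{w. observes (network \<phi>) (clause_agent (num_vars \<phi> + j)) w} = insert 1 (lit_agent ` set (snd \<phi> ! j))"
  using assms by (auto simp: observes_network edges_variable edges_clause)

text \<open>Given the own signal 1 the odds for T are 32, 2 or 1/8 according to whether none, one or
  both of the literal signals are 0.\<close>

lemma pair_gate:
  assumes "is_3cnf \<phi>" "i < num_vars \<phi>" "s (pair_agent i)"
  shows "action1 (network \<phi>) (pair_agent i) s \<longleftrightarrow> s (lit_agent (i, False)) \<or> s (lit_agent (i, True))"
proof -
  have obs: "observes (network \<phi>) (pair_agent i) w \<longleftrightarrow> w = lit_agent (i, False) \<or> w = lit_agent (i, True)" for w
    using observes_pair[of \<phi> i] assms(2) by auto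
  have inf: "pF (network \<phi>) w < pT (network \<phi>) w" if "observes (network \<phi>) (pair_agent i) w" for w
    using that unfolding obs by (auto simp: network_prob)
  have v: "pair_agent i < n_agents (network \<phi>)" using assms(2) by (intro agents_less(4)) simp
  have "action1 (network \<phi>) (pair_agent i) s \<longleftrightarrow>
    (\<Prod>w \<in> insert (pair_agent i) {lit_agent (i, False), lit_agent (i, True)}. likelihood (network \<phi>) False w (s w)) <
    (\<Prod>w \<in> insert (pair_agent i) {lit_agent (i, False), lit_agent (i, True)}. likelihood (network \<phi>) True w (s w))"
    using action1_iff[OF network_wf[OF assms(1)] v inf, of s] assms(2) unfolding observes_pair by (simp only: if_True)
  also have "\<dots> \<longleftrightarrow> s (lit_agent (i, False)) \<or> s (lit_agent (i, True))"
    using assms(3) by (simp add: network_likelihood)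
  finally show ?thesis .
qed

text \<open>A signal 1 of a literal agent multiplies the odds for T by 2, a signal 0 by 1/8.\<close>

lemma literal_odds:
  fixes \<phi> :: cnf and s :: "nat \<Rightarrow> bool" and L :: "(nat \<times> bool) set"
  defines "P \<equiv> \<lambda>\<theta> L. \<Prod>l \<in> L. likelihood (network \<phi>) \<theta> (lit_agent l) (s (lit_agent l))"
  assumes fin: "finite L" and card: "card L \<le> 3"
  shows "0 < P False L" "P True L \<le> 8 * P False L"
    "\<forall>l \<in> L. s (lit_agent l) \<Longrightarrow> P False L \<le> P True L"
    "\<exists>l \<in> L. \<not> s (lit_agent l) \<Longrightarrow> P True L \<le> 1/2 * P False L"
proof -
  have pos: "0 < P False K" for K
    unfolding P_def by (intro prod_pos) (auto simp: network_likelihood)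
  have le: "P True K \<le> 2 ^ card K * P False K" for K
    unfolding P_def prod_constant[symmetric] prod.distrib[symmetric]
    by (intro prod_mono) (auto simp: network_likelihood)
  show "0 < P False L" by (rule pos)
  have "(2 :: real) ^ card L \<le> 2 ^ 3" using card by (intro power_increasing) auto
  then have "2 ^ card L * P False L \<le> 8 * P False L" using pos[of L] by (intro mult_right_mono) auto
  with le[of L] show "P True L \<le> 8 * P False L" by simp
  show "P False L \<le> P True L" if "\<forall>l \<in> L. s (lit_agent l)"
    unfolding P_def using that by (intro prod_mono) (auto simp: network_likelihood)
  show "P True L \<le> 1/2 * P False L" if ex: "\<exists>l \<in> L. \<not> s (lit_agent l)"
  proof -
    obtain l where l: "l \<in> L" "\<not> s (lit_agent l)" using ex by blast
    have split: "P \<theta> L = likelihood (network \<phi>) \<theta> (lit_agent l) False * P \<theta> (L - {l})" for \<theta>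
      unfolding P_def using l fin by (subst prod.remove[of L l]) auto
    \<comment> \<open>At most two literals remain; their odds of at most 4 times the factor 1/8 of
      \<open>l\<close> give 1/2.\<close>
    have "card (L - {l}) \<le> 2" using l(1) fin card by simp
    then have "(2 :: real) ^ card (L - {l}) \<le> 2 ^ 2" by (intro power_increasing) auto
    then have "2 ^ card (L - {l}) * P False (L - {l}) \<le> 4 * P False (L - {l})"
      using pos[of "L - {l}"] by (intro mult_right_mono) auto
    then have "P True (L - {l}) \<le> 4 * P False (L - {l})" using le[of "L - {l}"] by simp
    then show ?thesis unfolding split by (simp add: network_likelihood)
  qed
qed

text \<open>With switch signal 0 the odds are at most 8/128. With switch signal 1, literal signals
  all 1 leave odds above 1, while one signal 0 gives at most 1/2 from the literals, which the factor
  (1 - eps T) / (1 - eps F), at most 8/7, cannot repair.\<close>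

lemma clause_gate:
  assumes cnf: "is_3cnf \<phi>" and j: "j < num_clauses \<phi>"
  shows "action1 (network \<phi>) (clause_agent (num_vars \<phi> + j)) s \<longleftrightarrow> s 1 \<and> (\<forall>l \<in> set (snd \<phi> ! j). s (lit_agent l))"
proof -
  let ?L = "set (snd \<phi> ! j)" and ?c = "clause_agent (num_vars \<phi> + j)"
  define P where "P \<theta> = (\<Prod>l \<in> ?L. likelihood (network \<phi>) \<theta> (lit_agent l) (s (lit_agent l)))" for \<theta>
  note odds = literal_odds[where L = ?L and \<phi> = \<phi> and s = s, OF finite_set card_clause[OF cnf j], folded P_def]
  have prod: "(\<Prod>w \<in> insert ?c (insert 1 (lit_agent ` ?L)). likelihood (network \<phi>) \<theta> w (s w)) =
      1/2 * (if s 1 then 1 - eps \<phi> \<theta> else eps \<phi> \<theta>) * P \<theta>" for \<theta>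
  proof -
    have "inj_on lit_agent ?L" by (simp add: inj_on_def)
    then have "(\<Prod>w \<in> lit_agent ` ?L. likelihood (network \<phi>) \<theta> w (s w)) = P \<theta>"
      by (simp add: P_def prod.reindex)
    moreover have "?c \<notin> insert 1 (lit_agent ` ?L)" "1 \<notin> lit_agent ` ?L"
      using clause_agent_eq lit_agent_eq(3)[symmetric] by auto
    ultimately show ?thesis using network_likelihood(1)[of \<phi> \<theta> "s 1"] network_likelihood(3)
      by simp
  qed
  have obs: "observes (network \<phi>) ?c w \<longleftrightarrow> w = 1 \<or> w \<in> lit_agent ` ?L" for w
    using observes_clause[OF j] by blast
  have inf: "pF (network \<phi>) w < pT (network \<phi>) w" if "observes (network \<phi>) ?c w" for w
    using that eps_ratio_le[of \<phi>] eps_bounds(1)[of \<phi> True] network_prob(3,4)[of \<phi>]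
    unfolding obs by (auto simp: network_prob)
  have c: "?c < n_agents (network \<phi>)" using j by (intro agents_less(5)) simp
  have iff: "action1 (network \<phi>) ?c s \<longleftrightarrow>
      1/2 * (if s 1 then 1 - eps \<phi> False else eps \<phi> False) * P False < 1/2 * (if s 1 then 1 - eps \<phi> True else eps \<phi> True) * P True"
    using action1_iff[OF network_wf[OF cnf] c inf, of s] unfolding observes_clause[OF j] prod .
  have e: "128 * eps \<phi> True \<le> eps \<phi> False" "0 < eps \<phi> True" "eps \<phi> False \<le> 1/8"
    using eps_ratio_le eps_bounds by auto
  consider "\<not> s 1" | "s 1" "\<forall>l \<in> ?L. s (lit_agent l)" | "s 1" "\<exists>l \<in> ?L. \<not> s (lit_agent l)" by blast
  then show ?thesis
  proof cases
    case 1
    have "eps \<phi> True * P True \<le> eps \<phi> True * (8 * P False)"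
      using odds(2) e(2) by (intro mult_left_mono) auto
    also have "\<dots> = (8 * eps \<phi> True) * P False" by simp
    also have "\<dots> \<le> eps \<phi> False * P False"
      using odds(1) e by (intro mult_right_mono) auto
    finally show ?thesis using 1 iff by simp
  next
    case 2
    \<comment> \<open>Strictness comes from the switch: for an empty clause the literals are
      neutral, and a tie would count as F.\<close>
    have "(1 - eps \<phi> False) * P False < (1 - eps \<phi> True) * P False"
      using odds(1) e by (intro mult_strict_right_mono) auto
    also have "\<dots> \<le> (1 - eps \<phi> True) * P True"
      using odds(3)[OF 2(2)] e by (intro mult_left_mono) auto
    finally show ?thesis using 2 iff by simp
  next
    case 3
    have "(1 - eps \<phi> True) * P True \<le> 1 * (1/2 * P False)"
      using odds(1) odds(4)[OF 3(2)] e by (intro mult_mono) (auto simp: P_def intro!: prod_nonneg simp: network_likelihood)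
    also have "\<dots> \<le> (1 - eps \<phi> False) * P False"
      using odds(1) e mult_right_mono[of "1/2" "1 - eps \<phi> False" "P False"] by simp
    finally show ?thesis using 3 iff by auto
  qed
qed

definition consistent :: "cnf \<Rightarrow> (nat \<Rightarrow> bool) \<Rightarrow> bool" where
  "consistent \<phi> s \<longleftrightarrow>
     (\<forall>i < num_vars \<phi>. s (pair_agent i) \<and> (s (lit_agent (i, False)) \<or> s (lit_agent (i, True)))) \<and>
     (s 1 \<longrightarrow> (\<forall>c \<in> set (snd \<phi>). \<exists>l \<in> set c. \<not> s (lit_agent l)))"

text \<open>Round 0 supplies the signals 1 of the pair agents, which is what
  \<open>pair_gate\<close> presupposes; for clause agents it says nothing. Round 1 contributes the
  gates.\<close>

lemma hist_consistent_reduction: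
  assumes "is_3cnf \<phi>"
  shows "hist_consistent (network \<phi>) (actseq (network \<phi>) 2) 0 (\<lambda>w t. even w) s \<longleftrightarrow> consistent \<phi> s"
proof -
  have even: "even (pair_agent i)" "odd (clause_agent i)" for i
    by (simp_all add: pair_agent_def clause_agent_def)
  note a0 = action0_iff[OF network_wf[OF assms], of _ s]
  have "hist_consistent (network \<phi>) (actseq (network \<phi>) 2) 0 (\<lambda>w t. even w) s \<longleftrightarrow>
      (\<forall>w. observes (network \<phi>) 0 w \<longrightarrow> action0 (network \<phi>) w s = even w \<and> action1 (network \<phi>) w s = even w)"
  proof -
    have "(\<forall>t' < Suc (Suc 0). R t') \<longleftrightarrow> R 0 \<and> R (Suc 0)" for R by (auto simp: less_Suc_eq)
    from this[of "\<lambda>t'. ([action0 (network \<phi>), action1 (network \<phi>)] ! t') w s = even w" for w]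
    show ?thesis unfolding hist_consistent_def actseq_2 by simp blast
  qed
  also have "\<dots> \<longleftrightarrow>
      (\<forall>i < num_vars \<phi>. action0 (network \<phi>) (pair_agent i) s \<and> action1 (network \<phi>) (pair_agent i) s) \<and>
      (\<forall>j < num_clauses \<phi>. \<not> action0 (network \<phi>) (clause_agent (num_vars \<phi> + j)) s \<and>
         \<not> action1 (network \<phi>) (clause_agent (num_vars \<phi> + j)) s)"
    unfolding observes_network edges_variable edges_clause
    by (auto simp: even)
  also have "\<dots> \<longleftrightarrow>
      (\<forall>i < num_vars \<phi>. s (pair_agent i) \<and> (s (lit_agent (i, False)) \<or> s (lit_agent (i, True)))) \<and>
      (\<forall>j < num_clauses \<phi>. \<not> (s 1 \<and> (\<forall>l \<in> set (snd \<phi> ! j). s (lit_agent l))))"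
    using a0[OF agents_less(4)] a0[OF agents_less(5)] pair_gate[OF assms] clause_gate[OF assms]
    by (auto simp: network_prob simp del: network_simps)
  also have "\<dots> \<longleftrightarrow> consistent \<phi> s"
    using all_set_conv_all_nth[of "snd \<phi>" "\<lambda>c. \<exists>l \<in> set c. \<not> s (lit_agent l)"]
    unfolding consistent_def num_clauses_def by auto
  finally show ?thesis .
qed

section \<open>The posterior of the decision maker\<close>

text \<open>All agents whose signals enter \<open>consistent\<close>; the others are summed out by
  \<open>mass_compare\<close>.\<close>

definition relevant :: "cnf \<Rightarrow> nat set" where
  "relevant \<phi> = insert 1 (pair_agent ` {..<num_vars \<phi>} \<union> (\<lambda>i. lit_agent (i, False)) ` {..<num_vars \<phi>}
     \<union> (\<lambda>i. lit_agent (i, True)) ` {..<num_vars \<phi>})"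

definition var_weight :: "cnf \<Rightarrow> bool \<Rightarrow> (nat \<Rightarrow> bool) \<Rightarrow> nat \<Rightarrow> real" where
  "var_weight \<phi> \<theta> s i = likelihood (network \<phi>) \<theta> (pair_agent i) (s (pair_agent i)) *
     likelihood (network \<phi>) \<theta> (lit_agent (i, False)) (s (lit_agent (i, False))) *
     likelihood (network \<phi>) \<theta> (lit_agent (i, True)) (s (lit_agent (i, True)))"

lemma prod_relevant:
  "(\<Prod>v \<in> relevant \<phi>. likelihood (network \<phi>) \<theta> v (s v)) =
     (if s 1 then 1 - eps \<phi> \<theta> else eps \<phi> \<theta>) * (\<Prod>i < num_vars \<phi>. var_weight \<phi> \<theta> s i)"
proof -
  let ?N = "{..<num_vars \<phi>}" and ?q = "\<lambda>v. likelihood (network \<phi>) \<theta> v (s v)"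
  let ?P = "pair_agent ` ?N" and ?F = "(\<lambda>i. lit_agent (i, False)) ` ?N" and ?T = "(\<lambda>i. lit_agent (i, True)) ` ?N"
  have disj: "?P \<inter> ?F = {}" "(?P \<union> ?F) \<inter> ?T = {}" by auto
  have one: "1 \<notin> ?P \<union> ?F \<union> ?T"
    using pair_agent_eq(3)[symmetric] lit_agent_eq(3)[symmetric] by auto
  have inj: "inj_on pair_agent ?N" "inj_on (\<lambda>i. lit_agent (i, b)) ?N" for b by (auto simp: inj_on_def)
  have "(\<Prod>v \<in> relevant \<phi>. ?q v) = ?q 1 * (\<Prod>v \<in> ?P \<union> ?F \<union> ?T. ?q v)"
    unfolding relevant_def using one by (subst prod.insert) auto
  also have "(\<Prod>v \<in> ?P \<union> ?F \<union> ?T. ?q v) = (\<Prod>v \<in> ?P. ?q v) * (\<Prod>v \<in> ?F. ?q v) * (\<Prod>v \<in> ?T. ?q v)"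
    using disj by (simp add: prod.union_disjoint)
  also have "\<dots> = (\<Prod>i < num_vars \<phi>. var_weight \<phi> \<theta> s i)"
    using inj by (simp add: prod.reindex var_weight_def prod.distrib)
  finally show ?thesis by (simp only: network_likelihood(1))
qed

lemma relevant_less: "relevant \<phi> \<subseteq> {..<n_agents (network \<phi>)}"
  unfolding relevant_def by (auto simp del: network_simps intro!: agents_less)

lemma in_relevant: "1 \<in> relevant \<phi>" "i < num_vars \<phi> \<Longrightarrow> pair_agent i \<in> relevant \<phi>"
  "fst l < num_vars \<phi> \<Longrightarrow> lit_agent l \<in> relevant \<phi>"
proof -
  show "lit_agent l \<in> relevant \<phi>" if "fst l < num_vars \<phi>"
    using that by (cases l; cases "snd l") (auto simp: relevant_def)
qed (auto simp: relevant_def)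

lemma consistent_cong:
  assumes cnf: "is_3cnf \<phi>" and eq: "\<forall>v \<in> relevant \<phi>. s v = s' v"
  shows "consistent \<phi> s = consistent \<phi> s'"
proof -
  have l: "s (lit_agent l) = s' (lit_agent l)" if "fst l < num_vars \<phi>" for l
    using eq in_relevant(3)[OF that] by blast
  have "s (lit_agent l) = s' (lit_agent l)" if "c \<in> set (snd \<phi>)" "l \<in> set c" for c l
    using that clause_lits[OF cnf] by (intro l) (metis in_set_conv_nth num_clauses_def)
  moreover have "s 1 = s' 1" "\<And>i. i < num_vars \<phi> \<Longrightarrow> s (pair_agent i) = s' (pair_agent i)"
    using eq in_relevant(1,2) by blast+
  ultimately show ?thesis unfolding consistent_def using l by simp
qed

text \<open>The odds of a variable are 8 * 2 / 8 = 2 if one literal is marked true and 8 * 2 * 2 =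
  32 if none is. The smallest weights, 49/2025 under F and 112/2025 under T, are rounded down; 1/72
  is chosen as 1/8 * 1/9 for comparison with \<open>mass_disabled_False\<close>.\<close>

lemma var_weight_bounds:
  assumes "consistent \<phi> s" "i < num_vars \<phi>"
  shows "2 * var_weight \<phi> False s i \<le> var_weight \<phi> True s i"
    "var_weight \<phi> True s i \<le> 32 * var_weight \<phi> False s i"
    "1/72 \<le> var_weight \<phi> False s i" "1/20 \<le> var_weight \<phi> True s i"
proof -
  have "s (pair_agent i)" "s (lit_agent (i, False)) \<or> s (lit_agent (i, True))"
    using assms by (auto simp: consistent_def)
  then show "2 * var_weight \<phi> False s i \<le> var_weight \<phi> True s i"
    "var_weight \<phi> True s i \<le> 32 * var_weight \<phi> False s i"
    "1/72 \<le> var_weight \<phi> False s i" "1/20 \<le> var_weight \<phi> True s i"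
    by (auto simp: var_weight_def network_likelihood)
qed

lemma power_le_prod:
  fixes f :: "nat \<Rightarrow> real"
  assumes "0 \<le> a" "\<And>i. i < n \<Longrightarrow> a \<le> f i"
  shows "a ^ n \<le> (\<Prod>i < n. f i)"
  using prod_mono[of "{..<n}" "\<lambda>_. a" f] assms by simp

lemma mass_consistent_pos:
  assumes cnf: "is_3cnf \<phi>" and s: "consistent \<phi> s"
  shows "1/2 * ((if s 1 then 1 - eps \<phi> \<theta> else eps \<phi> \<theta>) * (\<Prod>i < num_vars \<phi>. var_weight \<phi> \<theta> s i))
    \<le> mass (network \<phi>) \<theta> (\<lambda>s'. consistent \<phi> s' \<and> s' 1 = s 1)"
  unfolding prod_relevant[symmetric]
proof (rule mass_pos[OF network_wf[OF cnf] relevant_less])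
  fix s' assume "\<forall>v \<in> relevant \<phi>. s' v = s v"
  then show "consistent \<phi> s' \<and> s' 1 = s 1"
    using consistent_cong[OF cnf, of s' s] s in_relevant(1) by blast
qed

lemma posterior_mass:
  assumes "is_3cnf \<phi>"
  shows "posterior (reduction \<phi>) = mass (network \<phi>) True (consistent \<phi>) /
      (mass (network \<phi>) True (consistent \<phi>) + mass (network \<phi>) False (consistent \<phi>))"
    "hist_prob (reduction \<phi>) = mass (network \<phi>) True (consistent \<phi>) + mass (network \<phi>) False (consistent \<phi>)"
proof -
  have E: "hist_consistent (network \<phi>) (actseq (network \<phi>) 2) 0 (\<lambda>w t. even w) = consistent \<phi>"
    using hist_consistent_reduction[OF assms] by auto
  show h: "hist_prob (reduction \<phi>) = mass (network \<phi>) True (consistent \<phi>) + mass (network \<phi>) False (consistent \<phi>)"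
    unfolding hist_prob_def reduction_simps prob_mass E by simp
  show "posterior (reduction \<phi>) = mass (network \<phi>) True (consistent \<phi>) /
      (mass (network \<phi>) True (consistent \<phi>) + mass (network \<phi>) False (consistent \<phi>))"
    unfolding posterior_def h reduction_simps prob_mass E by simp
qed

text \<open>The profile with switch signal 0 and all other signals 1. Being consistent for every
  formula, it shows that the history has positive probability also in the unsatisfiable
  case.\<close>

definition disabled :: "nat \<Rightarrow> bool" where
  "disabled v \<longleftrightarrow> v \<noteq> 1"

lemma consistent_disabled: "consistent \<phi> disabled"
proof -
  have "pair_agent i \<noteq> 1" "lit_agent l \<noteq> 1" for i l by simp_all
  then show ?thesis by (simp add: consistent_def disabled_def)
qed

lemma mass_lower_True:
  assumes cnf: "is_3cnf \<phi>"
  shows "1/2 * (eps \<phi> True * (1/20) ^ num_vars \<phi>) \<le> mass (network \<phi>) True (consistent \<phi>)"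
proof -
  have "(1/20) ^ num_vars \<phi> \<le> (\<Prod>i < num_vars \<phi>. var_weight \<phi> True disabled i)"
    using var_weight_bounds(4)[OF consistent_disabled] by (intro power_le_prod) auto
  then have "1/2 * (eps \<phi> True * (1/20) ^ num_vars \<phi>) \<le> 1/2 * (eps \<phi> True * (\<Prod>i < num_vars \<phi>. var_weight \<phi> True disabled i))"
    using eps_bounds(1)[of \<phi> True] by (intro mult_left_mono) auto
  also have "\<dots> \<le> mass (network \<phi>) True (\<lambda>s. consistent \<phi> s \<and> s 1 = disabled 1)"
    using mass_consistent_pos[OF cnf consistent_disabled, of True] by (simp add: disabled_def)
  also have "\<dots> \<le> mass (network \<phi>) True (consistent \<phi>)"
    by (rule mass_mono[OF network_wf[OF cnf]]) simp
  finally show ?thesis .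
qed

text \<open>Each variable contributes odds of at least 2 for T, and switch signal 1 also favours
  T.\<close>

lemma mass_enabled_ratio:
  assumes cnf: "is_3cnf \<phi>"
  shows "2 ^ num_vars \<phi> * mass (network \<phi>) False (\<lambda>s. consistent \<phi> s \<and> s 1)
    \<le> 1 * mass (network \<phi>) True (\<lambda>s. consistent \<phi> s \<and> s 1)"
proof (rule mass_compare[OF network_wf[OF cnf] relevant_less])
  show "(consistent \<phi> s \<and> s 1) = (consistent \<phi> s' \<and> s' 1)" if "\<forall>v \<in> relevant \<phi>. s v = s' v" for s s'
    using consistent_cong[OF cnf that] that in_relevant(1) by blast
  fix s assume s: "consistent \<phi> s \<and> s 1"
  let ?W = "\<lambda>\<theta>. \<Prod>i < num_vars \<phi>. var_weight \<phi> \<theta> s i"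
  have b: "0 \<le> var_weight \<phi> False s i" "2 * var_weight \<phi> False s i \<le> var_weight \<phi> True s i" if "i < num_vars \<phi>" for i
    using var_weight_bounds(1,3)[OF conjunct1[OF s] that] by auto
  have "2 ^ num_vars \<phi> * ?W False = (\<Prod>i < num_vars \<phi>. 2 * var_weight \<phi> False s i)"
    by (simp add: prod.distrib)
  also have "\<dots> \<le> ?W True" using b by (intro prod_mono) auto
  finally have W: "2 ^ num_vars \<phi> * ?W False \<le> ?W True" .
  have e: "1 - eps \<phi> False \<le> 1 - eps \<phi> True" "0 \<le> 1 - eps \<phi> False"
    using eps_ratio_le[of \<phi>] eps_bounds[of \<phi> True] eps_bounds[of \<phi> False] by auto
  have "(1 - eps \<phi> False) * (2 ^ num_vars \<phi> * ?W False) \<le> (1 - eps \<phi> True) * ?W True"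
    using e W b by (intro mult_mono mult_nonneg_nonneg prod_nonneg) auto
  then show "2 ^ num_vars \<phi> * (\<Prod>v \<in> relevant \<phi>. likelihood (network \<phi>) False v (s v))
    \<le> 1 * (\<Prod>v \<in> relevant \<phi>. likelihood (network \<phi>) True v (s v))"
    unfolding prod_relevant using s by (simp add: mult.left_commute)
qed

text \<open>The variables can contribute 32^N in favour of T, but the switch costs 128^N.\<close>

lemma mass_disabled_ratio:
  assumes cnf: "is_3cnf \<phi>"
  shows "1 * mass (network \<phi>) True (\<lambda>s. consistent \<phi> s \<and> \<not> s 1)
    \<le> (1/4) ^ num_vars \<phi> * mass (network \<phi>) False (\<lambda>s. consistent \<phi> s \<and> \<not> s 1)"
proof (rule mass_compare[OF network_wf[OF cnf] relevant_less])
  show "(consistent \<phi> s \<and> \<not> s 1) = (consistent \<phi> s' \<and> \<not> s' 1)" if "\<forall>v \<in> relevant \<phi>. s v = s' v" for s s'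
    using consistent_cong[OF cnf that] that in_relevant(1) by blast
  fix s assume s: "consistent \<phi> s \<and> \<not> s 1"
  let ?W = "\<lambda>\<theta>. \<Prod>i < num_vars \<phi>. var_weight \<phi> \<theta> s i" and ?N = "num_vars \<phi>"
  have b: "0 \<le> var_weight \<phi> False s i" "0 \<le> var_weight \<phi> True s i" "var_weight \<phi> True s i \<le> 32 * var_weight \<phi> False s i"
    if "i < ?N" for i
    using var_weight_bounds(2,3,4)[OF conjunct1[OF s] that] by auto
  have "?W True \<le> (\<Prod>i < ?N. 32 * var_weight \<phi> False s i)" using b by (intro prod_mono) auto
  also have "\<dots> = 32 ^ ?N * ?W False" by (simp add: prod.distrib)
  finally have W: "?W True \<le> 32 ^ ?N * ?W False" .
  have W0: "0 \<le> ?W False" using b by (intro prod_nonneg) auto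
  have "(1/2 :: real) ^ (7 * (?N + 1)) \<le> (1/2) ^ (7 * ?N)" by (intro power_decreasing) auto
  also have "\<dots> = (1/128) ^ ?N" by (simp add: power_mult power_divide)
  finally have e: "eps \<phi> True \<le> (1/128) ^ ?N * eps \<phi> False"
    unfolding eps_ratio using eps_bounds(1)[of \<phi> False] by (intro mult_right_mono) auto
  have "eps \<phi> True * ?W True \<le> ((1/128) ^ ?N * eps \<phi> False) * (32 ^ ?N * ?W False)"
    using e W eps_bounds(1)[of \<phi> False] eps_bounds(1)[of \<phi> True] b
    by (intro mult_mono prod_nonneg) auto
  also have "\<dots> = ((1/128) ^ ?N * 32 ^ ?N) * (eps \<phi> False * ?W False)" by simp
  also have "(1/128 :: real) ^ ?N * 32 ^ ?N = (1/4) ^ ?N" by (simp flip: power_mult_distrib)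
  finally show "1 * (\<Prod>v \<in> relevant \<phi>. likelihood (network \<phi>) True v (s v))
    \<le> (1/4) ^ ?N * (\<Prod>v \<in> relevant \<phi>. likelihood (network \<phi>) False v (s v))"
    unfolding prod_relevant using s by simp
qed

text \<open>Only the constraints on the switch and on the pair agents are kept; their probabilities
  under F are \<open>eps \<phi> False\<close> and 1/9 each.\<close>

lemma mass_disabled_False:
  assumes cnf: "is_3cnf \<phi>"
  shows "mass (network \<phi>) False (\<lambda>s. consistent \<phi> s \<and> \<not> s 1) \<le> 1/2 * (eps \<phi> False * (1/9) ^ num_vars \<phi>)"
proof -
  let ?D = "insert 1 (pair_agent ` {..<num_vars \<phi>})" and ?g = "\<lambda>v. v \<noteq> 1"
  have D: "?D \<subseteq> {..<n_agents (network \<phi>)}"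
    by (auto simp del: network_simps intro!: agents_less)
  have one: "1 \<notin> pair_agent ` {..<num_vars \<phi>}" using pair_agent_eq(3)[symmetric] by auto
  have inj: "inj_on pair_agent {..<num_vars \<phi>}" by (auto simp: inj_on_def)
  have ne: "pair_agent i \<noteq> 1" for i by simp
  have "mass (network \<phi>) False (\<lambda>s. consistent \<phi> s \<and> \<not> s 1) \<le> mass (network \<phi>) False (\<lambda>s. \<forall>v \<in> ?D. s v = ?g v)"
    using ne by (intro mass_mono[OF network_wf[OF cnf]]) (auto simp: consistent_def)
  also have "\<dots> = 1/2 * (\<Prod>v \<in> ?D. likelihood (network \<phi>) False v (?g v))" by (rule mass_fixed[OF D])
  also have "(\<Prod>v \<in> ?D. likelihood (network \<phi>) False v (?g v)) = eps \<phi> False * (1/9) ^ num_vars \<phi>"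
    using one network_likelihood(1)[of \<phi> False False] ne
    by (simp add: prod.reindex[OF inj] network_likelihood)
  finally show ?thesis .
qed

lemma satisfiable_iff:
  assumes cnf: "is_3cnf \<phi>"
  shows "satisfiable \<phi> \<longleftrightarrow> (\<exists>s. consistent \<phi> s \<and> s 1)"
proof
  assume "satisfiable \<phi>"
  then obtain \<alpha> where \<alpha>: "\<forall>c \<in> set (snd \<phi>). \<exists>(v, b) \<in> set c. \<alpha> v = b" by (auto simp: satisfiable_def)
  \<comment> \<open>Only the agents of the literals true under \<open>\<alpha>\<close> get signal 0;
    the switch and the pair agents get signal 1.\<close>
  define s where "s w \<longleftrightarrow> \<not> (\<exists>v. w = lit_agent (v, \<alpha> v))" for w
  have "s (lit_agent (v, b)) \<longleftrightarrow> \<alpha> v \<noteq> b" "s (pair_agent i)" "s 1" for v b i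
    unfolding s_def using lit_agent_eq(3)[symmetric] pair_agent_eq(6) by auto
  moreover from this have "consistent \<phi> s"
    using \<alpha> unfolding consistent_def by fastforce
  ultimately show "\<exists>s. consistent \<phi> s \<and> s 1" by blast
next
  assume "\<exists>s. consistent \<phi> s \<and> s 1"
  then obtain s where s: "consistent \<phi> s" "s 1" by blast
  \<comment> \<open>Variables with no marked literal are set to False. A marked literal comes out
    true, because its negation is not marked as well.\<close>
  have "\<exists>(v, b) \<in> set c. (\<not> s (lit_agent (v, True))) = b" if c: "c \<in> set (snd \<phi>)" for c
  proof -
    obtain v b where l: "(v, b) \<in> set c" "\<not> s (lit_agent (v, b))"
      using s c unfolding consistent_def by fastforce
    have "v < num_vars \<phi>" using cnf c l(1) unfolding is_3cnf_def num_vars_def by fastforce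
    then have "s (lit_agent (v, False)) \<or> s (lit_agent (v, True))" using s by (auto simp: consistent_def)
    then have "(\<not> s (lit_agent (v, True))) = b" using l(2) by (cases b) auto
    then show ?thesis using l(1) by blast
  qed
  then show "satisfiable \<phi>" unfolding satisfiable_def by (intro exI[of _ "\<lambda>v. \<not> s (lit_agent (v, True))"]) blast
qed

text \<open>Here \<open>x\<close> is the mass of the unlikely state and \<open>r\<close> a bound on
  its odds. A total mass of at most 1 makes the bare mass a lower bound for the conditional
  probability.\<close>

lemma ratio_bounds:
  fixes x y :: real
  assumes "0 \<le> x" "0 < y" "x \<le> r * y" "x + y \<le> 1"
  shows "x \<le> x / (x + y)" "x / (x + y) \<le> r"
proof -
  have "0 < x + y" using assms by simp
  then show "x \<le> x / (x + y)" using assms(1,4) mult_left_mono[of "x + y" 1 x] by (simp add: le_divide_eq)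
  have "0 \<le> r" using assms(1-3) by (metis less_le_trans mult_neg_pos not_less)
  then have "x \<le> r * (x + y)" using assms(1,3) by (simp add: distrib_left add_increasing)
  then show "x / (x + y) \<le> r" using \<open>0 < x + y\<close> by (simp add: divide_le_eq)
qed

lemma posterior_satisfiable:
  assumes cnf: "is_3cnf \<phi>" and sat: "satisfiable \<phi>"
  shows "7/16 * (1/72) ^ num_vars \<phi> \<le> 1 - posterior (reduction \<phi>)"
    "1 - posterior (reduction \<phi>) \<le> 2 * (1/2) ^ num_vars \<phi>"
proof -
  let ?N = "num_vars \<phi>"
  let ?m = "\<lambda>\<theta>. mass (network \<phi>) \<theta> (consistent \<phi>)"
  define x where "x \<theta> = mass (network \<phi>) \<theta> (\<lambda>s. consistent \<phi> s \<and> s 1)" for \<theta>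
  define z where "z \<theta> = mass (network \<phi>) \<theta> (\<lambda>s. consistent \<phi> s \<and> \<not> s 1)" for \<theta>
  have split: "?m \<theta> = x \<theta> + z \<theta>" for \<theta>
    unfolding x_def z_def by (rule mass_split)
  note wf = network_wf[OF cnf]
  have z0: "0 \<le> z \<theta>" for \<theta> unfolding z_def by (rule mass_nonneg[OF wf])
  obtain s where s: "consistent \<phi> s" "s 1" using sat satisfiable_iff[OF cnf] by blast
  have "(1/72) ^ ?N \<le> (\<Prod>i < ?N. var_weight \<phi> False s i)"
    using var_weight_bounds(3)[OF s(1)] by (intro power_le_prod) auto
  moreover have "7/8 \<le> 1 - eps \<phi> False" using eps_bounds(2)[of \<phi> False] by simp
  ultimately have "7/8 * (1/72) ^ ?N \<le> (1 - eps \<phi> False) * (\<Prod>i < ?N. var_weight \<phi> False s i)"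
    by (intro mult_mono) auto
  then have xF: "7/16 * (1/72) ^ ?N \<le> x False"
    using mass_consistent_pos[OF cnf s(1), of False] s(2) by (simp add: x_def)
  \<comment> \<open>This is where the exponent 3(N + 1) matters: under F the disabled profiles weigh
    no more than a single consistent enabled pattern.\<close>
  have "eps \<phi> False * (1/9) ^ ?N = 1/8 * ((1/8) ^ ?N * (1/9) ^ ?N)"
    by (simp add: eps_def power_add power_mult power_divide)
  also have "(1/8) ^ ?N * (1/9) ^ ?N = (1/72 :: real) ^ ?N" by (simp flip: power_mult_distrib)
  finally have "z False \<le> 1/16 * (1/72) ^ ?N"
    using mass_disabled_False[OF cnf] by (simp add: z_def)
  moreover have "0 < (1/72 :: real) ^ ?N" by simp
  ultimately have zx: "z False \<le> x False" and x0: "0 < x False" using xF by linarith+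
  have "2 ^ ?N * x False \<le> x True" using mass_enabled_ratio[OF cnf] by (simp add: x_def)
  then have "x False \<le> (1/2) ^ ?N * x True" by (simp add: power_divide field_simps)
  moreover have "(1/2) ^ ?N * x True \<le> (1/2) ^ ?N * ?m True"
    using z0[of True] split[of True] by (intro mult_left_mono) auto
  \<comment> \<open>The factor 2 accounts for the disabled part, at most as large as the enabled
    part under F.\<close>
  ultimately have r: "?m False \<le> (2 * (1/2) ^ ?N) * ?m True"
    using zx split[of False] by linarith
  have pos: "0 < ?m True" 
  proof -
    have "0 < 1/2 * (eps \<phi> True * (1/20) ^ ?N)" using eps_bounds(1)[of \<phi> True] by simp
    then show ?thesis using mass_lower_True[OF cnf] by linarith
  qed
  have le1: "?m False + ?m True \<le> 1"
    using mass_le_half[OF wf, of False "consistent \<phi>"] mass_le_half[OF wf, of True "consistent \<phi>"] by linarith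
  have "0 \<le> ?m False" by (rule mass_nonneg[OF wf])
  note bounds = ratio_bounds[OF this pos r le1]
  have "1 - posterior (reduction \<phi>) = ?m False / (?m False + ?m True)"
    unfolding posterior_mass(1)[OF cnf] using pos \<open>0 \<le> ?m False\<close> by (simp add: field_simps)
  then show "7/16 * (1/72) ^ ?N \<le> 1 - posterior (reduction \<phi>)" "1 - posterior (reduction \<phi>) \<le> 2 * (1/2) ^ ?N"
    using bounds xF z0[of False] split[of False] by linarith+
qed

lemma posterior_unsatisfiable:
  assumes cnf: "is_3cnf \<phi>" and unsat: "\<not> satisfiable \<phi>"
  shows "1/2 * (eps \<phi> True * (1/20) ^ num_vars \<phi>) \<le> posterior (reduction \<phi>)"
    "posterior (reduction \<phi>) \<le> (1/4) ^ num_vars \<phi>"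
proof -
  let ?m = "\<lambda>\<theta>. mass (network \<phi>) \<theta> (consistent \<phi>)"
  note wf = network_wf[OF cnf]
  \<comment> \<open>Without satisfying assignment every consistent profile has switch signal
    0.\<close>
  have "consistent \<phi> = (\<lambda>s. consistent \<phi> s \<and> \<not> s 1)"
    using unsat satisfiable_iff[OF cnf] by blast
  then have r: "?m True \<le> (1/4) ^ num_vars \<phi> * ?m False"
    using mass_disabled_ratio[OF cnf] by simp
  have low: "1/2 * (eps \<phi> True * (1/20) ^ num_vars \<phi>) \<le> ?m True" by (rule mass_lower_True[OF cnf])
  have "0 < 1/2 * (eps \<phi> True * (1/20) ^ num_vars \<phi>)" using eps_bounds(1)[of \<phi> True] by simp
  then have pos: "0 < ?m True" using low by linarith
  then have "?m False \<noteq> 0" using r by auto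
  then have posF: "0 < ?m False" using mass_nonneg[OF wf, of False "consistent \<phi>"] by simp
  have le1: "?m True + ?m False \<le> 1"
    using mass_le_half[OF wf, of False "consistent \<phi>"] mass_le_half[OF wf, of True "consistent \<phi>"] by linarith
  note bounds = ratio_bounds[OF less_imp_le[OF pos] posF r le1]
  then show "1/2 * (eps \<phi> True * (1/20) ^ num_vars \<phi>) \<le> posterior (reduction \<phi>)"
    "posterior (reduction \<phi>) \<le> (1/4) ^ num_vars \<phi>"
    unfolding posterior_mass(1)[OF cnf] using low by linarith+
qed

lemma reduction_wf:
  assumes cnf: "is_3cnf \<phi>"
  shows "bay_input_wf (reduction \<phi>)"
proof -
  have "0 < 1/2 * (eps \<phi> True * (1/20) ^ num_vars \<phi>)" using eps_bounds(1)[of \<phi> True] by simp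
  then have "0 < hist_prob (reduction \<phi>)"
    unfolding posterior_mass(2)[OF cnf]
    using mass_lower_True[OF cnf] mass_nonneg[OF network_wf[OF cnf], of False "consistent \<phi>"] by linarith
  then show ?thesis using network_wf[OF cnf] by (simp add: bay_input_wf_def)
qed

lemma card_network_edges:
  assumes "is_3cnf \<phi>"
  shows "card (set (network_edges \<phi>)) \<le> 5 * (num_vars \<phi> + num_clauses \<phi>)"
proof -
  have "length (clause_edges (fst \<phi> + j) (snd \<phi> ! j)) \<le> 5" if "j < length (snd \<phi>)" for j
  proof -
    have "snd \<phi> ! j \<in> set (snd \<phi>)" using that by simp
    then show ?thesis using assms by (auto simp: is_3cnf_def clause_edges_def)
  qed
  then have "sum_list (map (\<lambda>j. length (clause_edges (fst \<phi> + j) (snd \<phi> ! j))) [0..<length (snd \<phi>)])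
      \<le> sum_list (map (\<lambda>j. 5) [0..<length (snd \<phi>)])"
    by (intro sum_list_mono) auto
  moreover have "sum_list (map (\<lambda>i. length (variable_edges i)) [0..<fst \<phi>]) = 3 * fst \<phi>"
    by (simp add: variable_edges_def sum_list_triv)
  ultimately have "length (network_edges \<phi>) \<le> 5 * (num_vars \<phi> + num_clauses \<phi>)"
    by (simp add: network_edges_def length_concat comp_def num_vars_def num_clauses_def sum_list_triv)
  then show ?thesis using card_length[of "network_edges \<phi>"] by linarith
qed

section \<open>Constants of the exponential bounds\<close>

lemma exp_minus_le_half_power: "exp (- real k * real n) \<le> (1/2) ^ (k * n)"
proof -
  have "exp (-1) \<le> (1/2 :: real)"
    using exp_ge_add_one_self[of 1] by (simp add: exp_minus field_simps)
  then have "exp (-1) ^ (k * n) \<le> (1/2 :: real) ^ (k * n)" by (intro power_mono) auto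
  then show ?thesis by (simp flip: exp_of_nat_mult)
qed

text \<open>The left side is 2^-(n-1); it remains to use n - 1 \<ge> n/2 and 2 \<ge> exp(1/2). For n
  = 1 it equals 1, so no exponential bound could hold; this is why the theorem starts at two
  variables.\<close>

lemma half_power_le_exp:
  assumes "2 \<le> n"
  shows "2 * (1/2) ^ n \<le> exp (- (1/4) * real n)"
proof -
  obtain k where k: "n = k + 1" "1 \<le> k" using assms by (cases n) auto
  have "exp (1/2) ^ k \<le> (2 :: real) ^ k" using exp_half_le2 by (intro power_mono) auto
  then have "exp (real k * (1/2)) \<le> (2 :: real) ^ k" by (simp only: exp_of_nat_mult)
  moreover have "exp (1/4 * real n) \<le> exp (real k * (1/2))" using k by simp
  ultimately have "exp (1/4 * real n) \<le> 2 ^ k" by linarith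
  then have "inverse (2 ^ k) \<le> inverse (exp (1/4 * real n))" by (intro le_imp_inverse_le) auto
  moreover have "2 * (1/2) ^ n = inverse ((2 :: real) ^ k)" using k(1) by (simp add: power_divide field_simps)
  moreover have "inverse (exp (1/4 * real n)) = exp (- (1/4) * real n)" by (simp add: exp_minus[symmetric])
  ultimately show ?thesis by linarith
qed

text \<open>Rounding 1/20 down to 2^-5, the second bound needs the exponent 1 + 10(n + 1) + 5n = 15n
  + 11, which is at most 26n. The first bound is weaker.\<close>

lemma posterior_lower_exponents:
  assumes "1 \<le> n"
  shows "exp (- 26 * real n) \<le> 7/16 * (1/72) ^ n"
    "exp (- 26 * real n) \<le> 1/2 * ((1/2) ^ (10 * (n + 1)) * (1/20) ^ n)"
proof -
  have e: "exp (- 26 * real n) \<le> (1/2) ^ (26 * n)" using exp_minus_le_half_power[of 26 n] by simp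
  have "(1/2 :: real) ^ (26 * n) \<le> (1/2) ^ (2 + 7 * n)" using assms by (intro power_decreasing) auto
  also have "\<dots> = 1/4 * (1/128) ^ n" by (simp add: power_add power_mult power_divide)
  also have "\<dots> \<le> 7/16 * (1/72) ^ n" by (intro mult_mono power_mono) auto
  finally show "exp (- 26 * real n) \<le> 7/16 * (1/72) ^ n" using e by linarith
  have "(1/2 :: real) ^ (26 * n) \<le> (1/2) ^ (1 + (10 * (n + 1) + 5 * n))" using assms by (intro power_decreasing) auto
  also have "\<dots> = 1/2 * ((1/2) ^ (10 * (n + 1)) * (1/32) ^ n)"
  proof -
    have "(1/2 :: real) ^ (5 * n) = (1/32) ^ n" by (simp add: power_mult power_divide)
    then show ?thesis by (simp only: power_add power_one_right)
  qed
  also have "\<dots> \<le> 1/2 * ((1/2) ^ (10 * (n + 1)) * (1/20) ^ n)" by (intro mult_left_mono power_mono) auto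
  finally show "exp (- 26 * real n) \<le> 1/2 * ((1/2) ^ (10 * (n + 1)) * (1/20) ^ n)" using e by linarith
qed

theorem theorem1:
  shows "\<exists>red :: cnf \<Rightarrow> bay_input.
    poly_time_on is_3cnf enc_cnf (\<lambda>\<phi>. enc_bay_discrete (red \<phi>)) \<and>
    poly_time_probs red \<and>
    (\<forall>\<phi>. is_3cnf \<phi> \<longrightarrow>
       bay_input_wf (red \<phi>) \<and> time (red \<phi>) = 2 \<and> no_signal (net (red \<phi>)) (agent (red \<phi>))) \<and>
    (\<exists>C c c1 c2 :: real. \<exists>N0 :: nat. 0 < c \<and> 0 < c1 \<and> 0 < c2 \<and>
      (\<forall>\<phi>. is_3cnf \<phi> \<and> N0 \<le> num_vars \<phi> \<longrightarrow>
         real (n_agents (net (red \<phi>))) \<le> C * real (num_vars \<phi> + num_clauses \<phi>) \<and>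
         real (card (set (edges (net (red \<phi>))))) \<le> C * real (num_vars \<phi> + num_clauses \<phi>) \<and>
         (\<forall>v < n_agents (net (red \<phi>)). \<forall>\<theta>.
            exp (- c * real (num_vars \<phi>)) \<le> sig_prob (net (red \<phi>)) \<theta> v \<and>
            sig_prob (net (red \<phi>)) \<theta> v \<le> 1 - exp (- c * real (num_vars \<phi>))) \<and>
         (satisfiable \<phi> \<longrightarrow>
            exp (- c2 * real (num_vars \<phi>)) \<le> 1 - posterior (red \<phi>) \<and>
            1 - posterior (red \<phi>) \<le> exp (- c1 * real (num_vars \<phi>))) \<and>
         (\<not> satisfiable \<phi> \<longrightarrow>
            exp (- c2 * real (num_vars \<phi>)) \<le> posterior (red \<phi>) \<and>
            posterior (red \<phi>) \<le> exp (- c1 * real (num_vars \<phi>)))))"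
proof (intro exI[of _ reduction] conjI)
  show "poly_time_on is_3cnf enc_cnf (\<lambda>\<phi>. enc_bay_discrete (reduction \<phi>))" by (rule poly_time_reduction)
  show "poly_time_probs reduction" by (rule poly_time_probs_reduction)
  show "\<forall>\<phi>. is_3cnf \<phi> \<longrightarrow> bay_input_wf (reduction \<phi>) \<and> time (reduction \<phi>) = 2 \<and>
      no_signal (net (reduction \<phi>)) (agent (reduction \<phi>))"
    using reduction_wf by (simp add: no_signal_def network_prob)
  have bounds: "real (n_agents (net (reduction \<phi>))) \<le> 12 * real (num_vars \<phi> + num_clauses \<phi>) \<and>
         real (card (set (edges (net (reduction \<phi>))))) \<le> 12 * real (num_vars \<phi> + num_clauses \<phi>) \<and>
         (\<forall>v < n_agents (net (reduction \<phi>)). \<forall>\<theta>.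
            exp (- 20 * real (num_vars \<phi>)) \<le> sig_prob (net (reduction \<phi>)) \<theta> v \<and>
            sig_prob (net (reduction \<phi>)) \<theta> v \<le> 1 - exp (- 20 * real (num_vars \<phi>))) \<and>
         (satisfiable \<phi> \<longrightarrow>
            exp (- 26 * real (num_vars \<phi>)) \<le> 1 - posterior (reduction \<phi>) \<and>
            1 - posterior (reduction \<phi>) \<le> exp (- (1/4) * real (num_vars \<phi>))) \<and>
         (\<not> satisfiable \<phi> \<longrightarrow>
            exp (- 26 * real (num_vars \<phi>)) \<le> posterior (reduction \<phi>) \<and>
            posterior (reduction \<phi>) \<le> exp (- (1/4) * real (num_vars \<phi>)))"
    if "is_3cnf \<phi> \<and> 2 \<le> num_vars \<phi>" for \<phi>
  proof (intro conjI allI impI)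
    let ?N = "num_vars \<phi>"
    have cnf: "is_3cnf \<phi>" and N: "2 \<le> ?N" using that by auto
    show "real (n_agents (net (reduction \<phi>))) \<le> 12 * real (?N + num_clauses \<phi>)" using N by simp
    show "real (card (set (edges (net (reduction \<phi>))))) \<le> 12 * real (?N + num_clauses \<phi>)"
      using card_network_edges[OF cnf] by simp
    have "exp (- 20 * real ?N) \<le> (1/2) ^ (20 * ?N)" using exp_minus_le_half_power[of 20 ?N] by simp
    also have "(1/2 :: real) ^ (20 * ?N) \<le> (1/2) ^ (10 * (?N + 1))" using N by (intro power_decreasing) auto
    finally show "exp (- 20 * real ?N) \<le> sig_prob (net (reduction \<phi>)) \<theta> v"
      "sig_prob (net (reduction \<phi>)) \<theta> v \<le> 1 - exp (- 20 * real ?N)" for \<theta> v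
      using network_prob_bounds(1,2)[of \<phi> \<theta> v] unfolding reduction_simps by linarith+
    show "exp (- 26 * real ?N) \<le> 1 - posterior (reduction \<phi>)" if "satisfiable \<phi>"
      using posterior_lower_exponents(1)[of ?N] posterior_satisfiable(1)[OF cnf that] N by linarith
    show "1 - posterior (reduction \<phi>) \<le> exp (- (1/4) * real ?N)" if "satisfiable \<phi>"
      using half_power_le_exp[OF N] posterior_satisfiable(2)[OF cnf that] by linarith
    have "eps \<phi> True = (1/2) ^ (10 * (?N + 1))" by (simp add: eps_def)
    then show "exp (- 26 * real ?N) \<le> posterior (reduction \<phi>)" if "\<not> satisfiable \<phi>"
      using posterior_lower_exponents(2)[of ?N] posterior_unsatisfiable(1)[OF cnf that] N by simp
    have "(1/4 :: real) ^ ?N \<le> (1/2) ^ ?N" by (intro power_mono) auto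
    also have "\<dots> \<le> 2 * (1/2) ^ ?N" by simp
    finally show "posterior (reduction \<phi>) \<le> exp (- (1/4) * real ?N)" if "\<not> satisfiable \<phi>"
      using half_power_le_exp[OF N] posterior_unsatisfiable(2)[OF cnf that] by linarith
  qed
  show "\<exists>C c c1 c2 :: real. \<exists>N0 :: nat. 0 < c \<and> 0 < c1 \<and> 0 < c2 \<and>
      (\<forall>\<phi>. is_3cnf \<phi> \<and> N0 \<le> num_vars \<phi> \<longrightarrow>
         real (n_agents (net (reduction \<phi>))) \<le> C * real (num_vars \<phi> + num_clauses \<phi>) \<and>
         real (card (set (edges (net (reduction \<phi>))))) \<le> C * real (num_vars \<phi> + num_clauses \<phi>) \<and>
         (\<forall>v < n_agents (net (reduction \<phi>)). \<forall>\<theta>.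
            exp (- c * real (num_vars \<phi>)) \<le> sig_prob (net (reduction \<phi>)) \<theta> v \<and>
            sig_prob (net (reduction \<phi>)) \<theta> v \<le> 1 - exp (- c * real (num_vars \<phi>))) \<and>
         (satisfiable \<phi> \<longrightarrow>
            exp (- c2 * real (num_vars \<phi>)) \<le> 1 - posterior (reduction \<phi>) \<and>
            1 - posterior (reduction \<phi>) \<le> exp (- c1 * real (num_vars \<phi>))) \<and>
         (\<not> satisfiable \<phi> \<longrightarrow>
            exp (- c2 * real (num_vars \<phi>)) \<le> posterior (reduction \<phi>) \<and>
            posterior (reduction \<phi>) \<le> exp (- c1 * real (num_vars \<phi>))))"
    \<comment> \<open>12 absorbs the constant in 8(N + M) + 4, and 20 comes from 10(N + 1) \<le>
      20N; both need only N \<ge> 1.\<close>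
    using bounds by (intro exI[of _ 12] exI[of _ 20] exI[of _ "1/4"] exI[of _ 26] exI[of _ 2] conjI allI impI) simp_all
qed

end
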